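(* Let $\phi$ be smooth of finite type near the origin of $\mathbb R^2$ with $\phi(0,0)=0$, $\nabla\phi(0,0)=0$, and assume that the coordinates $(x_1,x_2)$ are linearly adapted but not adapted to $\phi$. Let $S$ be the graph of $\phi$ over $\Omega$, with surface measure $d\sigma$, and let $x^0=0\in S$. Let $p\ge1$ and let $0\le\rho\in C_0^\infty(S)$ be supported in a neighborhood of $x^0$, and assume that the Fourier restriction estimate $$\Big(\int_S|\widehat f|^2\,\rho\,d\sigma\Big)^{1/2}\le C_p\|f\|_{L^p(\mathbb R^3)},\qquad f\in\mathcal S(\mathbb R^3),$$ holds true. Then, if $\rho(x^0)\ne0$, necessarily $p'\ge p_c':=2h^r(\phi)+2$.
   Context: Setting. $\Omega$ is a sufficiently small open neighborhood of the origin in $\mathbb R^2$; $d\sigma$ is the Riemannian surface measure on $S=\{(x_1,x_2,\phi(x_1,x_2)):(x_1,x_2)\in\Omega\}$; $1/p+1/p'=1$. Finite type means that the Taylor series of $\phi$ at $0$ is not identically zero. Newton notions. With Taylor series $\phi\sim\sum c_{\alpha_1,\alpha_2}x_1^{\alpha_1}x_2^{\alpha_2}$ at $0$, the Taylor support is $\{\alpha\in\mathbb N^2:c_\alpha\ne0\}$ and the Newton polyhedron $\mathcal N(\phi)$ is the convex hull of the union of all quadrants $\alpha+\mathbb R_+^2$ with $\alpha$ in the Taylor support. The Newton distance $d=d(\phi)$: $(d,d)$ is the point where the bisectrix $t_1=t_2$ meets the boundary of $\mathcal N(\phi)$; the principal face $\pi(\phi)$ is the face (edge or vertex) of minimal dimension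 containing $(d,d)$; $\phi_{\rm pr}=\sum_{\alpha\in\pi(\phi)}c_\alpha x^\alpha$. A local coordinate system at the origin is a smooth coordinate system near $0$ preserving $0$; $d_y$ is the Newton distance of $\phi$ expressed in the coordinates $y$; the height is $h(\phi)=\sup_yd_y$; coordinates $x$ are adapted if $d_x=h(\phi)$. $h_{\rm lin}(\phi)=\sup\{d(\phi\circ T):T\in GL(2,\mathbb R)\}$, and a linear coordinate system $y$ is linearly adapted if $d_y=h_{\rm lin}(\phi)$. If the coordinates are linearly adapted but not adapted, $\pi(\phi)$ is a compact edge on a unique line $L=\{\kappa_1t_1+\kappa_2t_2=1\}$; after permuting $x_1,x_2$ one always assumes $0<\kappa_1\le\kappa_2$; then $m:=\kappa_2/\kappa_1$ is an integer $\ge2$, and $d=1/(\kappa_1+\kappa_2)$. Principal root jet. $\psi$ is the smooth function near $0$ given by Varchenko's algorithm: when the coordinates are not adapted, $\phi_{\rm pr}$ has a unique real root $x_2=b_1x_1^{m_1}$ ($m_1=m$, $b_1\ne0$) of multiplicity $>d(\phi)$; pass to the coordinates $(x_1,x_2-b_1x_1^{m_1})$, and repeat as long as the new coordinates are not adapted, obtaining integers $m_1<m_2<\cdots$ and $b_k\ne0$. If one reaches adapted coordinates after $K$ steps, $\psi(x_1)=\sum_{k\le K}b_kx_1^{m_k}$; otherwise $\psi$ is a smooth function with Taylor series $\sum_kb_kx_1^{m_k}$. The coordinates $y_1=x_1$, $y_2=x_2-\psi(x_1)$ are adapted, and $\phi^a(y):=\phi(y_1,y_2+\psi(y_1))$.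 Restriction height. Let $(A_l,B_l)$, $l=0,\dots,n$, be the vertices of $\mathcal N(\phi^a)$, $A_{l-1}<A_l$, with compact edges $\gamma_l=[(A_{l-1},B_{l-1}),(A_l,B_l)]$ contained in lines $\{\kappa_1^lt_1+\kappa_2^lt_2=1\}$, $a_l:=\kappa_2^l/\kappa_1^l$ ($1\le l\le n$). For the unbounded horizontal edge put $\kappa^{n+1}=(0,1/B_n)$, $a_{n+1}=\infty$. Set $h_l=\frac{1+m\kappa_1^l-\kappa_2^l}{\kappa_1^l+\kappa_2^l}$ (so $h_{n+1}=B_n-1$) and $h^r(\phi):=\max\big(d,\max_{\{1\le l\le n+1:\,a_l>m\}}h_l\big)$. *)

theory Defs
  imports "HOL-Analysis.Analysis" "HOL-Computational_Algebra.Polynomial"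
begin

section \<open>Smooth functions\<close>

definition dirderiv ::
    "'a::real_normed_vector \<Rightarrow> ('a \<Rightarrow> 'b::real_normed_vector) \<Rightarrow> 'a \<Rightarrow> 'b" where
  "dirderiv v f = (\<lambda>x. frechet_derivative f (at x) v)"

primrec Ck_on ::
    "nat \<Rightarrow> 'a::real_normed_vector set \<Rightarrow> ('a \<Rightarrow> 'b::real_normed_vector) \<Rightarrow> bool" where
  "Ck_on 0 U f \<longleftrightarrow> continuous_on U f"
| "Ck_on (Suc k) U f \<longleftrightarrow>
     (\<forall>x\<in>U. f differentiable (at x)) \<and> (\<forall>v. Ck_on k U (dirderiv v f))"

text \<open>Meant for open \<open>U\<close> only, since the derivatives are two-sided ones.\<close>

definition smooth_on ::
    "'a::real_normed_vector set \<Rightarrow> ('a \<Rightarrow> 'b::real_normed_vector) \<Rightarrow> bool" where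
  "smooth_on U f \<longleftrightarrow> (\<forall>k. Ck_on k U f)"

definition smooth_near_0 ::
    "('a::real_normed_vector \<Rightarrow> 'b::real_normed_vector) \<Rightarrow> bool" where
  "smooth_near_0 f \<longleftrightarrow> (\<exists>U. open U \<and> 0 \<in> U \<and> smooth_on U f)"


section \<open>Newton polyhedra\<close>

definition taylor_coeff :: "(real \<times> real \<Rightarrow> real) \<Rightarrow> nat \<Rightarrow> nat \<Rightarrow> real" where
  "taylor_coeff \<phi> j k =
     ((dirderiv (1, 0) ^^ j) ((dirderiv (0, 1) ^^ k) \<phi>)) 0 / (fact j * fact k)"

definition taylor_support :: "(real \<times> real \<Rightarrow> real) \<Rightarrow> (nat \<times> nat) set" where
  "taylor_support \<phi> = {(j, k). taylor_coeff \<phi> j k \<noteq> 0}"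

definition finite_type :: "(real \<times> real \<Rightarrow> real) \<Rightarrow> bool" where
  "finite_type \<phi> \<longleftrightarrow> taylor_support \<phi> \<noteq> {}"

definition newton_polyhedron :: "(real \<times> real \<Rightarrow> real) \<Rightarrow> (real \<times> real) set" where
  "newton_polyhedron \<phi> =
     convex hull (\<Union>(j, k)\<in>taylor_support \<phi>. {(t1, t2). real j \<le> t1 \<and> real k \<le> t2})"

definition newton_distance :: "(real \<times> real \<Rightarrow> real) \<Rightarrow> real" where
  "newton_distance \<phi> = (THE d. (d, d) \<in> frontier (newton_polyhedron \<phi>))"

definition principal_face :: "(real \<times> real \<Rightarrow> real) \<Rightarrow> (real \<times> real) set" where
  "principal_face \<phi> =
     (let N = newton_polyhedron \<phi>; d = newton_distance \<phi> in
      THE F. F face_of N \<and> (d, d) \<in> F \<and>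
        (\<forall>G. G face_of N \<and> (d, d) \<in> G \<longrightarrow> aff_dim F \<le> aff_dim G))"

text \<open>The principal part as an element of \<open>\<real>[x\<^sub>1][x\<^sub>2]\<close>: the outer variable is \<open>x\<^sub>2\<close>, so that
  the root \<open>x\<^sub>2 = b x\<^sub>1\<^sup>m\<close> is the root \<open>monom b m\<close> of this polynomial over \<open>\<real>[x\<^sub>1]\<close>, and its
  multiplicity is \<open>order (monom b m)\<close>. The sum is finite when the principal face is compact;
  the principal part is only used in that case.\<close>

definition principal_part :: "(real \<times> real \<Rightarrow> real) \<Rightarrow> real poly poly" where
  "principal_part \<phi> =
     (\<Sum>(j, k)\<in>{(j, k). (j, k) \<in> taylor_support \<phi> \<and> (real j, real k) \<in> principal_face \<phi>}.
        monom (monom (taylor_coeff \<phi> j k) j) k)"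


section \<open>Height, adapted and linearly adapted coordinates\<close>

text \<open>A coordinate system \<open>y\<close> is given by the map \<open>\<Phi>\<close> with \<open>x = \<Phi>(y)\<close>, so that the function
  \<open>\<phi>\<close> expressed in the coordinates \<open>y\<close> is \<open>\<phi> \<circ> \<Phi>\<close>.\<close>

definition local_coordinates :: "(real \<times> real \<Rightarrow> real \<times> real) \<Rightarrow> bool" where
  "local_coordinates \<Phi> \<longleftrightarrow> \<Phi> 0 = 0 \<and>
     (\<exists>U V \<Psi>. open U \<and> 0 \<in> U \<and> open V \<and> smooth_on U \<Phi> \<and> smooth_on V \<Psi> \<and>
        \<Phi> ` U = V \<and> (\<forall>y\<in>U. \<Psi> (\<Phi> y) = y))"

definition height :: "(real \<times> real \<Rightarrow> real) \<Rightarrow> real" where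
  "height \<phi> = (SUP \<Phi>\<in>{\<Phi>. local_coordinates \<Phi>}. newton_distance (\<phi> \<circ> \<Phi>))"

definition adapted :: "(real \<times> real \<Rightarrow> real) \<Rightarrow> bool" where
  "adapted \<phi> \<longleftrightarrow> newton_distance \<phi> = height \<phi>"

definition linear_height :: "(real \<times> real \<Rightarrow> real) \<Rightarrow> real" where
  "linear_height \<phi> = (SUP T\<in>{T. linear T \<and> bij T}. newton_distance (\<phi> \<circ> T))"

definition linearly_adapted :: "(real \<times> real \<Rightarrow> real) \<Rightarrow> bool" where
  "linearly_adapted \<phi> \<longleftrightarrow> newton_distance \<phi> = linear_height \<phi>"

text \<open>The pair \<open>(\<kappa>\<^sub>1, \<kappa>\<^sub>2)\<close> for which the edge \<open>\<gamma>\<close> lies on the line \<open>\<kappa>\<^sub>1t\<^sub>1 + \<kappa>\<^sub>2t\<^sub>2 = 1\<close>; it is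
  unique for the compact edges of a Newton polyhedron, whose lines avoid the origin.\<close>

definition edge_weight :: "(real \<times> real) set \<Rightarrow> real \<times> real" where
  "edge_weight \<gamma> = (THE \<kappa>. \<gamma> \<subseteq> {(t1, t2). fst \<kappa> * t1 + snd \<kappa> * t2 = 1})"

definition principal_weight :: "(real \<times> real \<Rightarrow> real) \<Rightarrow> real \<times> real" where
  "principal_weight \<phi> = edge_weight (principal_face \<phi>)"

definition principal_exponent :: "(real \<times> real \<Rightarrow> real) \<Rightarrow> real" where
  "principal_exponent \<phi> = snd (principal_weight \<phi>) / fst (principal_weight \<phi>)"


section \<open>Principal root jet and restriction height\<close>

text \<open>The function \<open>\<phi>\<close> in the coordinates \<open>y\<^sub>1 = x\<^sub>1\<close>, \<open>y\<^sub>2 = x\<^sub>2 - \<psi>(x\<^sub>1)\<close>.\<close>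

definition shear :: "(real \<Rightarrow> real) \<Rightarrow> (real \<times> real \<Rightarrow> real) \<Rightarrow> real \<times> real \<Rightarrow> real" where
  "shear \<psi> \<phi> = (\<lambda>(y1, y2). \<phi> (y1, y2 + \<psi> y1))"

definition varchenko_root :: "(real \<times> real \<Rightarrow> real) \<Rightarrow> real \<Rightarrow> nat \<Rightarrow> bool" where
  "varchenko_root \<phi> b m \<longleftrightarrow>
     b \<noteq> 0 \<and> newton_distance \<phi> < real (order (monom b m) (principal_part \<phi>))"

text \<open>The \<open>k\<close>-th step of the algorithm (counted from \<open>0\<close>) starts from \<open>\<phi>\<close> in the coordinates
  obtained by the first \<open>k\<close> steps.\<close>

definition varchenko_step ::
    "(real \<times> real \<Rightarrow> real) \<Rightarrow> (nat \<Rightarrow> real) \<Rightarrow> (nat \<Rightarrow> nat) \<Rightarrow> nat \<Rightarrow> bool" where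
  "varchenko_step \<phi> b m k \<longleftrightarrow>
     (let \<phi>k = shear (\<lambda>s. \<Sum>i<k. b i * s ^ m i) \<phi> in
      \<not> adapted \<phi>k \<and> varchenko_root \<phi>k (b k) (m k))"

text \<open>In the non-terminating case \<open>\<psi>\<close> is determined only up to a flat function, so this is a
  relation. The inner sum there has at most one term because \<open>m\<close> is strictly increasing.\<close>

definition principal_root_jet :: "(real \<times> real \<Rightarrow> real) \<Rightarrow> (real \<Rightarrow> real) \<Rightarrow> bool" where
  "principal_root_jet \<phi> \<psi> \<longleftrightarrow>
     (\<exists>b m K. (\<forall>k<K. varchenko_step \<phi> b m k) \<and> strict_mono_on {..<K} m \<and>
        \<psi> = (\<lambda>s. \<Sum>k<K. b k * s ^ m k) \<and> adapted (shear \<psi> \<phi>)) \<or>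
     (\<exists>b m. (\<forall>k. varchenko_step \<phi> b m k) \<and> strict_mono m \<and> smooth_near_0 \<psi> \<and>
        (\<forall>i. (deriv ^^ i) \<psi> 0 / fact i = (\<Sum>k\<in>{k. m k = i}. b k)))"

definition compact_edges :: "(real \<times> real) set \<Rightarrow> (real \<times> real) set set" where
  "compact_edges N = {\<gamma>. \<gamma> face_of N \<and> aff_dim \<gamma> = 1 \<and> compact \<gamma>}"

definition last_vertex :: "(real \<times> real) set \<Rightarrow> real \<times> real" where
  "last_vertex N = (ARG_MAX fst v. v extreme_point_of N)"

definition edge_height :: "real \<Rightarrow> real \<times> real \<Rightarrow> real" where
  "edge_height m \<kappa> = (1 + m * fst \<kappa> - snd \<kappa>) / (fst \<kappa> + snd \<kappa>)"

text \<open>The compact edges \<open>\<gamma>\<^sub>1, \<dots>, \<gamma>\<^sub>n\<close> of the Newton polyhedron of \<open>\<phi>\<^sup>a = shear \<psi> \<phi>\<close> are not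
  numbered. The term \<open>B\<^sub>n - 1\<close> is the contribution of the unbounded horizontal edge, which is
  always present since \<open>a\<^sub>n\<^sub>+\<^sub>1 = \<infinity> > m\<close>; it is \<open>edge_height m (0, 1 / B\<^sub>n)\<close> if \<open>B\<^sub>n \<noteq> 0\<close>.\<close>

definition restriction_height :: "(real \<times> real \<Rightarrow> real) \<Rightarrow> (real \<Rightarrow> real) \<Rightarrow> real" where
  "restriction_height \<phi> \<psi> =
     (let m = principal_exponent \<phi>; N = newton_polyhedron (shear \<psi> \<phi>) in
      Max ({newton_distance \<phi>, snd (last_vertex N) - 1} \<union>
        {edge_height m (edge_weight \<gamma>) | \<gamma>.
           \<gamma> \<in> compact_edges N \<and> snd (edge_weight \<gamma>) / fst (edge_weight \<gamma>) > m}))"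


section \<open>Fourier restriction to a graph\<close>

definition graph_map :: "(real \<times> real \<Rightarrow> real) \<Rightarrow> real \<times> real \<Rightarrow> real \<times> real \<times> real" where
  "graph_map \<phi> x = (fst x, snd x, \<phi> x)"

text \<open>The \<open>\<sigma>\<close>-algebra is that of the Borel subsets of the graph, so that functions are
  measurable or not regardless of their values off the graph.\<close>

definition surface_measure ::
    "(real \<times> real) set \<Rightarrow> (real \<times> real \<Rightarrow> real) \<Rightarrow> (real \<times> real \<times> real) measure" where
  "surface_measure \<Omega> \<phi> =
     distr
       (density (restrict_space lborel \<Omega>)
          (\<lambda>x. ennreal (sqrt (1 + (dirderiv (1, 0) \<phi> x)\<^sup>2 + (dirderiv (0, 1) \<phi> x)\<^sup>2))))
       (restrict_space borel (graph_map \<phi> ` \<Omega>)) (graph_map \<phi>)"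

text \<open>The space \<open>C\<^sub>0\<^sup>\<infinity>(S)\<close> for the graph \<open>S = graph_map \<phi> ` \<Omega>\<close>; only the values on \<open>S\<close> matter.\<close>

definition smooth_compactly_supported_on_graph ::
    "(real \<times> real) set \<Rightarrow> (real \<times> real \<Rightarrow> real) \<Rightarrow> (real \<times> real \<times> real \<Rightarrow> real) \<Rightarrow> bool" where
  "smooth_compactly_supported_on_graph \<Omega> \<phi> \<rho> \<longleftrightarrow>
     smooth_on \<Omega> (\<rho> \<circ> graph_map \<phi>) \<and>
     (\<exists>K. compact K \<and> K \<subseteq> \<Omega> \<and> (\<forall>x\<in>\<Omega> - K. \<rho> (graph_map \<phi> x) = 0))"

definition schwartz :: "('a::euclidean_space \<Rightarrow> complex) \<Rightarrow> bool" where
  "schwartz f \<longleftrightarrow> smooth_on UNIV f \<and>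
     (\<forall>N vs. bounded (range (\<lambda>x. (1 + norm x) ^ N *\<^sub>R fold dirderiv vs f x)))"

definition fourier :: "('a::euclidean_space \<Rightarrow> complex) \<Rightarrow> 'a \<Rightarrow> complex" where
  "fourier f \<xi> = (LINT x|lborel. cis (- (x \<bullet> \<xi>)) * f x)"

definition Lp_norm :: "real \<Rightarrow> ('a::euclidean_space \<Rightarrow> complex) \<Rightarrow> real" where
  "Lp_norm p f = (LINT x|lborel. norm (f x) powr p) powr (1 / p)"

definition restriction_estimate ::
    "'a::euclidean_space measure \<Rightarrow> ('a \<Rightarrow> real) \<Rightarrow> real \<Rightarrow> bool" where
  "restriction_estimate \<sigma> \<rho> p \<longleftrightarrow>
     (\<exists>C. \<forall>f. schwartz f \<longrightarrow>
        sqrt (LINT \<xi>|\<sigma>. (norm (fourier f \<xi>))\<^sup>2 * \<rho> \<xi>) \<le> C * Lp_norm p f)"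

end

theory Submission
  imports Defs "HOL-Probability.Characteristic_Functions"
begin

text \<open>
  The condition comes from Knapp boxes. If \<open>\<kappa>\<^sub>1, \<kappa>\<^sub>2 > 0\<close> and \<open>\<kappa>\<^sub>1t\<^sub>1 + \<kappa>\<^sub>2t\<^sub>2 \<ge> 1\<close> on the Newton polyhedron of
  \<open>\<phi>\<close> in the coordinates \<open>y\<^sub>1 = x\<^sub>1, y\<^sub>2 = x\<^sub>2 - \<psi>(x\<^sub>1)\<close>, then \<open>\<phi> = O(\<epsilon>)\<close> where \<open>\<bar>y\<^sub>i\<bar> \<le> \<epsilon>\<^bsup>\<kappa>\<^sub>i\<^esup>\<close>. If
  moreover \<open>\<psi>(s) = O(\<bar>s\<bar>\<^bsup>m\<^esup>)\<close> and \<open>m\<kappa>\<^sub>1 \<le> \<kappa>\<^sub>2\<close>, this piece of the surface, of measure about \<open>\<epsilon>\<^bsup>\<kappa>\<^sub>1+\<kappa>\<^sub>2\<^esup>\<close>,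
  lies in a box of volume about \<open>\<epsilon>\<^bsup>1+(1+m)\<kappa>\<^sub>1\<^esup>\<close>. Testing the estimate on a Gaussian whose Fourier transform is
  adapted to the box gives \<open>p' \<ge> 2(1 + (1 + m)\<kappa>\<^sub>1) / (\<kappa>\<^sub>1 + \<kappa>\<^sub>2)\<close>. The weights of the compact edges with
  \<open>a\<^sub>l > m\<close> give \<open>p' \<ge> 2h\<^sub>l + 2\<close>; the weights \<open>(\<delta>, (1 - \<delta>A\<^sub>n) / B\<^sub>n)\<close> with \<open>\<delta> \<rightarrow> 0\<close> give \<open>p' \<ge> 2B\<^sub>n\<close>; and \<open>\<psi> = 0\<close>
  with the principal weight gives \<open>p' \<ge> 2d + 2\<close>. That the first exponent of \<open>\<psi>\<close> is \<open>m = \<kappa>\<^sub>2 / \<kappa>\<^sub>1\<close> follows from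
  the existence of the root \<open>b x\<^sub>1\<^sup>m\<close> of the principal part.
\<close>

section \<open>Calculus of smooth functions\<close>

text \<open>The sides of the box are \<open>\<epsilon>\<close> to the powers
  \<open>\<kappa>1\<close>, \<open>m\<kappa>1\<close> and 1: the curve
  \<open>x2 = \<psi>(x1)\<close> sweeps a height of order \<open>m\<kappa>1\<close>, which absorbs
  the thickness of order \<open>\<kappa>2\<close> around it. For an edge the resulting exponent is
  exactly \<open>2h + 2\<close>, because \<open>h + 1\<close> has the numerator
  \<open>1 + (1 + m)\<kappa>1\<close>. Both entries of a weight must be positive: the Taylor
  remainder \<open>\<bar>y1\<bar>^n + \<bar>y2\<bar>^n\<close> is \<open>O(\<epsilon>)\<close> on
  the piece only if \<open>n\<kappa>1\<close> and \<open>n\<kappa>2\<close> are at least 1. So the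
  compactness of an edge has to be turned into positivity of its weight, and the horizontal edge,
  with \<open>\<kappa>1 = 0\<close>, is reached only in a limit. Of Varchenko's algorithm only the
  first step enters, through its exponent and the order of vanishing of \<open>\<psi>\<close>. The
  polyhedron in the sheared coordinates must be nonempty; this is proved by comparing decay at the
  origin, since a function with vanishing Taylor series is \<open>O(\<bar>z\<bar>^n)\<close> for all
  \<open>n\<close>, and conversely.\<close>

lemma dirderiv_eqI: "(f has_derivative f') (at x) \<Longrightarrow> dirderiv v f x = f' v"
  unfolding dirderiv_def using frechet_derivative_at by metis

lemma dirderiv_works: "f differentiable (at x) \<Longrightarrow> (f has_derivative (\<lambda>v. dirderiv v f x)) (at x)"
  unfolding dirderiv_def using frechet_derivative_works by auto

lemma dirderiv_cong_open:
  assumes "open U" "x \<in> U" "\<And>y. y \<in> U \<Longrightarrow> f y = g y" "f differentiable (at x)"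
  shows "dirderiv v f x = dirderiv v g x"
  unfolding dirderiv_def using frechet_derivative_transform_within_open[OF assms(4,1,2,3)] by simp

text \<open>The rules for \<open>dirderiv\<close> of a sum, product or composition hold only where
  the functions are differentiable, that is on \<open>U\<close>. Each closure proof computes the
  derivative on \<open>U\<close> and transfers the result through this lemma.\<close>

lemma Ck_on_cong:
  assumes "open U" "\<And>x. x \<in> U \<Longrightarrow> f x = g x" "Ck_on k U f"
  shows "Ck_on k U g"
  using assms(2,3)
proof (induction k arbitrary: f g)
  case 0
  then show ?case using continuous_on_cong[of U U f g] by simp
next
  case (Suc k)
  have diff: "f differentiable (at x)" if "x \<in> U" for x using Suc that by simp
  have "g differentiable (at x)" if x: "x \<in> U" for x
  proof -
    obtain f' where f': "(f has_derivative f') (at x)" using diff[OF x] by (auto simp: differentiable_def)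
    have "(g has_derivative f') (at x)"
      using has_derivative_transform_within_open[OF f' \<open>open U\<close> x] Suc.prems(1) by blast
    then show ?thesis by (auto simp: differentiable_def)
  qed
  moreover have "Ck_on k U (dirderiv v g)" for v
  proof (rule Suc.IH)
    show "dirderiv v f x = dirderiv v g x" if "x \<in> U" for x
      using dirderiv_cong_open[OF \<open>open U\<close> that Suc.prems(1) diff[OF that]] .
    show "Ck_on k U (dirderiv v f)" using Suc.prems by simp
  qed
  ultimately show ?case by simp
qed

lemma Ck_on_subset: "Ck_on k U f \<Longrightarrow> V \<subseteq> U \<Longrightarrow> Ck_on k V f"
  by (induction k arbitrary: f) (auto intro: continuous_on_subset)

lemma Ck_on_SucD: "Ck_on (Suc k) U f \<Longrightarrow> Ck_on k U f"
proof (induction k arbitrary: f)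
  case 0
  then show ?case
    by (auto intro!: continuous_at_imp_continuous_on differentiable_imp_continuous_within)
next
  case (Suc k)
  then show ?case by simp
qed

lemma dirderiv_const [simp]: "dirderiv v (\<lambda>_. c) = (\<lambda>_. 0)"
  by (rule ext, rule dirderiv_eqI, rule has_derivative_const)

lemma Ck_on_const: "Ck_on k U (\<lambda>_. c)"
  by (induction k arbitrary: c) (auto simp: dirderiv_const)

lemma Ck_on_add:
  assumes "open U" "Ck_on k U f" "Ck_on k U g"
  shows "Ck_on k U (\<lambda>x. f x + g x)"
  using assms(2,3)
proof (induction k arbitrary: f g)
  case 0
  then show ?case by (simp add: continuous_on_add)
next
  case (Suc k)
  have "Ck_on k U (dirderiv v (\<lambda>x. f x + g x))" for v
  proof (rule Ck_on_cong[OF \<open>open U\<close>])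
    show "Ck_on k U (\<lambda>x. dirderiv v f x + dirderiv v g x)" using Suc by simp
    show "dirderiv v f x + dirderiv v g x = dirderiv v (\<lambda>x. f x + g x) x" if "x \<in> U" for x
      using Suc.prems that
      by (intro dirderiv_eqI[symmetric] has_derivative_add dirderiv_works) auto
  qed
  then show ?case using Suc.prems by auto
qed

lemma Ck_on_mult:
  fixes f g :: "'a::real_normed_vector \<Rightarrow> 'b::real_normed_algebra"
  assumes "open U" "Ck_on k U f" "Ck_on k U g"
  shows "Ck_on k U (\<lambda>x. f x * g x)"
  using assms(2,3)
proof (induction k arbitrary: f g)
  case 0
  then show ?case by (simp add: continuous_on_mult)
next
  case (Suc k)
  have "Ck_on k U (dirderiv v (\<lambda>x. f x * g x))" for v
  proof (rule Ck_on_cong[OF \<open>open U\<close>])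
    show "Ck_on k U (\<lambda>x. f x * dirderiv v g x + dirderiv v f x * g x)"
      using Suc Ck_on_SucD[OF Suc.prems(1)] Ck_on_SucD[OF Suc.prems(2)]
      by (intro Ck_on_add[OF \<open>open U\<close>]) auto
    show "f x * dirderiv v g x + dirderiv v f x * g x = dirderiv v (\<lambda>x. f x * g x) x" if "x \<in> U" for x
      using Suc.prems that
      by (intro dirderiv_eqI[symmetric] has_derivative_mult dirderiv_works) auto
  qed
  then show ?case using Suc.prems by (auto intro: differentiable_mult)
qed

lemma Ck_on_bounded_linear:
  assumes L: "bounded_linear L"
  shows "Ck_on k U L"
proof (cases k)
  case 0
  then show ?thesis using L by (simp add: linear_continuous_on)
next
  case (Suc l)
  have "dirderiv v L = (\<lambda>_. L v)" for v
    by (rule ext, rule dirderiv_eqI, rule bounded_linear_imp_has_derivative[OF L])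
  then show ?thesis using Suc L
    by (auto simp: Ck_on_const intro: bounded_linear_imp_differentiable)
qed

text \<open>Serves to regard the derivative of \<open>\<eta>\<close> at \<open>fst y\<close> as a
  function of \<open>y\<close> in \<open>smooth_on_shear\<close>.\<close>

lemma Ck_on_compose_linear:
  assumes L: "bounded_linear L" and "open V" "Ck_on k V f"
  shows "Ck_on k (L -` V) (\<lambda>x. f (L x))"
  using assms(3)
proof (induction k arbitrary: f)
  case 0
  then show ?case
    by (auto intro: continuous_on_compose2[OF _ linear_continuous_on[OF L]])
next
  case (Suc k)
  have op: "open (L -` V)"
    using L \<open>open V\<close> by (auto intro!: open_vimage linear_continuous_on)
  have der: "((\<lambda>x. f (L x)) has_derivative (\<lambda>v. dirderiv (L v) f (L x))) (at x)"
    if "L x \<in> V" for x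
  proof -
    have "f differentiable (at (L x))" using Suc.prems that by auto
    from has_derivative_compose[OF bounded_linear_imp_has_derivative[OF L] dirderiv_works[OF this]]
    show ?thesis .
  qed
  have "Ck_on k (L -` V) (dirderiv v (\<lambda>x. f (L x)))" for v
  proof (rule Ck_on_cong[OF op])
    show "Ck_on k (L -` V) (\<lambda>x. dirderiv (L v) f (L x))" using Suc by auto
    show "dirderiv (L v) f (L x) = dirderiv v (\<lambda>x. f (L x)) x" if "x \<in> L -` V" for x
      using dirderiv_eqI[OF der] that by simp
  qed
  then show ?case using der by (auto simp: differentiable_def)
qed

lemma smooth_on_differentiable: "smooth_on U f \<Longrightarrow> x \<in> U \<Longrightarrow> f differentiable (at x)"
  unfolding smooth_on_def by (drule spec[of _ "Suc 0"]) simp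

lemma smooth_on_continuous: "smooth_on U f \<Longrightarrow> continuous_on U f"
  unfolding smooth_on_def by (drule spec[of _ 0]) simp

lemma smooth_on_dirderiv: "smooth_on U f \<Longrightarrow> smooth_on U (dirderiv v f)"
  unfolding smooth_on_def by (metis Ck_on.simps(2))

lemma smooth_on_dirderiv_pow: "smooth_on U f \<Longrightarrow> smooth_on U ((dirderiv v ^^ n) f)"
  by (induction n) (auto intro: smooth_on_dirderiv)

lemma smooth_on_subset: "smooth_on U f \<Longrightarrow> V \<subseteq> U \<Longrightarrow> smooth_on V f"
  unfolding smooth_on_def using Ck_on_subset by blast

lemma smooth_on_add: "open U \<Longrightarrow> smooth_on U f \<Longrightarrow> smooth_on U g \<Longrightarrow> smooth_on U (\<lambda>x. f x + g x)"
  unfolding smooth_on_def using Ck_on_add by blast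

lemma smooth_on_mult:
  fixes f g :: "'a::real_normed_vector \<Rightarrow> 'b::real_normed_algebra"
  shows "open U \<Longrightarrow> smooth_on U f \<Longrightarrow> smooth_on U g \<Longrightarrow> smooth_on U (\<lambda>x. f x * g x)"
  unfolding smooth_on_def using Ck_on_mult by blast

lemma smooth_on_const: "smooth_on U (\<lambda>_. c)"
  unfolding smooth_on_def by (simp add: Ck_on_const)

lemma smooth_on_power:
  fixes f :: "'a::real_normed_vector \<Rightarrow> 'b::real_normed_algebra_1"
  shows "open U \<Longrightarrow> smooth_on U f \<Longrightarrow> smooth_on U (\<lambda>x. f x ^ n)"
  by (induction n) (auto intro: smooth_on_const smooth_on_mult)

lemma smooth_on_sum:
  "open U \<Longrightarrow> (\<And>i. i \<in> I \<Longrightarrow> smooth_on U (f i)) \<Longrightarrow> smooth_on U (\<lambda>x. \<Sum>i\<in>I. f i x)"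
  by (induction I rule: infinite_finite_induct) (auto intro: smooth_on_const smooth_on_add)

lemma smooth_on_bounded_linear: "bounded_linear L \<Longrightarrow> smooth_on U L"
  unfolding smooth_on_def by (simp add: Ck_on_bounded_linear)

section \<open>Shears of the plane\<close>

text \<open>The derivative is written through shears of derivatives of \<open>f\<close>, by the same
  \<open>\<eta>\<close>. This is what lets the induction over the order of smoothness in
  \<open>smooth_on_shear\<close> close, with \<open>f\<close> arbitrary.\<close>

lemma has_derivative_shear:
  assumes \<eta>: "\<eta> differentiable (at (fst y))"
    and f: "f differentiable (at (fst y, snd y + \<eta> (fst y)))"
  shows "(shear \<eta> f has_derivative
    (\<lambda>v. shear \<eta> (dirderiv v f) y + fst v * dirderiv 1 \<eta> (fst y) * shear \<eta> (dirderiv (0, 1) f) y)) (at y)"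
proof -
  define g where "g = (\<lambda>y. (fst y, snd y + \<eta> (fst y)))"
  define g' where "g' = (\<lambda>v. (fst v, snd v + dirderiv (fst v) \<eta> (fst y)))"
  have \<eta>': "((\<lambda>y. \<eta> (fst y)) has_derivative (\<lambda>v. dirderiv (fst v) \<eta> (fst y))) (at y)"
    using has_derivative_compose[OF bounded_linear_imp_has_derivative[OF bounded_linear_fst] dirderiv_works[OF \<eta>]] .
  have g: "(g has_derivative g') (at y)"
    unfolding g_def g'_def
    by (intro has_derivative_Pair has_derivative_add \<eta>' bounded_linear_imp_has_derivative
        bounded_linear_fst bounded_linear_snd)
  have f': "(f has_derivative (\<lambda>v. dirderiv v f (g y))) (at (g y))"
    using dirderiv_works[OF f] by (simp add: g_def)
  have lin: "linear (\<lambda>v. dirderiv v f (g y))" using f' has_derivative_linear by blast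
  have "linear (\<lambda>s. dirderiv s \<eta> (fst y))" using dirderiv_works[OF \<eta>] has_derivative_linear by blast
  then have sc: "dirderiv s \<eta> (fst y) = s * dirderiv 1 \<eta> (fst y)" for s
    using linear_cmul[of "\<lambda>s. dirderiv s \<eta> (fst y)" s 1] by simp
  have "dirderiv (g' v) f (g y) = dirderiv v f (g y) + fst v * dirderiv 1 \<eta> (fst y) * dirderiv (0, 1) f (g y)" for v
  proof -
    have "g' v = v + (fst v * dirderiv 1 \<eta> (fst y)) *\<^sub>R (0, 1)"
      by (simp add: g'_def sc[of "fst v"] prod_eq_iff)
    then show ?thesis by (simp only: linear_add[OF lin] linear_cmul[OF lin] real_scaleR_def)
  qed
  moreover have "shear \<eta> h = (\<lambda>y. h (g y))" for h
    by (auto simp: shear_def g_def fun_eq_iff)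
  ultimately show ?thesis using has_derivative_compose[OF g f'] by simp
qed

lemma smooth_on_shear:
  assumes "open U" "smooth_on U f" "open V" "smooth_on V \<eta>" "open W"
    and W: "\<And>y. y \<in> W \<Longrightarrow> fst y \<in> V \<and> (fst y, snd y + \<eta> (fst y)) \<in> U"
  shows "smooth_on W (shear \<eta> f)"
proof -
  have "Ck_on k W (shear \<eta> f)" for k
    using assms(2)
  proof (induction k arbitrary: f)
    case 0
    have "continuous_on W (\<lambda>y. f (fst y, snd y + \<eta> (fst y)))"
      using W by (intro continuous_on_compose2[OF smooth_on_continuous[OF 0]] continuous_intros
          continuous_on_compose2[OF smooth_on_continuous[OF \<open>smooth_on V \<eta>\<close>]]) auto
    then show ?case by (simp add: shear_def case_prod_beta')
  next
    case (Suc k)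
    have der: "(shear \<eta> f has_derivative
      (\<lambda>v. shear \<eta> (dirderiv v f) y + fst v * dirderiv 1 \<eta> (fst y) * shear \<eta> (dirderiv (0, 1) f) y)) (at y)"
      if "y \<in> W" for y
      using W[OF that] Suc.prems \<open>smooth_on V \<eta>\<close>
      by (intro has_derivative_shear smooth_on_differentiable) auto
    have "Ck_on k W (dirderiv v (shear \<eta> f))" for v
    proof (rule Ck_on_cong[OF \<open>open W\<close>])
      have c: "Ck_on k W (\<lambda>y. dirderiv 1 \<eta> (fst y))"
        using smooth_on_dirderiv[OF \<open>smooth_on V \<eta>\<close>, of 1] W
        by (intro Ck_on_subset[OF Ck_on_compose_linear[OF bounded_linear_fst \<open>open V\<close>]])
           (auto simp: smooth_on_def)
      show "Ck_on k W (\<lambda>y. shear \<eta> (dirderiv v f) y + fst v * dirderiv 1 \<eta> (fst y) * shear \<eta> (dirderiv (0, 1) f) y)"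
        by (intro Ck_on_add[OF \<open>open W\<close>] Ck_on_mult[OF \<open>open W\<close>] Ck_on_const c Suc.IH smooth_on_dirderiv Suc.prems)
      show "shear \<eta> (dirderiv v f) y + fst v * dirderiv 1 \<eta> (fst y) * shear \<eta> (dirderiv (0, 1) f) y
         = dirderiv v (shear \<eta> f) y" if "y \<in> W" for y
        using dirderiv_eqI[OF der[OF that]] by simp
    qed
    moreover have "shear \<eta> f differentiable (at y)" if "y \<in> W" for y
      using der[OF that] unfolding differentiable_def by blast
    ultimately show ?case by simp
  qed
  then show ?thesis by (simp add: smooth_on_def)
qed

lemma smooth_near_0_shear:
  assumes "smooth_near_0 f" "smooth_near_0 \<eta>" "\<eta> 0 = 0"
  shows "smooth_near_0 (shear \<eta> f)"
proof -
  obtain U V where U: "open U" "0 \<in> U" "smooth_on U f" and V: "open V" "0 \<in> V" "smooth_on V \<eta>"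
    using assms by (auto simp: smooth_near_0_def)
  define g where "g = (\<lambda>y. (fst y, snd y + \<eta> (fst y)))"
  have cont: "continuous_on (fst -` V) g"
    unfolding g_def by (intro continuous_intros continuous_on_compose2[OF smooth_on_continuous[OF V(3)]]) auto
  have oV: "open (fst -` V :: (real \<times> real) set)" using V by (intro open_vimage continuous_intros)
  define W where "W = fst -` V \<inter> g -` U"
  have oW: "open W" unfolding W_def
    using continuous_on_open_vimage[OF oV] cont U(1) by (metis Int_commute)
  have "smooth_on W (shear \<eta> f)"
    by (rule smooth_on_shear[OF U(1,3) V(1,3) oW]) (auto simp: W_def g_def)
  moreover have "0 \<in> W" using U V assms(3) by (auto simp: W_def g_def zero_prod_def)
  ultimately show ?thesis using oW by (auto simp: smooth_near_0_def)
qed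

section \<open>Taylor expansion in two variables\<close>

lemma Maclaurin_remainder:
  fixes D :: "nat \<Rightarrow> real \<Rightarrow> real"
  assumes "\<And>i t. i < n \<Longrightarrow> \<bar>t\<bar> \<le> r \<Longrightarrow> (D i has_real_derivative D (Suc i) t) (at t)"
    and "\<And>t. \<bar>t\<bar> \<le> r \<Longrightarrow> \<bar>D n t\<bar> \<le> C" and "\<bar>x\<bar> \<le> r"
  shows "\<bar>D 0 x - (\<Sum>i<n. D i 0 / fact i * x ^ i)\<bar> \<le> C * \<bar>x\<bar> ^ n"
proof -
  obtain t where t: "\<bar>t\<bar> \<le> \<bar>x\<bar>"
    "D 0 x = (\<Sum>i<n. D i 0 / fact i * x ^ i) + D n t / fact n * x ^ n"
    using Maclaurin_bi_le[of D "D 0" n x] assms by fastforce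
  have "\<bar>D n t / fact n\<bar> \<le> \<bar>D n t\<bar>"
    using fact_ge_1[of n, where 'a=real] by (simp add: abs_divide divide_le_eq mult_left_mono[of 1 "fact n" "\<bar>D n t\<bar>", simplified])
  also have "\<dots> \<le> C" using assms t by auto
  finally have "\<bar>D n t / fact n\<bar> * \<bar>x\<bar> ^ n \<le> C * \<bar>x\<bar> ^ n" by (intro mult_right_mono) auto
  then show ?thesis using t(2) by (simp add: abs_mult power_abs)
qed

lemma has_real_derivative_line:
  fixes f :: "'a::real_normed_vector \<Rightarrow> real"
  assumes "f differentiable (at (a + t *\<^sub>R v))"
  shows "((\<lambda>t. f (a + t *\<^sub>R v)) has_real_derivative dirderiv v f (a + t *\<^sub>R v)) (at t)"
proof -
  have l: "((\<lambda>t. a + t *\<^sub>R v) has_derivative (\<lambda>s. s *\<^sub>R v)) (at t)"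
    by (auto intro!: derivative_eq_intros)
  have f: "(f has_derivative (\<lambda>v. dirderiv v f (a + t *\<^sub>R v'))) (at (a + t *\<^sub>R v'))" if "v' = v" for v'
    using dirderiv_works[OF assms] that by simp
  have "((\<lambda>t. f (a + t *\<^sub>R v)) has_derivative (\<lambda>s. dirderiv (s *\<^sub>R v) f (a + t *\<^sub>R v))) (at t)"
    using has_derivative_compose[OF l f] by simp
  moreover have "dirderiv (s *\<^sub>R v) f (a + t *\<^sub>R v) = dirderiv v f (a + t *\<^sub>R v) * s" for s
    using linear_cmul[OF has_derivative_linear[OF f[OF refl]]] by (simp add: mult.commute)
  ultimately show ?thesis by (simp add: has_field_derivative_def)
qed

text \<open>Truncation to a square of exponents, rather than by total degree, fits an expansion in
  one variable after the other and leaves the remainder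
  \<open>\<bar>x\<bar> ^ n + \<bar>y\<bar> ^ n\<close>.\<close>

definition taylor_poly :: "(real \<times> real \<Rightarrow> real) \<Rightarrow> nat \<Rightarrow> real \<Rightarrow> real \<Rightarrow> real" where
  "taylor_poly f n x y = (\<Sum>k<n. \<Sum>j<n. taylor_coeff f j k * x ^ j * y ^ k)"

text \<open>Expand in \<open>y\<close> at fixed \<open>x\<close>, then expand each coefficient, a
  function of \<open>x\<close> on the axis \<open>y = 0\<close>. The derivatives then appear in the
  order of \<open>taylor_coeff\<close>, with those in \<open>x2\<close> taken first.\<close>

lemma taylor_expansion:
  assumes f: "smooth_near_0 (f :: real \<times> real \<Rightarrow> real)"
  shows "\<exists>r>0. \<exists>C\<ge>0. \<forall>x y. \<bar>x\<bar> \<le> r \<longrightarrow> \<bar>y\<bar> \<le> r \<longrightarrow>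
      \<bar>f (x, y) - taylor_poly f n x y\<bar> \<le> C * (\<bar>x\<bar> ^ n + \<bar>y\<bar> ^ n)"
proof -
  obtain U where U: "open U" "0 \<in> U" "smooth_on U f" using f by (auto simp: smooth_near_0_def)
  obtain e where e: "e > 0" "ball 0 e \<subseteq> U" using U openE by blast
  \<comment> \<open>\<open>e / 3\<close> keeps the square inside the ball, since the norm is at most
    the sum of the coordinates; \<open>r \<le> 1\<close> bounds the factors
    \<open>\<bar>y\<bar> ^ k\<close> by 1.\<close>
  define r where "r = min 1 (e / 3)"
  have r: "r > 0" "r \<le> 1" using e by (auto simp: r_def)
  define Q where "Q = {(x, y). \<bar>x\<bar> \<le> r \<and> \<bar>y\<bar> \<le> (r::real)}"
  have Q_eq: "Q = {-r..r} \<times> {-r..r}" by (auto simp: Q_def abs_le_iff)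
  have QU: "z \<in> U" if "z \<in> Q" for z
  proof -
    have "norm z \<le> \<bar>fst z\<bar> + \<bar>snd z\<bar>" using norm_le_l1[of z] by (cases z) (simp add: norm_Pair sqrt_sum_squares_le_sum_abs)
    also have "\<dots> < e" using that e by (auto simp: Q_def r_def)
    finally show ?thesis using e by auto
  qed
  have cQ: "compact Q" unfolding Q_eq by (intro compact_Times) auto
  define g where "g = (\<lambda>k. (dirderiv (0, 1) ^^ k) f)"
  define h where "h = (\<lambda>k j. (dirderiv (1, 0) ^^ j) (g k))"
  have sg: "smooth_on U (g k)" for k unfolding g_def by (intro smooth_on_dirderiv_pow U)
  have sh: "smooth_on U (h k j)" for k j unfolding h_def by (intro smooth_on_dirderiv_pow sg)
  have bd: "\<exists>C. C \<ge> 0 \<and> (\<forall>z\<in>Q. \<bar>u z\<bar> \<le> C)" if "smooth_on U u" for u :: "real \<times> real \<Rightarrow> real"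
  proof -
    have "compact (u ` Q)"
      using QU by (intro compact_continuous_image[OF continuous_on_subset[OF smooth_on_continuous[OF that]] cQ]) auto
    then obtain C where "\<forall>x\<in>u ` Q. norm x \<le> C" using compact_imp_bounded bounded_iff by metis
    then show ?thesis by (intro exI[of _ "max C 0"]) auto
  qed
  obtain C1 where C1: "C1 \<ge> 0" "\<And>z. z \<in> Q \<Longrightarrow> \<bar>g n z\<bar> \<le> C1" using bd[OF sg] by blast
  have "\<forall>k. \<exists>C. C \<ge> 0 \<and> (\<forall>z\<in>Q. \<bar>h k n z\<bar> \<le> C)" using bd[OF sh] by blast
  then obtain C2 where C2: "\<And>k. C2 k \<ge> 0" "\<And>k z. z \<in> Q \<Longrightarrow> \<bar>h k n z\<bar> \<le> C2 k" by metis
  define C where "C = C1 + (\<Sum>k<n. C2 k)"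
  have sC2: "(\<Sum>k<n. C2 k) \<ge> 0" by (intro sum_nonneg) (simp add: C2)
  have C: "C \<ge> 0" using C1 sC2 by (simp add: C_def)
  have main: "\<bar>f (x, y) - taylor_poly f n x y\<bar> \<le> C * (\<bar>x\<bar> ^ n + \<bar>y\<bar> ^ n)"
    if xy: "\<bar>x\<bar> \<le> r" "\<bar>y\<bar> \<le> r" for x y
  proof -
    have A: "\<bar>g 0 (x, y) - (\<Sum>k<n. g k (x, 0) / fact k * y ^ k)\<bar> \<le> C1 * \<bar>y\<bar> ^ n"
    proof (rule Maclaurin_remainder[where D = "\<lambda>k t. g k (x, t)"])
      fix i t assume "\<bar>t\<bar> \<le> r"
      then have "g i differentiable (at (x, t))"
        using xy by (intro smooth_on_differentiable[OF sg] QU) (auto simp: Q_def)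
      then show "((\<lambda>t. g i (x, t)) has_real_derivative g (Suc i) (x, t)) (at t)"
        using has_real_derivative_line[of "g i" "(x, 0)" t "(0, 1)"] by (simp add: g_def)
    qed (use xy C1 in \<open>auto simp: Q_def\<close>)
    have B: "\<bar>h k 0 (x, 0) - (\<Sum>j<n. h k j (0, 0) / fact j * x ^ j)\<bar> \<le> C2 k * \<bar>x\<bar> ^ n" for k
    proof (rule Maclaurin_remainder[where D = "\<lambda>j t. h k j (t, 0)"])
      fix i t assume "\<bar>t\<bar> \<le> r"
      then have "h k i differentiable (at (t, 0))"
        using r by (intro smooth_on_differentiable[OF sh] QU) (auto simp: Q_def)
      then show "((\<lambda>t. h k i (t, 0)) has_real_derivative h k (Suc i) (t, 0)) (at t)"
        using has_real_derivative_line[of "h k i" "(0, 0)" t "(1, 0)"] by (simp add: h_def)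
    qed (use r xy C2 in \<open>auto simp: Q_def\<close>)
    have tc: "taylor_coeff f j k = h k j (0, 0) / fact j / fact k" for j k
      by (simp add: taylor_coeff_def h_def g_def zero_prod_def)
    have dist: "a / c * z - (\<Sum>j<n. b j / fact j / c * x ^ j * z) = (a - (\<Sum>j<n. b j / fact j * x ^ j)) / c * z"
      for a c z :: real and b
      by (simp add: diff_divide_distrib left_diff_distrib sum_divide_distrib sum_distrib_right mult.assoc)
    have eq: "g k (x, 0) / fact k * y ^ k - (\<Sum>j<n. taylor_coeff f j k * x ^ j * y ^ k)
      = (h k 0 (x, 0) - (\<Sum>j<n. h k j (0, 0) / fact j * x ^ j)) / fact k * y ^ k" for k
      unfolding tc using dist[where a = "h k 0 (x, 0)"] by (simp add: h_def)
    have "\<bar>(\<Sum>k<n. g k (x, 0) / fact k * y ^ k) - (\<Sum>k<n. \<Sum>j<n. taylor_coeff f j k * x ^ j * y ^ k)\<bar>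
      = \<bar>\<Sum>k<n. (h k 0 (x, 0) - (\<Sum>j<n. h k j (0, 0) / fact j * x ^ j)) / fact k * y ^ k\<bar>"
      unfolding sum_subtractf[symmetric] by (simp only: eq)
    also have "\<dots> \<le> (\<Sum>k<n. \<bar>(h k 0 (x, 0) - (\<Sum>j<n. h k j (0, 0) / fact j * x ^ j)) / fact k * y ^ k\<bar>)"
      by (rule sum_abs)
    also have "\<dots> \<le> (\<Sum>k<n. C2 k * \<bar>x\<bar> ^ n)"
    proof (rule sum_mono)
      fix k
      let ?d = "\<bar>h k 0 (x, 0) - (\<Sum>j<n. h k j (0, 0) / fact j * x ^ j)\<bar>"
      have "\<bar>y\<bar> ^ k \<le> 1" using xy r by (intro power_le_one) auto
      moreover have "?d / fact k \<le> ?d" using fact_ge_1[of k, where 'a=real]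
        by (simp add: divide_le_eq mult_left_mono[of 1 "fact k" ?d, simplified])
      ultimately have "?d / fact k * \<bar>y\<bar> ^ k \<le> ?d * 1"
        by (intro mult_mono) auto
      also have "\<dots> \<le> C2 k * \<bar>x\<bar> ^ n" using B by simp
      finally show "\<bar>(h k 0 (x, 0) - (\<Sum>j<n. h k j (0, 0) / fact j * x ^ j)) / fact k * y ^ k\<bar> \<le> C2 k * \<bar>x\<bar> ^ n"
        by (simp add: abs_mult power_abs)
    qed
    also have "\<dots> = (\<Sum>k<n. C2 k) * \<bar>x\<bar> ^ n" by (simp add: sum_distrib_right)
    finally have "\<bar>f (x, y) - taylor_poly f n x y\<bar>
       \<le> C1 * \<bar>y\<bar> ^ n + (\<Sum>k<n. C2 k) * \<bar>x\<bar> ^ n"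
      using A by (simp add: g_def taylor_poly_def)
    also have "\<dots> \<le> C * (\<bar>x\<bar> ^ n + \<bar>y\<bar> ^ n)"
      using C1 sC2 by (simp add: C_def algebra_simps)
    finally show ?thesis .
  qed
  show ?thesis using r(1) C main by blast
qed

text \<open>Along the curve \<open>(t, t\<^sup>N)\<close>, with \<open>N\<close> large, the lexicographically smallest exponent dominates.\<close>

lemma taylor_support_empty:
  assumes f: "smooth_near_0 (f :: real \<times> real \<Rightarrow> real)"
    and flat: "\<And>n. \<exists>C. eventually (\<lambda>z. \<bar>f z\<bar> \<le> C * norm z ^ n) (nhds 0)"
  shows "taylor_support f = {}"
proof (rule ccontr)
  assume ne: "taylor_support f \<noteq> {}"
  define k0 where "k0 = (LEAST k. \<exists>j. (j, k) \<in> taylor_support f)"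
  have "\<exists>j. (j, k0) \<in> taylor_support f"
    unfolding k0_def by (rule LeastI_ex) (use ne in auto)
  define j0 where "j0 = (LEAST j. (j, k0) \<in> taylor_support f)"
  have j0: "(j0, k0) \<in> taylor_support f"
    unfolding j0_def using \<open>\<exists>j. (j, k0) \<in> taylor_support f\<close> by (rule LeastI_ex)
  have kmin: "k0 \<le> k" if "(j, k) \<in> taylor_support f" for j k
    unfolding k0_def using that by (intro Least_le) auto
  have jmin: "j0 \<le> j" if "(j, k0) \<in> taylor_support f" for j
    unfolding j0_def using that by (intro Least_le) auto
  \<comment> \<open>On the curve the monomial \<open>(j, k)\<close> has order
    \<open>j + N * k\<close>. As \<open>N\<close> exceeds \<open>j0\<close>, one more power of the
    second variable outweighs the loss of all \<open>j0\<close> powers of the first, so every other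
    monomial has order at least \<open>M + 1\<close>.\<close>
  define N where "N = Suc j0"
  define M where "M = j0 + N * k0"
  define n where "n = Suc M"
  let ?c = "taylor_coeff f"
  have larger: "j + N * k \<ge> n" if jk: "?c j k \<noteq> 0" "(j, k) \<noteq> (j0, k0)" for j k
  proof (cases "k = k0")
    case True
    then have "j0 \<le> j" using jmin jk by (auto simp: taylor_support_def)
    then show ?thesis using True jk by (auto simp: n_def M_def)
  next
    case False
    then have "Suc k0 \<le> k" using kmin[of j k] jk by (auto simp: taylor_support_def)
    then have "N * Suc k0 \<le> N * k" by (rule mult_le_mono2)
    then show ?thesis by (simp add: n_def M_def N_def)
  qed
  obtain C r where Cr: "r > 0" "C \<ge> 0" "\<And>x y. \<bar>x\<bar> \<le> r \<Longrightarrow> \<bar>y\<bar> \<le> r \<Longrightarrow>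
      \<bar>f (x, y) - taylor_poly f n x y\<bar> \<le> C * (\<bar>x\<bar> ^ n + \<bar>y\<bar> ^ n)"
    using taylor_expansion[OF f, of n] by blast
  obtain D where D: "eventually (\<lambda>z. \<bar>f z\<bar> \<le> D * norm z ^ n) (nhds 0)" using flat by blast
  define S where "S = (\<Sum>k<n. \<Sum>j<n. \<bar>?c j k\<bar>)"
  define E where "E = S + 2 * C + \<bar>D\<bar> * 2 ^ n"
  have lim: "((\<lambda>t. (t, t ^ N)) \<longlongrightarrow> (0::real \<times> real)) (at_right 0)"
    unfolding zero_prod_def by (auto intro!: tendsto_eq_intros simp: N_def)
  have ev1: "eventually (\<lambda>t::real. \<bar>f (t, t ^ N)\<bar> \<le> D * norm (t, t ^ N) ^ n) (at_right 0)"
    using filterlim_iff[THEN iffD1, OF lim] D by blast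
  have ev2: "eventually (\<lambda>t::real. t > 0 \<and> t < min 1 r) (at_right 0)"
    using Cr(1) by (auto simp: eventually_at_right_field intro!: exI[of _ "min 1 r"])
  have ev3: "eventually (\<lambda>t::real. \<bar>?c j0 k0\<bar> \<le> E * t) (at_right 0)"
    using ev1 ev2
  proof eventually_elim
    case (elim t)
    have t: "0 < t" "t < 1" "t < r" using elim by auto
    have tN: "t ^ N \<le> t" using t power_decreasing[of 1 N t] by (simp add: N_def)
    have tNn: "(t ^ N) ^ n \<le> t ^ n" using t tN by (intro power_mono) auto
    have "norm (t, t ^ N) \<le> \<bar>t\<bar> + \<bar>t ^ N\<bar>" by (simp add: norm_Pair sqrt_sum_squares_le_sum_abs)
    also have "\<dots> \<le> 2 * t" using t tN by simp
    finally have "norm (t, t ^ N) ^ n \<le> (2 * t) ^ n" by (intro power_mono) auto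
    then have "\<bar>D\<bar> * norm (t, t ^ N) ^ n \<le> \<bar>D\<bar> * (2 * t) ^ n" by (intro mult_left_mono) auto
    moreover have "D * norm (t, t ^ N) ^ n \<le> \<bar>D\<bar> * norm (t, t ^ N) ^ n" by (intro mult_right_mono) auto
    ultimately have a1: "\<bar>f (t, t ^ N)\<bar> \<le> \<bar>D\<bar> * 2 ^ n * t ^ n"
      using elim by (simp add: power_mult_distrib)
    have "\<bar>f (t, t ^ N) - taylor_poly f n t (t ^ N)\<bar> \<le> C * (\<bar>t\<bar> ^ n + \<bar>t ^ N\<bar> ^ n)"
      using t tN by (intro Cr) auto
    also have "\<dots> \<le> C * (t ^ n + t ^ n)" using t tNn Cr(2) by (intro mult_left_mono add_mono) auto
    finally have a2: "\<bar>f (t, t ^ N) - taylor_poly f n t (t ^ N)\<bar> \<le> 2 * C * t ^ n" by simp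
    let ?T = "\<lambda>j k. if (j, k) = (j0, k0) then 0 else ?c j k * t ^ (j + N * k)"
    have kn: "k0 < n" "j0 < n" by (auto simp: n_def M_def N_def)
    have "(\<Sum>k<n. \<Sum>j<n. ?c j k * t ^ j * (t ^ N) ^ k)
       = (\<Sum>k<n. \<Sum>j<n. (if k = k0 then if j = j0 then ?c j0 k0 * t ^ M else 0 else 0) + ?T j k)"
      by (intro sum.cong refl) (auto simp: M_def power_add power_mult)
    also have "\<dots> = ?c j0 k0 * t ^ M + (\<Sum>k<n. \<Sum>j<n. ?T j k)"
    proof -
      have "(\<Sum>j<n. if k = k0 then if j = j0 then ?c j0 k0 * t ^ M else 0 else 0)
        = (if k = k0 then ?c j0 k0 * t ^ M else 0)" for k
        using kn by (cases "k = k0") (auto simp: sum.delta)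
      then show ?thesis using kn by (simp add: sum.distrib sum.delta)
    qed
    finally have a3: "(\<Sum>k<n. \<Sum>j<n. ?c j k * t ^ j * (t ^ N) ^ k) = ?c j0 k0 * t ^ M + (\<Sum>k<n. \<Sum>j<n. ?T j k)" .
    have T: "\<bar>?T j k\<bar> \<le> \<bar>?c j k\<bar> * t ^ n" for j k
    proof (cases "?c j k = 0 \<or> (j, k) = (j0, k0)")
      case True
      then show ?thesis using t by auto
    next
      case False
      then have "t ^ (j + N * k) \<le> t ^ n" using larger[of j k] t by (intro power_decreasing) auto
      then show ?thesis using False t by (auto simp: abs_mult intro!: mult_left_mono)
    qed
    have "\<bar>\<Sum>k<n. \<Sum>j<n. ?T j k\<bar> \<le> (\<Sum>k<n. \<bar>\<Sum>j<n. ?T j k\<bar>)" by (rule sum_abs)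
    also have "\<dots> \<le> (\<Sum>k<n. \<Sum>j<n. \<bar>?T j k\<bar>)" by (intro sum_mono sum_abs)
    also have "\<dots> \<le> (\<Sum>k<n. \<Sum>j<n. \<bar>?c j k\<bar> * t ^ n)" by (intro sum_mono T)
    also have "\<dots> = S * t ^ n" by (simp add: S_def sum_distrib_right)
    finally have a4: "\<bar>\<Sum>k<n. \<Sum>j<n. ?T j k\<bar> \<le> S * t ^ n" .
    \<comment> \<open>The bound on \<open>f\<close>, the Taylor remainder and the other monomials
      are all of order \<open>n = M + 1\<close>; dividing by \<open>t ^ M\<close> leaves a bound on
      the coefficient that tends to 0.\<close>
    have "\<bar>?c j0 k0 * t ^ M\<bar> \<le> E * t ^ n"
      using a1 a2 a4 unfolding taylor_poly_def a3 E_def by (simp only: distrib_right)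
    then have "\<bar>?c j0 k0\<bar> * t ^ M \<le> (E * t) * t ^ M" using t by (simp add: abs_mult n_def mult.assoc)
    then show ?case using t by simp
  qed
  have "((\<lambda>t. E * t) \<longlongrightarrow> 0) (at_right (0::real))" by (auto intro!: tendsto_eq_intros)
  then have "\<bar>?c j0 k0\<bar> \<le> 0"
    by (rule tendsto_lowerbound[OF _ ev3]) simp
  then show False using j0 by (auto simp: taylor_support_def)
qed

text \<open>On the box a monomial is at most \<open>e powr (\<kappa>1 * j + \<kappa>2 * k)\<close>,
  hence at most \<open>e\<close> for exponents in the support. The remainder of order
  \<open>n\<close> is also \<open>O(e)\<close> once \<open>\<kappa>1 * n\<close> and
  \<open>\<kappa>2 * n\<close> are at least 1, which fixes the choice of \<open>n\<close>.\<close>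

lemma anisotropic_box_bound:
  fixes \<kappa>1 \<kappa>2 :: real
  assumes f: "smooth_near_0 (f :: real \<times> real \<Rightarrow> real)"
    and \<kappa>: "\<kappa>1 > 0" "\<kappa>2 > 0" "\<And>j k. (j, k) \<in> taylor_support f \<Longrightarrow> 1 \<le> \<kappa>1 * j + \<kappa>2 * k"
  shows "\<exists>C\<ge>0. \<exists>e0>0. \<forall>e x y. 0 < e \<longrightarrow> e < e0 \<longrightarrow> \<bar>x\<bar> \<le> e powr \<kappa>1 \<longrightarrow> \<bar>y\<bar> \<le> e powr \<kappa>2 \<longrightarrow>
    \<bar>f (x, y)\<bar> \<le> C * e"
proof -
  obtain n :: nat where n: "n > 1 / \<kappa>1 + 1 / \<kappa>2" using reals_Archimedean2 by blast
  have n12: "\<kappa>1 * n \<ge> 1" "\<kappa>2 * n \<ge> 1"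
  proof -
    have "1 / \<kappa>1 \<le> n" "1 / \<kappa>2 \<le> n" using n \<kappa> by (smt (verit) divide_pos_pos)+
    then show "\<kappa>1 * n \<ge> 1" "\<kappa>2 * n \<ge> 1" using \<kappa> by (simp_all add: field_simps)
  qed
  let ?c = "taylor_coeff f"
  obtain C r where Cr: "r > 0" "C \<ge> 0" "\<And>x y. \<bar>x\<bar> \<le> r \<Longrightarrow> \<bar>y\<bar> \<le> r \<Longrightarrow>
      \<bar>f (x, y) - taylor_poly f n x y\<bar> \<le> C * (\<bar>x\<bar> ^ n + \<bar>y\<bar> ^ n)"
    using taylor_expansion[OF f, of n] by blast
  define S where "S = (\<Sum>k<n. \<Sum>j<n. \<bar>?c j k\<bar>)"
  \<comment> \<open>Below \<open>e0\<close> the box lies in the square where the expansion is valid,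
    and \<open>e < 1\<close> makes higher powers of \<open>e\<close> smaller.\<close>
  define e0 where "e0 = min 1 (min (r powr (1 / \<kappa>1)) (r powr (1 / \<kappa>2)))"
  have e0: "e0 > 0" using Cr by (simp add: e0_def)
  have S: "S \<ge> 0" by (auto simp: S_def intro!: sum_nonneg)
  have main: "\<bar>f (x, y)\<bar> \<le> (S + 2 * C) * e"
    if e: "0 < e" "e < e0" and x: "\<bar>x\<bar> \<le> e powr \<kappa>1" and y: "\<bar>y\<bar> \<le> e powr \<kappa>2" for e x y
  proof -
    have "e powr \<kappa>1 \<le> (r powr (1 / \<kappa>1)) powr \<kappa>1" "e powr \<kappa>2 \<le> (r powr (1 / \<kappa>2)) powr \<kappa>2"
      using e \<kappa> by (auto intro!: powr_mono2 simp: e0_def)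
    then have er: "e powr \<kappa>1 \<le> r" "e powr \<kappa>2 \<le> r" using \<kappa> Cr by (auto simp: powr_powr)
    have e1: "e < 1" using e by (simp add: e0_def)
    have mono: "\<bar>x\<bar> ^ j * \<bar>y\<bar> ^ k \<le> e powr (\<kappa>1 * j + \<kappa>2 * k)" for j k
    proof -
      have "\<bar>x\<bar> ^ j * \<bar>y\<bar> ^ k \<le> (e powr \<kappa>1) ^ j * (e powr \<kappa>2) ^ k"
        using x y by (intro mult_mono power_mono) auto
      also have "\<dots> = e powr (\<kappa>1 * j + \<kappa>2 * k)"
        using e by (simp add: powr_add powr_realpow[symmetric] powr_powr)
      finally show ?thesis .
    qed
    have le: "e powr s \<le> e" if "s \<ge> 1" for s
      using powr_mono'[OF that, of e] e e1 by simp
    have "\<bar>f (x, y) - taylor_poly f n x y\<bar> \<le> C * (\<bar>x\<bar> ^ n + \<bar>y\<bar> ^ n)"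
      using er x y by (intro Cr) auto
    also have "\<dots> \<le> C * (e + e)"
      using mono[of n 0] mono[of 0 n] le[OF n12(1)] le[OF n12(2)] Cr(2)
      by (intro mult_left_mono add_mono) auto
    finally have a2: "\<bar>f (x, y) - taylor_poly f n x y\<bar> \<le> 2 * C * e" by simp
    have T: "\<bar>?c j k * x ^ j * y ^ k\<bar> \<le> \<bar>?c j k\<bar> * e" for j k
    proof (cases "?c j k = 0")
      case False
      then have "1 \<le> \<kappa>1 * j + \<kappa>2 * k" by (intro \<kappa>) (auto simp: taylor_support_def)
      then have "\<bar>x\<bar> ^ j * \<bar>y\<bar> ^ k \<le> e" using mono[of j k] le by (meson order_trans)
      then show ?thesis by (auto simp: abs_mult power_abs mult.assoc intro!: mult_left_mono)
    qed auto
    have "\<bar>\<Sum>k<n. \<Sum>j<n. ?c j k * x ^ j * y ^ k\<bar> \<le> (\<Sum>k<n. \<bar>\<Sum>j<n. ?c j k * x ^ j * y ^ k\<bar>)" by (rule sum_abs)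
    also have "\<dots> \<le> (\<Sum>k<n. \<Sum>j<n. \<bar>?c j k * x ^ j * y ^ k\<bar>)" by (intro sum_mono sum_abs)
    also have "\<dots> \<le> (\<Sum>k<n. \<Sum>j<n. \<bar>?c j k\<bar> * e)" by (intro sum_mono T)
    also have "\<dots> = S * e" by (simp add: S_def sum_distrib_right)
    finally show ?thesis using a2 by (simp add: algebra_simps taylor_poly_def)
  qed
  have "S + 2 * C \<ge> 0" using S Cr(2) by simp
  then show ?thesis using e0 main by blast
qed

section \<open>Newton polyhedra\<close>

text \<open>The polyhedron as a function of the set of exponents alone, so that the support can be
  replaced by a finite subset.\<close>

definition newton_hull :: "(nat \<times> nat) set \<Rightarrow> (real \<times> real) set" where
  "newton_hull S = convex hull (\<Union>(j, k)\<in>S. {(t1, t2). real j \<le> t1 \<and> real k \<le> t2})"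

lemma newton_polyhedron_eq: "newton_polyhedron f = newton_hull (taylor_support f)"
  by (simp add: newton_polyhedron_def newton_hull_def)

lemma convex_newton_hull: "convex (newton_hull S)"
  by (simp add: newton_hull_def)

lemma newton_hull_generator: "(j, k) \<in> S \<Longrightarrow> real j \<le> x \<Longrightarrow> real k \<le> y \<Longrightarrow> (x, y) \<in> newton_hull S"
  unfolding newton_hull_def by (rule hull_inc) auto

lemma newton_hull_least:
  assumes "convex T" "\<And>j k x y. (j, k) \<in> S \<Longrightarrow> real j \<le> x \<Longrightarrow> real k \<le> y \<Longrightarrow> (x, y) \<in> T"
  shows "newton_hull S \<subseteq> T"
  unfolding newton_hull_def by (rule hull_minimal) (use assms in auto)

lemma newton_hull_mono: "S \<subseteq> T \<Longrightarrow> newton_hull S \<subseteq> newton_hull T"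
  by (rule newton_hull_least) (auto intro: convex_newton_hull newton_hull_generator)

text \<open>The preimage of the hull under translation by \<open>v = q - p\<close> is convex and
  contains all generating quadrants, because each of them is stable under this translation.\<close>

lemma newton_hull_upward:
  assumes "p \<in> newton_hull S" "fst p \<le> fst q" "snd p \<le> snd q"
  shows "q \<in> newton_hull S"
proof -
  define v where "v = q - p"
  have v: "fst v \<ge> 0" "snd v \<ge> 0" using assms by (auto simp: v_def)
  have "convex ((\<lambda>x. v + x) -` newton_hull S)"
  proof (rule convexI, unfold vimage_eq)
    fix x y and s t :: real assume *: "v + x \<in> newton_hull S" "v + y \<in> newton_hull S" "0 \<le> s" "0 \<le> t" "s + t = 1"
    have "v + (s *\<^sub>R x + t *\<^sub>R y) = s *\<^sub>R (v + x) + t *\<^sub>R (v + y)"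
      using scaleR_add_left[of s t v] *(5) by (simp add: scaleR_add_right)
    then show "v + (s *\<^sub>R x + t *\<^sub>R y) \<in> newton_hull S"
      using convexD[OF convex_newton_hull *] by simp
  qed
  then have "newton_hull S \<subseteq> (\<lambda>x. v + x) -` newton_hull S"
  proof (rule newton_hull_least)
    fix j k x y assume "(j, k) \<in> S" "real j \<le> x" "real k \<le> y"
    then have "(fst v + x, snd v + y) \<in> newton_hull S" using v by (intro newton_hull_generator) auto
    then show "(x, y) \<in> (\<lambda>x. v + x) -` newton_hull S" by (cases v) auto
  qed
  then show ?thesis using assms(1) by (auto simp: v_def)
qed

lemma newton_hull_halfplane:
  assumes "a \<ge> 0" "b \<ge> 0" "\<And>j k. (j, k) \<in> S \<Longrightarrow> c \<le> a * real j + b * real k" "(x, y) \<in> newton_hull S"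
  shows "c \<le> a * x + b * y"
proof -
  have "newton_hull S \<subseteq> {p. (a, b) \<bullet> p \<ge> c}"
  proof (rule newton_hull_least[OF convex_halfspace_ge])
    fix j k x y assume *: "(j, k) \<in> S" "real j \<le> x" "real k \<le> y"
    have "c \<le> a * real j + b * real k" using assms * by blast
    also have "\<dots> \<le> a * x + b * y" using assms * by (intro add_mono mult_left_mono) auto
    finally show "(x, y) \<in> {p. (a, b) \<bullet> p \<ge> c}" by simp
  qed
  then show ?thesis using assms(4) by auto
qed

lemma newton_hull_nonneg: "(x, y) \<in> newton_hull S \<Longrightarrow> 0 \<le> x \<and> 0 \<le> y"
  using newton_hull_halfplane[of 1 0 S 0 x y] newton_hull_halfplane[of 0 1 S 0 x y] by auto

text \<open>Dickson's lemma in two variables. Given one point \<open>(j0, k0)\<close> of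
  \<open>S\<close>, any other either dominates it or lies in one of finitely many columns
  \<open>j \<le> j0\<close> or rows \<open>k \<le> k0\<close>, and each of these has a least
  element.\<close>

lemma finite_dominating_subset:
  fixes S :: "(nat \<times> nat) set"
  shows "\<exists>M\<subseteq>S. finite M \<and> (\<forall>(j, k)\<in>S. \<exists>(j', k')\<in>M. j' \<le> j \<and> k' \<le> k)"
proof (cases "S = {}")
  case False
  then obtain j0 k0 where 0: "(j0, k0) \<in> S" by auto
  define K where "K = (\<lambda>j. LEAST k. (j, k) \<in> S)"
  define J where "J = (\<lambda>k. LEAST j. (j, k) \<in> S)"
  \<comment> \<open>For a column or row that misses \<open>S\<close>, the \<open>LEAST\<close> is an
    arbitrary value; intersecting with \<open>S\<close> discards such pairs.\<close>
  define M where "M = S \<inter> ({(j0, k0)} \<union> (\<lambda>j. (j, K j)) ` {..j0} \<union> (\<lambda>k. (J k, k)) ` {..k0})"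
  have "\<exists>(j', k')\<in>M. j' \<le> j \<and> k' \<le> k" if jk: "(j, k) \<in> S" for j k
  proof -
    have "(j, K j) \<in> S" "K j \<le> k" unfolding K_def using jk by (auto intro: LeastI Least_le)
    have "(J k, k) \<in> S" "J k \<le> j" unfolding J_def using jk by (auto intro: LeastI[of "\<lambda>j. (j, k) \<in> S"] Least_le)
    note facts = \<open>(j, K j) \<in> S\<close> \<open>K j \<le> k\<close> \<open>(J k, k) \<in> S\<close> \<open>J k \<le> j\<close>
    consider "j \<le> j0" | "k \<le> k0" | "j0 \<le> j \<and> k0 \<le> k" by linarith
    then show ?thesis
    proof cases
      case 1
      then have "(j, K j) \<in> M" using facts by (simp add: M_def)
      then show ?thesis using facts by (intro bexI[of _ "(j, K j)"]) auto
    next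
      case 2
      then have "(J k, k) \<in> M" using facts by (simp add: M_def)
      then show ?thesis using facts by (intro bexI[of _ "(J k, k)"]) auto
    next
      case 3
      have "(j0, k0) \<in> M" using 0 by (simp add: M_def)
      then show ?thesis using 3 by (intro bexI[of _ "(j0, k0)"]) auto
    qed
  qed
  moreover have "finite M" "M \<subseteq> S" by (auto simp: M_def)
  ultimately show ?thesis by blast
qed auto

lemma newton_hull_dominating:
  assumes "M \<subseteq> S" "\<forall>(j, k)\<in>S. \<exists>(j', k')\<in>M. j' \<le> j \<and> k' \<le> k"
  shows "newton_hull S = newton_hull M"
proof
  show "newton_hull S \<subseteq> newton_hull M"
  proof (rule newton_hull_least[OF convex_newton_hull])
    fix j k x y assume *: "(j, k) \<in> S" "real j \<le> x" "real k \<le> y"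
    obtain j' k' where "(j', k') \<in> M" "j' \<le> j" "k' \<le> k" using assms(2) * by blast
    then show "(x, y) \<in> newton_hull M" using * by (intro newton_hull_generator[of j' k']) auto
  qed
qed (rule newton_hull_mono[OF assms(1)])

text \<open>With finitely many generators the hull is the sum of a compact polygon and the closed
  first quadrant, and the sum of a compact and a closed set is closed.\<close>

lemma closed_newton_hull: "closed (newton_hull S)"
proof -
  obtain M where M: "M \<subseteq> S" "finite M" "\<forall>(j, k)\<in>S. \<exists>(j', k')\<in>M. j' \<le> j \<and> k' \<le> k"
    using finite_dominating_subset[of S] by blast
  define P where "P = (\<lambda>(j, k). (real j, real k)) ` M"
  define R where "R = {p :: real \<times> real. 0 \<le> fst p \<and> 0 \<le> snd p}"
  have "newton_hull M = (\<Union>x\<in>convex hull P. \<Union>y\<in>R. {x + y})"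
  proof (intro equalityI)
    have cR: "convex R"
    proof -
      have "R = {p. (1, 0) \<bullet> p \<ge> 0} \<inter> {p. (0, 1) \<bullet> p \<ge> 0}" by (auto simp: R_def)
      then show ?thesis using convex_Int convex_halfspace_ge by metis
    qed
    show "newton_hull M \<subseteq> (\<Union>x\<in>convex hull P. \<Union>y\<in>R. {x + y})"
    proof (rule newton_hull_least)
      show "convex (\<Union>x\<in>convex hull P. \<Union>y\<in>R. {x + y})"
        by (intro convex_sums convex_convex_hull cR)
      fix j k x y assume *: "(j, k) \<in> M" "real j \<le> x" "real k \<le> y"
      have "(real j, real k) \<in> convex hull P" using * by (intro hull_inc) (auto simp: P_def)
      moreover have "(x - real j, y - real k) \<in> R" using * by (simp add: R_def)
      moreover have "(x, y) = (real j, real k) + (x - real j, y - real k)" by simp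
      ultimately show "(x, y) \<in> (\<Union>x\<in>convex hull P. \<Union>y\<in>R. {x + y})" by blast
    qed
    have "convex hull P \<subseteq> newton_hull M"
      by (rule hull_minimal) (auto simp: P_def convex_newton_hull intro: newton_hull_generator)
    then show "(\<Union>x\<in>convex hull P. \<Union>y\<in>R. {x + y}) \<subseteq> newton_hull M"
      by (auto simp: R_def intro: newton_hull_upward)
  qed
  moreover have "closed (\<Union>x\<in>convex hull P. \<Union>y\<in>R. {x + y})"
  proof (rule compact_closed_sums)
    show "compact (convex hull P)" using M(2) by (simp add: P_def finite_imp_compact compact_convex_hull)
    show "closed R" unfolding R_def by (intro closed_Collect_conj closed_Collect_le continuous_intros)
  qed
  ultimately show ?thesis using newton_hull_dominating[OF M(1,3)] by simp
qed

section \<open>Vertices, faces and edges\<close>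

text \<open>The reflection of \<open>a\<close> in \<open>x\<close> lies above and to the right of
  \<open>x\<close>, so it belongs to the hull; were \<open>a\<close> different from
  \<open>x\<close>, then \<open>x\<close> would be the midpoint of a segment in the hull.\<close>

lemma newton_hull_extreme_le:
  assumes "x extreme_point_of newton_hull S" "a \<in> newton_hull S" "fst a \<le> fst x" "snd a \<le> snd x"
  shows "a = x"
proof (rule ccontr)
  assume ne: "a \<noteq> x"
  have "2 *\<^sub>R x - a \<in> newton_hull S"
  proof (rule newton_hull_upward)
    show "x \<in> newton_hull S" using assms(1) by (simp add: extreme_point_of_def)
  qed (use assms(3,4) in auto)
  moreover have "x \<in> open_segment a (2 *\<^sub>R x - a)"
    unfolding in_segment
  proof (intro conjI exI[of _ "1/2"])
    show "a \<noteq> 2 *\<^sub>R x - a" using ne by (auto simp: prod_eq_iff)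
    show "x = (1 - 1 / 2) *\<^sub>R a + (1 / 2) *\<^sub>R (2 *\<^sub>R x - a)" by (auto simp: prod_eq_iff field_simps)
  qed auto
  ultimately show False using assms(1,2) unfolding extreme_point_of_def by blast
qed

lemma newton_hull_extreme_point:
  assumes "x extreme_point_of newton_hull S"
  obtains j k where "(j, k) \<in> S" "x = (real j, real k)"
proof -
  have "x \<in> (\<Union>(j, k)\<in>S. {(t1, t2). real j \<le> t1 \<and> real k \<le> t2})"
    using assms extreme_point_of_convex_hull unfolding newton_hull_def by blast
  then obtain j k where jk: "(j, k) \<in> S" "real j \<le> fst x" "real k \<le> snd x" by auto
  then have "(real j, real k) = x"
    by (intro newton_hull_extreme_le[OF assms]) (auto intro: newton_hull_generator)
  then show ?thesis using that jk by auto
qed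

lemma finite_newton_hull_extreme_points: "finite {x. x extreme_point_of newton_hull S}"
proof -
  obtain M where M: "M \<subseteq> S" "finite M" "\<forall>(j, k)\<in>S. \<exists>(j', k')\<in>M. j' \<le> j \<and> k' \<le> k"
    using finite_dominating_subset[of S] by blast
  have "{x. x extreme_point_of newton_hull M} \<subseteq> (\<lambda>(j, k). (real j, real k)) ` M"
    by (auto elim!: newton_hull_extreme_point)
  then show ?thesis using newton_hull_dominating[OF M(1,3)] M(2) finite_subset by fastforce
qed

text \<open>If \<open>F\<close> missed \<open>Q\<close>, the hull without \<open>F\<close> would
  still contain \<open>Q\<close>. It is also convex: a segment with both ends off the face cannot
  meet the face. So it would be the whole hull.\<close>

lemma face_of_convex_hull_meets:
  assumes F: "F face_of (convex hull Q)" and ne: "F \<noteq> {}"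
  shows "F \<inter> Q \<noteq> {}"
proof
  assume "F \<inter> Q = {}"
  then have "Q \<subseteq> convex hull Q - F" using hull_subset[of Q convex] by blast
  moreover have "convex (convex hull Q - F)"
  proof (rule convex_contains_segment[THEN iffD2], intro ballI)
    fix a b assume ab: "a \<in> convex hull Q - F" "b \<in> convex hull Q - F"
    then have "closed_segment a b \<subseteq> convex hull Q"
      by (intro closed_segment_subset convex_convex_hull) auto
    moreover have "x \<notin> F" if x: "x \<in> closed_segment a b" for x
    proof
      assume xF: "x \<in> F"
      then have "x \<in> open_segment a b" using ab x by (auto simp: open_segment_def)
      then show False using F ab xF unfolding face_of_def by blast
    qed
    ultimately show "closed_segment a b \<subseteq> convex hull Q - F" by blast
  qed
  ultimately have "convex hull Q \<subseteq> convex hull Q - F" by (rule hull_minimal)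
  then show False using face_of_imp_subset[OF F] ne by blast
qed

text \<open>Cramer's rule: two distinct points on a line that avoids the origin are linearly
  independent, so they determine the two coefficients of its normalized equation.\<close>

lemma edge_weight_eq:
  assumes "\<gamma> \<subseteq> {(t1, t2). a * t1 + b * t2 = 1}" "v \<in> \<gamma>" "w \<in> \<gamma>" "v \<noteq> w"
  shows "edge_weight \<gamma> = (a, b)"
  unfolding edge_weight_def
proof (rule the_equality)
  show "\<gamma> \<subseteq> {(t1, t2). fst (a, b) * t1 + snd (a, b) * t2 = 1}" using assms by simp
next
  fix \<kappa> assume \<kappa>: "\<gamma> \<subseteq> {(t1, t2). fst \<kappa> * t1 + snd \<kappa> * t2 = 1}"
  obtain c d where cd: "\<kappa> = (c, d)" by (cases \<kappa>)
  obtain v1 v2 w1 w2 where vw: "v = (v1, v2)" "w = (w1, w2)" by (cases v, cases w)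
  have e: "a * v1 + b * v2 = 1" "a * w1 + b * w2 = 1" "c * v1 + d * v2 = 1" "c * w1 + d * w2 = 1"
    using assms \<kappa> by (auto simp: cd vw)
  define D where "D = v1 * w2 - v2 * w1"
  have "v1 - w1 = v1 * (a * w1 + b * w2) - w1 * (a * v1 + b * v2)" using e by simp
  also have "\<dots> = b * D" by (simp add: D_def algebra_simps)
  finally have 1: "v1 - w1 = b * D" .
  have "w2 - v2 = w2 * (a * v1 + b * v2) - v2 * (a * w1 + b * w2)" using e by simp
  also have "\<dots> = a * D" by (simp add: D_def algebra_simps)
  finally have 2: "w2 - v2 = a * D" .
  have D: "D \<noteq> 0" using 1 2 assms(4) vw by auto
  have "a * D = w2 * (a * v1 + b * v2) - v2 * (a * w1 + b * w2)" by (simp add: D_def algebra_simps)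
  also have "\<dots> = w2 * (c * v1 + d * v2) - v2 * (c * w1 + d * w2)" using e by simp
  also have "\<dots> = c * D" by (simp add: D_def algebra_simps)
  finally have ac: "a = c" using D by simp
  have "b * D = v1 * (a * w1 + b * w2) - w1 * (a * v1 + b * v2)" by (simp add: D_def algebra_simps)
  also have "\<dots> = v1 * (c * w1 + d * w2) - w1 * (c * v1 + d * v2)" using e by simp
  also have "\<dots> = d * D" by (simp add: D_def algebra_simps)
  finally have "b = d" using D by simp
  then show "\<kappa> = (a, b)" using ac cd by simp
qed

lemma supporting_weight_nonneg:
  assumes "\<And>q. q \<in> newton_hull S \<Longrightarrow> a \<bullet> p \<le> a \<bullet> q" "p \<in> newton_hull S"
  shows "fst a \<ge> 0" "snd a \<ge> 0"
proof -
  have "p + (1, 0) \<in> newton_hull S" "p + (0, 1) \<in> newton_hull S"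
    using assms(2) by (auto intro: newton_hull_upward[of p])
  from this[THEN assms(1)] show "fst a \<ge> 0" "snd a \<ge> 0"
    by (cases a; simp add: inner_add_right)+
qed

lemma newton_hull_support:
  assumes "p \<in> newton_hull S" "p \<notin> rel_interior (newton_hull S)"
  shows "\<exists>a. a \<noteq> 0 \<and> (\<forall>y\<in>newton_hull S. a \<bullet> p \<le> a \<bullet> y)"
  by (rule supporting_hyperplane_rel_boundary[OF convex_newton_hull assms]) (intro exI conjI ballI)

lemma newton_hull_interior_nonempty:
  assumes "S \<noteq> {}"
  shows "interior (newton_hull S) \<noteq> {}"
proof -
  obtain j k where jk: "(j, k) \<in> S" using assms by auto
  have "{real j<..} \<times> {real k<..} \<subseteq> newton_hull S" using jk by (auto intro: newton_hull_generator)
  then have "{real j<..} \<times> {real k<..} \<subseteq> interior (newton_hull S)"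
    by (intro interior_maximal open_Times) auto
  moreover have "(real j + 1, real k + 1) \<in> {real j<..} \<times> {real k<..}" by simp
  ultimately show ?thesis by blast
qed

text \<open>A supporting line at a relative interior point of the edge contains the whole edge, and
  its normal has nonnegative entries. If one entry vanished, the edge could be translated into
  itself along a coordinate axis, contradicting compactness. Dividing by the level \<open>c\<close>
  gives the normalized weight.\<close>

lemma compact_edge_weight:
  assumes \<gamma>: "\<gamma> \<in> compact_edges (newton_hull S)" and ne: "S \<noteq> {}"
  obtains \<kappa>1 \<kappa>2 where "\<kappa>1 > 0" "\<kappa>2 > 0" "edge_weight \<gamma> = (\<kappa>1, \<kappa>2)"
    "\<And>j k. (j, k) \<in> S \<Longrightarrow> 1 \<le> \<kappa>1 * real j + \<kappa>2 * real k"
proof -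
  let ?N = "newton_hull S"
  have face: "\<gamma> face_of ?N" and dim: "aff_dim \<gamma> = 1" and comp: "compact \<gamma>"
    using \<gamma> by (auto simp: compact_edges_def)
  have "\<gamma> \<noteq> {}" using dim by auto
  then obtain v where v: "v \<in> \<gamma>" by auto
  have "\<gamma> \<noteq> {v}" using dim by auto
  then obtain w where w: "w \<in> \<gamma>" "w \<noteq> v" using v by auto
  have sub: "\<gamma> \<subseteq> ?N" using face face_of_imp_subset by blast
  have "\<gamma> \<noteq> ?N"
    using aff_dim_nonempty_interior[OF newton_hull_interior_nonempty[OF ne]] dim by auto
  obtain x where x: "x \<in> rel_interior \<gamma>"
    using rel_interior_eq_empty[of \<gamma>] \<open>\<gamma> \<noteq> {}\<close> face_of_imp_convex[OF face] by blast
  have x\<gamma>: "x \<in> \<gamma>" using x rel_interior_subset by blast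
  have "x \<notin> rel_interior ?N"
    using face_of_disjoint_rel_interior[OF face \<open>\<gamma> \<noteq> ?N\<close>] x\<gamma> by blast
  then obtain a where a: "a \<noteq> 0" "\<And>y. y \<in> ?N \<Longrightarrow> a \<bullet> x \<le> a \<bullet> y"
    using newton_hull_support[of x S] sub x\<gamma> by blast
  obtain a1 a2 where a12: "a = (a1, a2)" by (cases a)
  have nonneg: "a1 \<ge> 0" "a2 \<ge> 0"
    using supporting_weight_nonneg[OF a(2)] sub x\<gamma> by (auto simp: a12)
  have "?N \<inter> {y. a \<bullet> y = a \<bullet> x} face_of ?N"
    by (rule face_of_Int_supporting_hyperplane_ge[OF convex_newton_hull]) (use a in auto)
  then have "\<gamma> \<subseteq> ?N \<inter> {y. a \<bullet> y = a \<bullet> x}"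
    by (rule subset_of_face_of[OF _ sub]) (use x x\<gamma> sub in auto)
  then have \<gamma>eq: "a \<bullet> y = a \<bullet> x" if "y \<in> \<gamma>" for y using that by blast
  \<comment> \<open>Otherwise \<open>\<gamma>\<close> would be a proper face of the intersection of
    the polyhedron with the supporting line. That intersection has dimension at most 1, so
    \<open>\<gamma>\<close> would have dimension less than 1.\<close>
  have shift: "y + u \<in> \<gamma>" if y: "y \<in> \<gamma>" and u: "fst u \<ge> 0" "snd u \<ge> 0" "u \<noteq> 0" "a \<bullet> u = 0" for y u
  proof -
    have yu: "y + u \<in> ?N"
      by (rule newton_hull_upward[OF subsetD[OF sub y]]) (use u(1,2) in simp_all)
    have G: "?N \<inter> {z. a \<bullet> z = a \<bullet> x} face_of ?N"
      by (rule face_of_Int_supporting_hyperplane_ge[OF convex_newton_hull]) (use a in auto)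
    show ?thesis
    proof (rule ccontr)
      assume "y + u \<notin> \<gamma>"
      have "aff_dim (?N \<inter> {z. a \<bullet> z = a \<bullet> x}) \<le> aff_dim {z. a \<bullet> z = a \<bullet> x}"
        by (rule aff_dim_subset) auto
      also have "\<dots> = 1" using a(1) by (simp add: aff_dim_hyperplane)
      finally have "aff_dim (?N \<inter> {z. a \<bullet> z = a \<bullet> x}) \<le> 1" .
      moreover have "\<gamma> face_of (?N \<inter> {z. a \<bullet> z = a \<bullet> x})"
        by (rule face_of_subset[OF face]) (use \<gamma>eq sub in auto)
      moreover have "y + u \<in> ?N \<inter> {z. a \<bullet> z = a \<bullet> x}"
        using yu u(4) \<gamma>eq[OF y] by (simp add: inner_add_right)
      then have "\<gamma> \<noteq> ?N \<inter> {z. a \<bullet> z = a \<bullet> x}" using \<open>y + u \<notin> \<gamma>\<close> by auto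
      ultimately show False
        using face_of_aff_dim_lt[of "?N \<inter> {z. a \<bullet> z = a \<bullet> x}" \<gamma>] dim
          face_of_imp_convex[OF G] by auto
    qed
  qed
  have noshift: False if u: "fst u \<ge> 0" "snd u \<ge> 0" "u \<noteq> 0" "a \<bullet> u = 0" for u
  proof -
    \<comment> \<open>A point of the edge that is farthest in the direction \<open>u\<close> cannot
      be shifted by \<open>u\<close> within the edge.\<close>
    obtain z where z: "z \<in> \<gamma>" "\<And>y. y \<in> \<gamma> \<Longrightarrow> u \<bullet> y \<le> u \<bullet> z"
      using continuous_attains_sup[OF comp \<open>\<gamma> \<noteq> {}\<close>, of "\<lambda>y. u \<bullet> y"]
        continuous_on_inner[OF continuous_on_const continuous_on_id, of \<gamma> u] by blast
    have "u \<bullet> (z + u) \<le> u \<bullet> z" using z shift[OF z(1) u] by blast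
    then have "u \<bullet> u \<le> 0" by (simp add: inner_add_right)
    then show False using u(3) inner_gt_zero_iff[of u] by linarith
  qed
  have pos: "a1 > 0" "a2 > 0"
  proof -
    show "a1 > 0" using nonneg noshift[of "(1, 0)"] by (cases "a1 = 0") (auto simp: a12 zero_prod_def)
    show "a2 > 0" using nonneg noshift[of "(0, 1)"] by (cases "a2 = 0") (auto simp: a12 zero_prod_def)
  qed
  define c where "c = a \<bullet> x"
  have vw: "a \<bullet> v = c" "a \<bullet> w = c" using \<gamma>eq v w by (auto simp: c_def)
  have nn: "fst v \<ge> 0" "snd v \<ge> 0" "fst w \<ge> 0" "snd w \<ge> 0"
    using newton_hull_nonneg[of "fst v" "snd v" S] newton_hull_nonneg[of "fst w" "snd w" S] v w sub by auto
  \<comment> \<open>For \<open>c \<le> 0\<close> the line would meet the closed first quadrant at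
    most in the origin, but \<open>v\<close> and \<open>w\<close> are two distinct points on
    it.\<close>
  have c: "c > 0"
  proof (rule ccontr)
    assume "\<not> c > 0"
    have "z = 0" if "fst z \<ge> 0" "snd z \<ge> 0" "a \<bullet> z = c" for z
    proof -
      have "a1 * fst z + a2 * snd z \<le> 0" using that \<open>\<not> c > 0\<close> by (cases z) (auto simp: a12)
      moreover have "a1 * fst z \<ge> 0" "a2 * snd z \<ge> 0" using that pos by auto
      ultimately have "a1 * fst z = 0" "a2 * snd z = 0" by linarith+
      then show "z = 0" using pos by (auto simp: prod_eq_iff)
    qed
    then have "v = 0" "w = 0" using nn vw by blast+
    then show False using w by simp
  qed
  show ?thesis
  proof
    show "a1 / c > 0" "a2 / c > 0" using pos c by auto
    show "edge_weight \<gamma> = (a1 / c, a2 / c)"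
    proof (rule edge_weight_eq[OF _ v w(1) w(2)[symmetric]])
      show "\<gamma> \<subseteq> {(t1, t2). a1 / c * t1 + a2 / c * t2 = 1}"
      proof
        fix y assume "y \<in> \<gamma>"
        then have "a \<bullet> y = c" using \<gamma>eq c_def by blast
        then show "y \<in> {(t1, t2). a1 / c * t1 + a2 / c * t2 = 1}"
          using c by (cases y) (auto simp: a12 field_simps)
      qed
    qed
    fix j k assume "(j, k) \<in> S"
    then have "c \<le> a \<bullet> (real j, real k)" unfolding c_def by (intro a newton_hull_generator) auto
    then show "1 \<le> a1 / c * real j + a2 / c * real k" using c by (auto simp: a12 field_simps)
  qed
qed

text \<open>A compact face is the convex hull of its extreme points, which are among the finitely
  many vertices of the polyhedron. Finiteness gives meaning to the \<open>Max\<close> in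
  \<open>restriction_height\<close>.\<close>

lemma finite_compact_edges: "finite (compact_edges (newton_hull S))"
proof (rule finite_subset)
  show "compact_edges (newton_hull S) \<subseteq> (\<lambda>E. convex hull E) ` Pow {x. x extreme_point_of newton_hull S}"
  proof
    fix \<gamma> assume "\<gamma> \<in> compact_edges (newton_hull S)"
    then have face: "\<gamma> face_of newton_hull S" and comp: "compact \<gamma>" by (auto simp: compact_edges_def)
    have "\<gamma> = convex hull {x. x extreme_point_of \<gamma>}"
      using Krein_Milman_Minkowski[OF comp face_of_imp_convex[OF face]] .
    moreover have "{x. x extreme_point_of \<gamma>} \<subseteq> {x. x extreme_point_of newton_hull S}"
      using extreme_point_of_face[OF face] by blast
    ultimately show "\<gamma> \<in> (\<lambda>E. convex hull E) ` Pow {x. x extreme_point_of newton_hull S}" by blast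
  qed
qed (use finite_newton_hull_extreme_points in simp)

text \<open>The rightmost vertex is the leftmost support point in the lowest row that meets the
  support. This identifies the value chosen by \<open>ARG_MAX\<close> and provides the lexicographic
  order used in \<open>last_vertex_bound\<close>.\<close>

lemma last_vertex_newton_hull:
  assumes "S \<noteq> {}"
  obtains A B where "last_vertex (newton_hull S) = (real A, real B)"
    "\<And>j k. (j, k) \<in> S \<Longrightarrow> B < k \<or> k = B \<and> A \<le> j"
proof -
  let ?N = "newton_hull S"
  define B where "B = (LEAST k. \<exists>j. (j, k) \<in> S)"
  have ex: "\<exists>j. (j, B) \<in> S" unfolding B_def by (rule LeastI_ex) (use assms in auto)
  define A where "A = (LEAST j. (j, B) \<in> S)"
  have AB: "(A, B) \<in> S" unfolding A_def using ex by (rule LeastI_ex)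
  have lex: "B < k \<or> k = B \<and> A \<le> j" if "(j, k) \<in> S" for j k
  proof -
    have "B \<le> k" unfolding B_def using that by (intro Least_le) auto
    moreover have "A \<le> j" if "(j, B) \<in> S" for j unfolding A_def using that by (intro Least_le)
    ultimately show ?thesis using that by (cases "k = B") auto
  qed
  have ABN: "(real A, real B) \<in> ?N" using AB by (intro newton_hull_generator) auto
  \<comment> \<open>A lexicographic half-plane: it is convex and contains all generating quadrants,
    hence the polyhedron, and \<open>(A, B)\<close> is an extreme point of it.\<close>
  define L where "L = {p. real B < snd p \<or> snd p = real B \<and> real A \<le> fst p}"
  have "convex L"
  proof (rule convexI)
    fix x y :: "real \<times> real" and u v :: real
    assume xy: "x \<in> L" "y \<in> L" and uv: "0 \<le> u" "0 \<le> v" "u + v = 1"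
    have x: "real B \<le> snd x" and y: "real B \<le> snd y" using xy by (auto simp: L_def)
    have v: "v = 1 - u" using uv by simp
    have s: "snd (u *\<^sub>R x + v *\<^sub>R y) - real B = u * (snd x - real B) + v * (snd y - real B)"
      by (simp add: v algebra_simps)
    have f: "fst (u *\<^sub>R x + v *\<^sub>R y) - real A = u * (fst x - real A) + v * (fst y - real A)"
      by (simp add: v algebra_simps)
    consider "u = 0" | "v = 0" | "u > 0" "v > 0" using uv by linarith
    then show "u *\<^sub>R x + v *\<^sub>R y \<in> L"
    proof cases
      case 3
      show ?thesis
      proof (cases "snd x = real B \<and> snd y = real B")
        case True
        then have "u * (fst x - real A) \<ge> 0" "v * (fst y - real A) \<ge> 0"
          using xy 3 by (auto simp: L_def)
        then show ?thesis using s f True by (simp add: L_def)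
      next
        case False
        then have "u * (snd x - real B) + v * (snd y - real B) > 0"
          using x y 3 by (cases "snd x = real B") (auto intro: add_pos_nonneg add_nonneg_pos)
        then show ?thesis using s by (simp add: L_def)
      qed
    qed (use xy uv in auto)
  qed
  then have NL: "?N \<subseteq> L"
    by (rule newton_hull_least) (use lex in \<open>fastforce simp: L_def\<close>)
  have ext: "(real A, real B) extreme_point_of ?N"
    unfolding extreme_point_of_def
  proof (intro conjI ballI ABN notI)
    fix p q assume pq: "p \<in> ?N" "q \<in> ?N" and seg: "(real A, real B) \<in> open_segment p q"
    obtain u where u: "0 < u" "u < 1" "p \<noteq> q"
      "real A = (1 - u) * fst p + u * fst q" "real B = (1 - u) * snd p + u * snd q"
      using seg by (auto simp: in_segment prod_eq_iff)
    have p: "real B \<le> snd p" and q: "real B \<le> snd q" using NL pq by (auto simp: L_def)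
    have z: "a = 0 \<and> b = 0" if "a \<ge> 0" "b \<ge> 0" "(1 - u) * a + u * b = 0" for a b
    proof -
      have "(1 - u) * a \<ge> 0" "u * b \<ge> 0" using that u by auto
      then have "(1 - u) * a = 0" "u * b = 0" using that(3) by linarith+
      then show ?thesis using u by auto
    qed
    have "(1 - u) * (snd p - real B) + u * (snd q - real B) = 0" using u(5) by (simp add: algebra_simps)
    then have 2: "snd p = real B" "snd q = real B" using z[of "snd p - real B" "snd q - real B"] p q by auto
    then have "real A \<le> fst p" "real A \<le> fst q" using NL pq by (auto simp: L_def)
    moreover have "(1 - u) * (fst p - real A) + u * (fst q - real A) = 0" using u(4) by (simp add: algebra_simps)
    ultimately have "fst p = real A" "fst q = real A" using z[of "fst p - real A" "fst q - real A"] by auto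
    then show False using 2 u(3) by (simp add: prod_eq_iff)
  qed
  \<comment> \<open>A vertex at or to the right of \<open>A\<close> dominates \<open>(A, B)\<close>
    in both coordinates, so it equals \<open>(A, B)\<close> by
    \<open>newton_hull_extreme_le\<close>. This makes the maximizer unique.\<close>
  have bound: "fst v \<le> real A \<and> (fst v = real A \<longrightarrow> v = (real A, real B))" if v: "v extreme_point_of ?N" for v
  proof -
    have "v \<in> L" using v NL by (auto simp: extreme_point_of_def)
    then have "snd v \<ge> real B" by (auto simp: L_def)
    then show ?thesis using newton_hull_extreme_le[OF v ABN] by (cases "fst v < real A") auto
  qed
  have "last_vertex ?N = (real A, real B)"
    unfolding last_vertex_def arg_max_def is_arg_max_def
  proof (rule some_equality)
    show "(real A, real B) extreme_point_of ?N \<and>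
      \<not> (\<exists>y. y extreme_point_of ?N \<and> fst (real A, real B) < fst y)"
      using ext bound by (metis fst_conv not_less)
    fix v assume v: "v extreme_point_of ?N \<and> \<not> (\<exists>y. y extreme_point_of ?N \<and> fst v < fst y)"
    then have "fst v \<ge> real A" using ext by (metis fst_conv not_less)
    then show "v = (real A, real B)" using bound[of v] v by simp
  qed
  then show ?thesis using that lex by blast
qed

section \<open>Newton distance and principal face\<close>

text \<open>The parameters of the diagonal points of the polyhedron form a closed set with a least
  element \<open>e\<close>. Diagonal points beyond \<open>e\<close> are interior, since the
  polyhedron contains the quadrant above \<open>(e, e)\<close>; so \<open>e\<close> is the value of
  the \<open>THE\<close> in \<open>newton_distance\<close>.\<close>

lemma newton_distance_props:
  assumes ne: "taylor_support f \<noteq> {}" and 0: "(0, 0) \<notin> taylor_support f"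
  defines "d \<equiv> newton_distance f"
  shows "d > 0" "(d, d) \<in> newton_polyhedron f" "(d, d) \<in> frontier (newton_polyhedron f)"
proof -
  let ?N = "newton_hull (taylor_support f)"
  define T where "T = {t. (t, t) \<in> ?N}"
  obtain j k where jk: "(j, k) \<in> taylor_support f" using ne by auto
  have T_ne: "real (max j k) \<in> T" unfolding T_def using jk by (auto intro: newton_hull_generator)
  \<comment> \<open>Without the exponent \<open>(0, 0)\<close> the polyhedron lies in the half-plane
    where the sum of the coordinates is at least 1.\<close>
  have T_half: "1 / 2 \<le> t" if "t \<in> T" for t
  proof -
    have cov: "1 \<le> 1 * real j + 1 * real k" if "(j, k) \<in> taylor_support f" for j k
      using that 0 by (cases "j = 0"; cases "k = 0") auto
    have "(t, t) \<in> ?N" using that by (simp add: T_def)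
    from newton_hull_halfplane[OF _ _ cov this] show ?thesis by simp
  qed
  have "closed T"
  proof -
    have "T = (\<lambda>t. (t, t)) -` ?N" by (auto simp: T_def)
    then show ?thesis using closed_newton_hull by (auto intro!: closed_vimage continuous_intros)
  qed
  define e where "e = Inf T"
  have bdd: "bdd_below T" using T_half by (rule bdd_belowI)
  have eT: "e \<in> T" unfolding e_def using closed_contains_Inf[OF _ bdd \<open>closed T\<close>] T_ne by blast
  have emin: "e \<le> t" if "t \<in> T" for t unfolding e_def using that bdd by (rule cInf_lower)
  have "(e, e) \<notin> interior ?N"
  proof
    assume "(e, e) \<in> interior ?N"
    then obtain r where r: "r > 0" "ball (e, e) r \<subseteq> ?N" unfolding mem_interior by blast
    have "(e - r / 3, e - r / 3) \<in> ball (e, e) r"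
    proof -
      have "dist (e, e) (e - r / 3, e - r / 3) \<le> \<bar>r / 3\<bar> + \<bar>r / 3\<bar>"
        unfolding dist_Pair_Pair dist_real_def by (rule order_trans[OF sqrt_sum_squares_le_sum_abs]) simp
      then show ?thesis using r by simp
    qed
    then have "e - r / 3 \<in> T" using r by (auto simp: T_def)
    then show False using emin[of "e - r / 3"] r by simp
  qed
  then have efr: "(e, e) \<in> frontier ?N"
    using eT closed_newton_hull by (auto simp: frontier_def T_def)
  have unique: "t = e" if "(t, t) \<in> frontier ?N" for t
  proof (rule ccontr)
    assume "t \<noteq> e"
    have "(t, t) \<in> ?N" using that frontier_subset_closed[OF closed_newton_hull] by blast
    then have "e < t" using emin[of t] \<open>t \<noteq> e\<close> by (auto simp: T_def)
    have "{e<..} \<times> {e<..} \<subseteq> ?N" using eT by (auto simp: T_def intro: newton_hull_upward)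
    then have "{e<..} \<times> {e<..} \<subseteq> interior ?N" by (intro interior_maximal open_Times) auto
    then have "(t, t) \<in> interior ?N" using \<open>e < t\<close> by auto
    then show False using that by (auto simp: frontier_def)
  qed
  have "d = e" unfolding d_def newton_distance_def newton_polyhedron_eq
    by (rule the_equality, rule efr, rule unique)
  then show "d > 0" "(d, d) \<in> newton_polyhedron f" "(d, d) \<in> frontier (newton_polyhedron f)"
    using efr eT T_half[OF eT] by (auto simp: newton_polyhedron_eq T_def)
qed

text \<open>The face of least dimension is the intersection of all faces through
  \<open>(d, d)\<close>: a rival of the same dimension has this intersection as a face and so
  coincides with it. A supporting line at \<open>(d, d)\<close> cuts out one of these faces, hence
  contains the principal face. Its normal is only known to be nonnegative, since the principal face
  may be unbounded.\<close>

lemma principal_face_cases: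
  assumes ne: "taylor_support f \<noteq> {}" and 0: "(0, 0) \<notin> taylor_support f"
  defines "d \<equiv> newton_distance f" and "F \<equiv> principal_face f"
  shows "F face_of newton_polyhedron f"
    and "F = {(d, d)} \<or>
      (\<exists>\<kappa>1 \<kappa>2. \<kappa>1 \<ge> 0 \<and> \<kappa>2 \<ge> 0 \<and> principal_weight f = (\<kappa>1, \<kappa>2) \<and> (\<kappa>1 + \<kappa>2) * d = 1 \<and>
        (\<forall>(x, y)\<in>F. \<kappa>1 * x + \<kappa>2 * y = 1) \<and> (d, d) \<in> F \<and>
        (\<forall>(j, k)\<in>taylor_support f. 1 \<le> \<kappa>1 * real j + \<kappa>2 * real k))"
proof -
  let ?N = "newton_hull (taylor_support f)"
  note np = newton_distance_props[OF ne 0, folded d_def, unfolded newton_polyhedron_eq]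
  define \<F> where "\<F> = {G. G face_of ?N \<and> (d, d) \<in> G}"
  have "?N \<in> \<F>" using np by (auto simp: \<F>_def face_of_refl convex_newton_hull)
  then have face: "\<Inter>\<F> face_of ?N" by (intro face_of_Inter) (auto simp: \<F>_def)
  have dF: "(d, d) \<in> \<Inter>\<F>" by (auto simp: \<F>_def)
  have sub: "\<Inter>\<F> \<subseteq> G" if "G face_of ?N" "(d, d) \<in> G" for G using that by (auto simp: \<F>_def)
  have F: "F = \<Inter>\<F>"
    unfolding F_def principal_face_def Let_def newton_polyhedron_eq d_def[symmetric]
  proof (rule the_equality)
    show "\<Inter>\<F> face_of ?N \<and> (d, d) \<in> \<Inter>\<F> \<and>
      (\<forall>G. G face_of ?N \<and> (d, d) \<in> G \<longrightarrow> aff_dim (\<Inter>\<F>) \<le> aff_dim G)"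
      using face dF sub by (auto intro!: aff_dim_subset)
    fix G assume G: "G face_of ?N \<and> (d, d) \<in> G \<and> (\<forall>H. H face_of ?N \<and> (d, d) \<in> H \<longrightarrow> aff_dim G \<le> aff_dim H)"
    have "\<Inter>\<F> face_of G"
      using face_of_subset[OF face] sub G face_of_imp_subset by blast
    moreover have "aff_dim G \<le> aff_dim (\<Inter>\<F>)" using G face dF by blast
    moreover have "convex G" using G face_of_imp_convex by blast
    ultimately show "G = \<Inter>\<F>"
      using face_of_aff_dim_lt[of G "\<Inter>\<F>"] by (metis linorder_not_less)
  qed
  show "F face_of newton_polyhedron f" using face F by (simp add: newton_polyhedron_eq)
  have "(d, d) \<notin> rel_interior ?N"
    using np rel_interior_nonempty_interior[OF newton_hull_interior_nonempty[OF ne]]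
    by (auto simp: frontier_def)
  then obtain a where a: "a \<noteq> 0" "\<And>y. y \<in> ?N \<Longrightarrow> a \<bullet> (d, d) \<le> a \<bullet> y"
    using newton_hull_support[OF np(2)] by blast
  obtain a1 a2 where a12: "a = (a1, a2)" by (cases a)
  have nonneg: "a1 \<ge> 0" "a2 \<ge> 0" using supporting_weight_nonneg[OF a(2) np(2)] by (auto simp: a12)
  then have s: "a1 + a2 > 0" using a(1) by (auto simp: a12 zero_prod_def)
  define c where "c = (a1 + a2) * d"
  have c: "c > 0" using s np by (simp add: c_def)
  have ac: "a \<bullet> (d, d) = c" by (simp add: a12 c_def distrib_right)
  have "?N \<inter> {y. a \<bullet> y = c} face_of ?N"
    by (rule face_of_Int_supporting_hyperplane_ge[OF convex_newton_hull]) (use a ac in auto)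
  then have line: "F \<subseteq> {y. a \<bullet> y = c}" unfolding F using sub[of "?N \<inter> {y. a \<bullet> y = c}"] np ac by blast
  have line': "F \<subseteq> {(x, y). a1 / c * x + a2 / c * y = 1}"
  proof
    fix y assume "y \<in> F"
    then show "y \<in> {(x, y). a1 / c * x + a2 / c * y = 1}"
      using line c by (cases y) (auto simp: a12 field_simps)
  qed
  show "F = {(d, d)} \<or>
      (\<exists>\<kappa>1 \<kappa>2. \<kappa>1 \<ge> 0 \<and> \<kappa>2 \<ge> 0 \<and> principal_weight f = (\<kappa>1, \<kappa>2) \<and> (\<kappa>1 + \<kappa>2) * d = 1 \<and>
        (\<forall>(x, y)\<in>F. \<kappa>1 * x + \<kappa>2 * y = 1) \<and> (d, d) \<in> F \<and>
        (\<forall>(j, k)\<in>taylor_support f. 1 \<le> \<kappa>1 * real j + \<kappa>2 * real k))"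
  proof (cases "F = {(d, d)}")
    case False
    then obtain w where w: "w \<in> F" "w \<noteq> (d, d)" using dF F by blast
    have "principal_weight f = (a1 / c, a2 / c)"
      unfolding principal_weight_def F_def[symmetric]
      using edge_weight_eq[OF line' w(1) _ w(2)] dF F by simp
    moreover have "(a1 / c + a2 / c) * d = ((a1 + a2) * d) / c"
      by (simp add: add_divide_distrib distrib_right)
    then have "(a1 / c + a2 / c) * d = 1" using c by (simp add: c_def[symmetric])
    moreover have "1 \<le> a1 / c * real j + a2 / c * real k" if "(j, k) \<in> taylor_support f" for j k
    proof -
      have "c \<le> a \<bullet> (real j, real k)" using a(2) ac that newton_hull_generator[of j k] by fastforce
      then show ?thesis using c by (auto simp: a12 field_simps)
    qed
    moreover have "a1 / c \<ge> 0" "a2 / c \<ge> 0" using nonneg c by simp_all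
    moreover have "\<forall>(x, y)\<in>F. a1 / c * x + a2 / c * y = 1" using line' by blast
    moreover have "(d, d) \<in> F" using dF F by simp
    ultimately show ?thesis by blast
  qed auto
qed

section \<open>The principal root jet\<close>

text \<open>Substituting \<open>monom b m\<close> turns the term of \<open>(j, k)\<close> into a
  monomial of degree \<open>j + m * k\<close> in the first variable. Distinct degrees cannot cancel,
  so the value is nonzero and \<open>monom b m\<close> is not a root.\<close>

lemma order_monom_root_eq_0:
  fixes c :: "nat \<Rightarrow> nat \<Rightarrow> real"
  assumes "finite A" "A \<noteq> {}" and inj: "inj_on (\<lambda>(j, k). j + m * k) A"
    and c: "\<And>j k. (j, k) \<in> A \<Longrightarrow> c j k \<noteq> 0" and "b \<noteq> 0"
  shows "order (monom b m) (\<Sum>(j, k)\<in>A. monom (monom (c j k) j) k) = 0"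
proof -
  let ?p = "\<Sum>(j, k)\<in>A. monom (monom (c j k) j) k"
  obtain j0 k0 where A0: "(j0, k0) \<in> A" using \<open>A \<noteq> {}\<close> by auto
  have "poly ?p (monom b m) = (\<Sum>(j, k)\<in>A. monom (c j k * b ^ k) (j + m * k))"
    by (simp add: poly_sum case_prod_unfold poly_monom monom_power mult_monom)
  then have "coeff (poly ?p (monom b m)) (j0 + m * k0)
     = (\<Sum>(j, k)\<in>A. coeff (monom (c j k * b ^ k) (j + m * k)) (j0 + m * k0))"
    by (simp add: coeff_sum case_prod_unfold)
  also have "\<dots> = (\<Sum>z\<in>A. if z = (j0, k0) then c j0 k0 * b ^ k0 else 0)"
  proof (rule sum.cong[OF refl])
    fix z assume z: "z \<in> A"
    obtain j k where jk: "z = (j, k)" by (cases z)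
    have "j + m * k = j0 + m * k0 \<longleftrightarrow> (j, k) = (j0, k0)"
      using inj_on_eq_iff[OF inj, of "(j, k)" "(j0, k0)"] z A0 jk by simp
    then show "(case z of (j, k) \<Rightarrow> coeff (monom (c j k * b ^ k) (j + m * k)) (j0 + m * k0))
      = (if z = (j0, k0) then c j0 k0 * b ^ k0 else 0)" by (auto simp: jk)
  qed
  also have "\<dots> = c j0 k0 * b ^ k0" using \<open>finite A\<close> A0 by (simp add: sum.delta)
  also have "\<dots> \<noteq> 0" using c[OF A0] \<open>b \<noteq> 0\<close> by simp
  finally have "poly ?p (monom b m) \<noteq> 0" by auto
  then show ?thesis using order_root[of ?p "monom b m"] by blast
qed

text \<open>If \<open>m \<noteq> \<kappa>\<^sub>2 / \<kappa>\<^sub>1\<close>, the monomials of the principal part stay distinct after substituting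
  \<open>x\<^sub>2 = b x\<^sub>1\<^sup>m\<close>, so this is not a root; likewise if the principal face is a vertex.\<close>

lemma varchenko_root_exponent:
  assumes ne: "taylor_support f \<noteq> {}" and 0: "(0, 0) \<notin> taylor_support f"
    and root: "varchenko_root f b m"
    and pos: "0 < fst (principal_weight f)" "0 < snd (principal_weight f)"
  shows "real m = principal_exponent f"
    and "(fst (principal_weight f) + snd (principal_weight f)) * newton_distance f = 1"
    and "(j, k) \<in> taylor_support f \<Longrightarrow>
      1 \<le> fst (principal_weight f) * real j + snd (principal_weight f) * real k"
proof -
  define d F A where "d = newton_distance f" and "F = principal_face f"
    and "A = {(j, k). (j, k) \<in> taylor_support f \<and> (real j, real k) \<in> F}"
  note pf = principal_face_cases[OF ne 0, folded d_def F_def]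
  have d0: "d > 0" using newton_distance_props[OF ne 0] by (simp add: d_def)
  have b: "b \<noteq> 0" and ord: "d < real (order (monom b m) (principal_part f))"
    using root by (auto simp: varchenko_root_def d_def)
  have pp: "principal_part f = (\<Sum>(j, k)\<in>A. monom (monom (taylor_coeff f j k) j) k)"
    by (simp add: principal_part_def A_def F_def)
  have not_inj: "\<not> inj_on (\<lambda>(j, k). j + m * k) A" if "finite A" "A \<noteq> {}"
  proof
    assume "inj_on (\<lambda>(j, k). j + m * k) A"
    then have "order (monom b m) (principal_part f) = 0"
      unfolding pp by (intro order_monom_root_eq_0 that b) (auto simp: A_def taylor_support_def)
    then show False using ord d0 by simp
  qed
  have "F \<noteq> {(d, d)}"
  proof
    assume F: "F = {(d, d)}"
    then have "(d, d) extreme_point_of newton_hull (taylor_support f)"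
      using pf(1) by (simp add: face_of_singleton newton_polyhedron_eq)
    then obtain j k where jk: "(j, k) \<in> taylor_support f" "(d, d) = (real j, real k)"
      by (rule newton_hull_extreme_point)
    then have "A = {(j, k)}" by (auto simp: A_def F)
    then show False using not_inj by simp
  qed
  then obtain \<kappa>1 \<kappa>2 where \<kappa>: "principal_weight f = (\<kappa>1, \<kappa>2)" "(\<kappa>1 + \<kappa>2) * d = 1"
    "\<forall>(x, y)\<in>F. \<kappa>1 * x + \<kappa>2 * y = 1" "(d, d) \<in> F"
    "\<forall>(j, k)\<in>taylor_support f. 1 \<le> \<kappa>1 * real j + \<kappa>2 * real k"
    using pf(2) by blast
  have \<kappa>pos: "\<kappa>1 > 0" "\<kappa>2 > 0" using pos \<kappa>(1) by auto
  \<comment> \<open>The principal face meets a generating quadrant. Both weights being positive, a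
    point of that quadrant on the supporting line can only be its corner, so the principal part has
    at least one term.\<close>
  have "F \<inter> (\<Union>(j, k)\<in>taylor_support f. {(t1, t2). real j \<le> t1 \<and> real k \<le> t2}) \<noteq> {}"
    using pf(1) \<kappa>(4) by (intro face_of_convex_hull_meets) (auto simp: newton_polyhedron_def)
  then obtain j k x y where jk: "(j, k) \<in> taylor_support f" "real j \<le> x" "real k \<le> y" "(x, y) \<in> F"
    by blast
  have "real j = x \<and> real k = y"
  proof -
    have "\<kappa>1 * x + \<kappa>2 * y = 1" "1 \<le> \<kappa>1 * real j + \<kappa>2 * real k" using \<kappa>(3,5) jk by blast+
    moreover have "\<kappa>1 * real j \<le> \<kappa>1 * x" "\<kappa>2 * real k \<le> \<kappa>2 * y" using jk \<kappa>pos by auto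
    ultimately have "\<kappa>1 * real j = \<kappa>1 * x" "\<kappa>2 * real k = \<kappa>2 * y" by linarith+
    then show ?thesis using \<kappa>pos by simp
  qed
  then have "A \<noteq> {}" using jk by (auto simp: A_def)
  have line: "\<kappa>1 * real j + \<kappa>2 * real k = 1" if "(j, k) \<in> A" for j k
    using that \<kappa>(3) by (auto simp: A_def)
  have "finite A"
  proof (rule finite_subset)
    show "A \<subseteq> {..nat \<lfloor>1 / \<kappa>1\<rfloor>} \<times> {..nat \<lfloor>1 / \<kappa>2\<rfloor>}"
    proof clarify
      fix j k assume "(j, k) \<in> A"
      then have "\<kappa>1 * real j + \<kappa>2 * real k = 1" by (rule line)
      moreover have "\<kappa>1 * real j \<ge> 0" "\<kappa>2 * real k \<ge> 0" using \<kappa>pos by auto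
      ultimately have "\<kappa>1 * real j \<le> 1" "\<kappa>2 * real k \<le> 1" by linarith+
      then have "real j \<le> 1 / \<kappa>1" "real k \<le> 1 / \<kappa>2" using \<kappa>pos by (simp_all add: field_simps)
      then show "j \<in> {..nat \<lfloor>1 / \<kappa>1\<rfloor>} \<and> k \<in> {..nat \<lfloor>1 / \<kappa>2\<rfloor>}"
        by (simp add: le_nat_floor)
    qed
  qed simp
  then obtain j k j' k' where jk': "(j, k) \<in> A" "(j', k') \<in> A" "(j, k) \<noteq> (j', k')" "j + m * k = j' + m * k'"
    using not_inj[OF _ \<open>A \<noteq> {}\<close>] by (auto simp: inj_on_def)
  have e: "real j + real m * real k = real j' + real m * real k'"
    using jk'(4) by (metis of_nat_add of_nat_mult)
  \<comment> \<open>Two support points on the line of the weight with equal \<open>j + m * k\<close>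
    also lie on a line of slope given by \<open>m\<close>; the two lines can share distinct points
    only if they are parallel.\<close>
  have "(\<kappa>2 - real m * \<kappa>1) * (real k - real k')
    = (\<kappa>1 * real j + \<kappa>2 * real k) - (\<kappa>1 * real j' + \<kappa>2 * real k')
      - \<kappa>1 * ((real j + real m * real k) - (real j' + real m * real k'))"
    by (simp add: algebra_simps)
  also have "\<dots> = 0" using line[OF jk'(1)] line[OF jk'(2)] e by simp
  finally have "\<kappa>2 = real m * \<kappa>1 \<or> k = k'" by simp
  moreover have "k \<noteq> k'" using jk' by auto
  ultimately show "real m = principal_exponent f" using \<kappa>pos by (simp add: principal_exponent_def \<kappa>(1))
  show "(fst (principal_weight f) + snd (principal_weight f)) * newton_distance f = 1"
    using \<kappa> by (simp add: d_def)
  show "1 \<le> fst (principal_weight f) * real j + snd (principal_weight f) * real k"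
    if "(j, k) \<in> taylor_support f" for j k using that \<kappa> by auto
qed

section \<open>Order of vanishing of the root jet\<close>

text \<open>Links the \<open>deriv\<close> of \<open>principal_root_jet\<close> with the
  \<open>dirderiv\<close> in which smoothness is expressed.\<close>

lemma deriv_pow_eq_dirderiv:
  fixes g :: "real \<Rightarrow> real"
  assumes "open U" "smooth_on U g" "x \<in> U"
  shows "(deriv ^^ n) g x = (dirderiv 1 ^^ n) g x"
  using assms(3)
proof (induction n arbitrary: x)
  case (Suc n)
  have "eventually (\<lambda>y. (deriv ^^ n) g y = (dirderiv 1 ^^ n) g y) (nhds x)"
    using eventually_nhds_in_open[OF assms(1) Suc.prems] by eventually_elim (rule Suc.IH)
  then have "deriv ((deriv ^^ n) g) x = deriv ((dirderiv 1 ^^ n) g) x" by (rule deriv_cong_ev) simp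
  also have "\<dots> = (dirderiv 1 ^^ Suc n) g x"
    using has_real_derivative_line[of "(dirderiv 1 ^^ n) g" 0 x 1]
      smooth_on_differentiable[OF smooth_on_dirderiv_pow[OF assms(2)] Suc.prems]
    by (auto intro: DERIV_imp_deriv)
  finally show ?case by simp
qed simp

lemma smooth_vanishing_bound:
  fixes g :: "real \<Rightarrow> real"
  assumes "smooth_near_0 g" "\<And>i. i < n \<Longrightarrow> (deriv ^^ i) g 0 = 0"
  shows "\<exists>C\<ge>0. \<exists>r>0. \<forall>s. \<bar>s\<bar> \<le> r \<longrightarrow> \<bar>g s\<bar> \<le> C * \<bar>s\<bar> ^ n"
proof -
  obtain U where U: "open U" "0 \<in> U" "smooth_on U g" using assms by (auto simp: smooth_near_0_def)
  obtain r where r: "r > 0" "cball 0 r \<subseteq> U" using U open_contains_cball by blast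
  let ?D = "\<lambda>i. (dirderiv 1 ^^ i) g"
  have sm: "smooth_on U (?D i)" for i by (intro smooth_on_dirderiv_pow U)
  have "compact (?D n ` cball 0 r)"
    by (intro compact_continuous_image[OF continuous_on_subset[OF smooth_on_continuous[OF sm] r(2)]]) auto
  then obtain C where C: "\<forall>x\<in>?D n ` cball 0 r. norm x \<le> C" using compact_imp_bounded bounded_iff by metis
  have "\<bar>g s\<bar> \<le> max C 0 * \<bar>s\<bar> ^ n" if s: "\<bar>s\<bar> \<le> r" for s
  proof -
    have "\<bar>?D 0 s - (\<Sum>i<n. ?D i 0 / fact i * s ^ i)\<bar> \<le> max C 0 * \<bar>s\<bar> ^ n"
    proof (rule Maclaurin_remainder[where r = r])
      fix i t assume "\<bar>t\<bar> \<le> r"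
      then have "t \<in> U" using r(2) by auto
      from has_real_derivative_line[of "?D i" 0 t 1] smooth_on_differentiable[OF sm this]
      show "(?D i has_real_derivative ?D (Suc i) t) (at t)" by simp
    next
      fix t assume "\<bar>t\<bar> \<le> r"
      then have "t \<in> cball 0 r" by simp
      then show "\<bar>?D n t\<bar> \<le> max C 0" using C[rule_format, OF imageI, of t] by simp
    qed (rule s)
    moreover have "(\<Sum>i<n. ?D i 0 / fact i * s ^ i) = 0"
      using assms(2) deriv_pow_eq_dirderiv[OF U(1,3,2)] by (intro sum.neutral) auto
    ultimately show ?thesis by simp
  qed
  then show ?thesis using r by (intro exI[of _ "max C 0"]) auto
qed

lemma shear_0 [simp]: "shear (\<lambda>_. 0) f = f"
  by (auto simp: shear_def)

text \<open>Since \<open>f\<close> is not adapted, at least one step is made. Step 0 starts from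
  \<open>f\<close> itself, as its shear is by an empty sum, and the exponents increase, so
  \<open>\<psi>\<close> vanishes to the order \<open>m 0\<close> in the terminating and in the
  infinite case.\<close>

lemma principal_root_jet_order:
  assumes jet: "principal_root_jet f \<psi>" and "\<not> adapted f"
  shows "\<exists>b m. varchenko_root f b m \<and> smooth_near_0 \<psi> \<and>
    (\<exists>C\<ge>0. \<exists>r>0. \<forall>s. \<bar>s\<bar> \<le> r \<longrightarrow> \<bar>\<psi> s\<bar> \<le> C * \<bar>s\<bar> ^ m)"
  using jet unfolding principal_root_jet_def
proof (elim disjE exE conjE)
  fix b m K
  assume steps: "\<forall>k<K. varchenko_step f b m k" and mono: "strict_mono_on {..<K} m"
    and \<psi>: "\<psi> = (\<lambda>s. \<Sum>k<K. b k * s ^ m k)" and ad: "adapted (shear \<psi> f)"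
  have "K \<noteq> 0"
  proof
    assume "K = 0"
    then have "shear \<psi> f = f" by (simp add: \<psi>)
    then show False using ad \<open>\<not> adapted f\<close> by simp
  qed
  then have "varchenko_step f b m 0" using steps by simp
  then have root: "varchenko_root f (b 0) (m 0)" by (simp add: varchenko_step_def)
  have "smooth_on UNIV \<psi>" unfolding \<psi>
    by (intro smooth_on_sum smooth_on_mult smooth_on_power smooth_on_const
        smooth_on_bounded_linear[OF bounded_linear_ident]) auto
  then have sm: "smooth_near_0 \<psi>" unfolding smooth_near_0_def by blast
  have "\<bar>\<psi> s\<bar> \<le> (\<Sum>k<K. \<bar>b k\<bar>) * \<bar>s\<bar> ^ m 0" if "\<bar>s\<bar> \<le> 1" for s
  proof -
    have "\<bar>\<psi> s\<bar> \<le> (\<Sum>k<K. \<bar>b k * s ^ m k\<bar>)" unfolding \<psi> by (rule sum_abs)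
    also have "\<dots> \<le> (\<Sum>k<K. \<bar>b k\<bar> * \<bar>s\<bar> ^ m 0)"
    proof (rule sum_mono)
      fix k assume "k \<in> {..<K}"
      then have "m 0 \<le> m k" using mono \<open>K \<noteq> 0\<close>
        by (cases "k = 0") (auto simp: strict_mono_on_def dest!: bspec[of _ _ 0] intro: less_imp_le)
      then show "\<bar>b k * s ^ m k\<bar> \<le> \<bar>b k\<bar> * \<bar>s\<bar> ^ m 0"
        using that by (auto simp: abs_mult power_abs intro!: mult_left_mono power_decreasing)
    qed
    finally show ?thesis by (simp add: sum_distrib_right)
  qed
  moreover have "(\<Sum>k<K. \<bar>b k\<bar>) \<ge> 0" by (intro sum_nonneg) auto
  ultimately have "\<exists>C\<ge>0. \<exists>r>0. \<forall>s. \<bar>s\<bar> \<le> r \<longrightarrow> \<bar>\<psi> s\<bar> \<le> C * \<bar>s\<bar> ^ m 0"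
    by (meson zero_less_one)
  then show ?thesis using root sm by blast
next
  fix b :: "nat \<Rightarrow> real" and m
  assume steps: "\<forall>k. varchenko_step f b m k" and mono: "strict_mono m" and sm: "smooth_near_0 \<psi>"
    and co: "\<forall>i. (deriv ^^ i) \<psi> 0 / fact i = (\<Sum>k\<in>{k. m k = i}. b k)"
  have "varchenko_step f b m 0" using steps by simp
  then have root: "varchenko_root f (b 0) (m 0)" by (simp add: varchenko_step_def)
  have "(deriv ^^ i) \<psi> 0 = 0" if "i < m 0" for i
  proof -
    have "m k \<noteq> i" for k using that strict_mono_less_eq[OF mono, of 0 k] by auto
    then have "(\<Sum>k\<in>{k. m k = i}. b k) = 0" by simp
    then show ?thesis using co[rule_format, of i] by simp
  qed
  then show ?thesis using smooth_vanishing_bound[OF sm] root sm by blast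
qed

section \<open>Gaussian test functions\<close>

lemma real_polynomial_function_dirderiv:
  assumes "real_polynomial_function P"
  shows "P differentiable (at x)" and "real_polynomial_function (dirderiv v P)"
proof -
  have "(\<forall>x. P differentiable (at x)) \<and> real_polynomial_function (dirderiv v P)"
    using assms
  proof (induction rule: real_polynomial_function.induct)
    case (linear f)
    have "dirderiv v f = (\<lambda>_. f v)"
      by (rule ext, rule dirderiv_eqI, rule bounded_linear_imp_has_derivative[OF linear])
    then show ?case using linear by (auto intro: bounded_linear_imp_differentiable)
  next
    case (const c)
    then show ?case by auto
  next
    case (add f g)
    have "dirderiv v (\<lambda>x. f x + g x) = (\<lambda>x. dirderiv v f x + dirderiv v g x)"
      using add by (intro ext dirderiv_eqI has_derivative_add dirderiv_works) auto
    then show ?case using add by auto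
  next
    case (mult f g)
    have "dirderiv v (\<lambda>x. f x * g x) = (\<lambda>x. f x * dirderiv v g x + dirderiv v f x * g x)"
      using mult by (intro ext dirderiv_eqI has_derivative_mult dirderiv_works) auto
    then show ?case using mult by (auto intro: differentiable_mult)
  qed
  then show "P differentiable (at x)" "real_polynomial_function (dirderiv v P)" by auto
qed

lemma real_polynomial_function_bound:
  assumes "real_polynomial_function P"
  shows "\<exists>C\<ge>0. \<exists>N. \<forall>x. \<bar>P x\<bar> \<le> C * (1 + norm x) ^ N"
  using assms
proof (induction rule: real_polynomial_function.induct)
  case (linear f)
  then obtain K where K: "K \<ge> 0" "\<And>x. norm (f x) \<le> norm x * K" using bounded_linear.nonneg_bounded by blast
  have "\<bar>f x\<bar> \<le> K * (1 + norm x) ^ 1" for x using K(2)[of x] K(1) by (simp add: algebra_simps)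
  then show ?case using K(1) by blast
next
  case (const c)
  have "\<bar>c\<bar> \<le> \<bar>c\<bar> * (1 + norm x) ^ 0" for x :: 'a by simp
  then show ?case by (metis abs_ge_zero)
next
  case (add f g)
  then obtain C1 C2 N1 N2 where *: "C1 \<ge> 0" "C2 \<ge> 0"
    "\<And>x. \<bar>f x\<bar> \<le> C1 * (1 + norm x) ^ N1" "\<And>x. \<bar>g x\<bar> \<le> C2 * (1 + norm x) ^ N2" by metis
  have "\<bar>f x + g x\<bar> \<le> (C1 + C2) * (1 + norm x) ^ max N1 N2" for x
  proof -
    have "\<bar>f x + g x\<bar> \<le> C1 * (1 + norm x) ^ N1 + C2 * (1 + norm x) ^ N2"
      using *(3,4)[of x] by linarith
    also have "\<dots> \<le> C1 * (1 + norm x) ^ max N1 N2 + C2 * (1 + norm x) ^ max N1 N2"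
      using * by (intro add_mono mult_left_mono power_increasing) auto
    finally show ?thesis by (simp add: algebra_simps)
  qed
  moreover have "C1 + C2 \<ge> 0" using * by simp
  ultimately show ?case by blast
next
  case (mult f g)
  then obtain C1 C2 N1 N2 where *: "C1 \<ge> 0" "C2 \<ge> 0"
    "\<And>x. \<bar>f x\<bar> \<le> C1 * (1 + norm x) ^ N1" "\<And>x. \<bar>g x\<bar> \<le> C2 * (1 + norm x) ^ N2" by metis
  have "\<bar>f x * g x\<bar> \<le> (C1 * C2) * (1 + norm x) ^ (N1 + N2)" for x
  proof -
    have "\<bar>f x * g x\<bar> \<le> (C1 * (1 + norm x) ^ N1) * (C2 * (1 + norm x) ^ N2)"
      unfolding abs_mult using *(1,3,4) by (intro mult_mono) auto
    then show ?thesis by (simp add: power_add mult_ac)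
  qed
  moreover have "C1 * C2 \<ge> 0" using * by simp
  ultimately show ?case by blast
qed

text \<open>For fixed \<open>q\<close> this class is closed under directional derivatives, so one
  decay estimate for all \<open>P\<close> covers all derivatives in \<open>schwartz\<close>.\<close>

definition poly_gauss :: "('a::real_normed_vector \<Rightarrow> real) \<Rightarrow> ('a \<Rightarrow> real) \<Rightarrow> 'a \<Rightarrow> complex" where
  "poly_gauss q P = (\<lambda>x. complex_of_real (P x * exp (- q x)))"

lemma poly_gauss_derivative:
  assumes "real_polynomial_function q" "real_polynomial_function P"
  shows "poly_gauss q P differentiable (at x)"
    and "dirderiv v (poly_gauss q P) = poly_gauss q (\<lambda>x. dirderiv v P x - P x * dirderiv v q x)"
proof -
  have P: "(P has_derivative (\<lambda>v. dirderiv v P x)) (at x)"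
    and q: "(q has_derivative (\<lambda>v. dirderiv v q x)) (at x)" for x
    using assms by (auto intro: dirderiv_works real_polynomial_function_dirderiv)
  have der: "(poly_gauss q P has_derivative
    (\<lambda>v. complex_of_real (P x * (- dirderiv v q x * exp (- q x)) + dirderiv v P x * exp (- q x)))) (at x)" for x
    unfolding poly_gauss_def
    by (intro has_derivative_of_real has_derivative_mult has_derivative_exp has_derivative_minus P q)
  then show "poly_gauss q P differentiable (at x)" unfolding differentiable_def by blast
  show "dirderiv v (poly_gauss q P) = poly_gauss q (\<lambda>x. dirderiv v P x - P x * dirderiv v q x)"
    by (rule ext, subst dirderiv_eqI[OF der]) (simp add: poly_gauss_def algebra_simps)
qed

lemma smooth_on_poly_gauss:
  assumes q: "real_polynomial_function q" and "real_polynomial_function P"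
  shows "smooth_on UNIV (poly_gauss q P)"
proof -
  have "Ck_on k UNIV (poly_gauss q P)" for k
    using assms(2)
  proof (induction k arbitrary: P)
    case 0
    then show ?case using poly_gauss_derivative(1)[OF q 0]
      by (auto intro!: continuous_at_imp_continuous_on differentiable_imp_continuous_within)
  next
    case (Suc k)
    have "Ck_on k UNIV (dirderiv v (poly_gauss q P))" for v
      unfolding poly_gauss_derivative(2)[OF q Suc.prems]
      by (intro Suc.IH real_polynomial_function_diff real_polynomial_function.intros(4) Suc.prems
          real_polynomial_function_dirderiv q)
    then show ?case using poly_gauss_derivative(1)[OF q Suc.prems] by simp
  qed
  then show ?thesis by (simp add: smooth_on_def)
qed

text \<open>All polynomial factors together are \<open>O((1 + t) ^ n)\<close> with
  \<open>t = norm x\<close>, and \<open>(1 + t) ^ n\<close> is at most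
  \<open>exp (n * (1 + t))\<close>. Completing the square bounds
  \<open>n * t - c * t\<^sup>2\<close> by the constant in the exponent.\<close>

lemma poly_gauss_bounded:
  fixes q P :: "'a::real_normed_vector \<Rightarrow> real"
  assumes "real_polynomial_function P" and c: "c > 0" "\<And>x. c * (norm x)\<^sup>2 \<le> q x"
  shows "bounded (range (\<lambda>x. (1 + norm x) ^ N *\<^sub>R poly_gauss q P x))"
proof -
  obtain C M where C: "C \<ge> 0" "\<And>x. \<bar>P x\<bar> \<le> C * (1 + norm x) ^ M"
    using real_polynomial_function_bound[OF assms(1)] by blast
  define n where "n = N + M"
  have "norm ((1 + norm x) ^ N *\<^sub>R poly_gauss q P x) \<le> C * exp (real n + (real n)\<^sup>2 / (4 * c))" for x
  proof -
    let ?t = "norm x"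
    have "real n * ?t - c * ?t\<^sup>2 \<le> (real n)\<^sup>2 / (4 * c)"
    proof -
      have "0 \<le> (2 * c * ?t - real n)\<^sup>2" by simp
      then have "4 * c * (real n * ?t - c * ?t\<^sup>2) \<le> (real n)\<^sup>2" by (simp add: power2_eq_square algebra_simps)
      then show ?thesis using c by (simp add: pos_le_divide_eq mult.commute)
    qed
    then have e: "real n * (1 + ?t) - q x \<le> real n + (real n)\<^sup>2 / (4 * c)"
      using c(2)[of x] by (simp add: algebra_simps)
    have "norm ((1 + ?t) ^ N *\<^sub>R poly_gauss q P x) = (1 + ?t) ^ N * (\<bar>P x\<bar> * exp (- q x))"
      by (simp add: poly_gauss_def norm_mult)
    also have "\<dots> \<le> (1 + ?t) ^ N * ((C * (1 + ?t) ^ M) * exp (- q x))"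
      using C by (intro mult_left_mono mult_right_mono) auto
    also have "\<dots> = C * ((1 + ?t) ^ n * exp (- q x))" by (simp add: n_def power_add mult_ac)
    also have "\<dots> \<le> C * (exp (1 + ?t) ^ n * exp (- q x))"
      using C(1) exp_ge_add_one_self[of "1 + ?t"]
      by (intro mult_left_mono mult_right_mono power_mono) auto
    also have "exp (1 + ?t) ^ n * exp (- q x) = exp (real n * (1 + ?t) - q x)"
      by (simp add: exp_of_nat_mult[symmetric] exp_add[symmetric])
    also have "C * exp (real n * (1 + ?t) - q x) \<le> C * exp (real n + (real n)\<^sup>2 / (4 * c))"
      using C(1) e by (intro mult_left_mono) auto
    finally show ?thesis .
  qed
  then show ?thesis unfolding bounded_iff by blast
qed

lemma schwartz_poly_gauss:
  fixes q P :: "'a::euclidean_space \<Rightarrow> real"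
  assumes q: "real_polynomial_function q" and P: "real_polynomial_function P"
    and c: "c > 0" "\<And>x. c * (norm x)\<^sup>2 \<le> q x"
  shows "schwartz (poly_gauss q P)"
proof -
  have "\<exists>P'. real_polynomial_function P' \<and> fold dirderiv vs (poly_gauss q P) = poly_gauss q P'" for vs
    using P
  proof (induction vs arbitrary: P)
    case (Cons v vs)
    have "real_polynomial_function (\<lambda>x. dirderiv v P x - P x * dirderiv v q x)"
      by (intro real_polynomial_function_diff real_polynomial_function.intros(4) Cons.prems
          real_polynomial_function_dirderiv q)
    from Cons.IH[OF this] show ?case by (simp add: poly_gauss_derivative(2)[OF q Cons.prems])
  qed auto
  then show ?thesis unfolding schwartz_def
    using smooth_on_poly_gauss[OF q P] poly_gauss_bounded[OF _ c] by metis
qed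

section \<open>Gaussians adapted to a box\<close>

text \<open>\<open>a\<close>, \<open>b\<close>, \<open>c\<close> are the widths on the Fourier side.
  The factor \<open>a * b * c\<close> makes the integral independent of them, so the Fourier
  transform is a Gaussian of fixed height. The nesting of the product matches
  \<open>integral_lborel_mult3\<close>.\<close>

definition gauss_box :: "real \<Rightarrow> real \<Rightarrow> real \<Rightarrow> real \<times> real \<times> real \<Rightarrow> complex" where
  "gauss_box a b c = (\<lambda>(x, y, z). complex_of_real
     ((a * exp (- (a * x)\<^sup>2 / 2)) * ((b * exp (- (b * y)\<^sup>2 / 2)) * (c * exp (- (c * z)\<^sup>2 / 2)))))"

lemma schwartz_gauss_box:
  assumes "a > 0" "b > 0" "c > 0"
  shows "schwartz (gauss_box a b c)"
proof -
  define q where "q = (\<lambda>p :: real \<times> real \<times> real. ((a * fst p)\<^sup>2 + ((b * fst (snd p))\<^sup>2 + (c * snd (snd p))\<^sup>2)) / 2)"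
  have lin: "real_polynomial_function (\<lambda>p :: real \<times> real \<times> real. fst p)"
    "real_polynomial_function (\<lambda>p :: real \<times> real \<times> real. fst (snd p))"
    "real_polynomial_function (\<lambda>p :: real \<times> real \<times> real. snd (snd p))"
    by (auto intro!: real_polynomial_function.intros(1) bounded_linear_fst bounded_linear_snd
        bounded_linear_compose[OF bounded_linear_fst] bounded_linear_compose[OF bounded_linear_snd])
  have "real_polynomial_function q"
    unfolding q_def power2_eq_square
    by (intro real_polynomial_function_divide real_polynomial_function.intros(3)
        real_polynomial_function.intros(4) real_polynomial_function.intros(2) lin)
  moreover define m where "m = min (a\<^sup>2) (min (b\<^sup>2) (c\<^sup>2)) / 2"
  have "m > 0" using assms by (simp add: m_def)
  moreover have "m * (norm p)\<^sup>2 \<le> q p" for p :: "real \<times> real \<times> real"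
  proof -
    obtain x y z where p: "p = (x, y, z)" by (cases p)
    have n: "(norm p)\<^sup>2 = x\<^sup>2 + (y\<^sup>2 + z\<^sup>2)" by (simp add: p norm_Pair)
    have "m * x\<^sup>2 \<le> a\<^sup>2 / 2 * x\<^sup>2" "m * y\<^sup>2 \<le> b\<^sup>2 / 2 * y\<^sup>2" "m * z\<^sup>2 \<le> c\<^sup>2 / 2 * z\<^sup>2"
      by (auto simp: m_def intro!: mult_right_mono)
    then show ?thesis unfolding n by (simp add: q_def p power_mult_distrib distrib_left add_divide_distrib)
  qed
  ultimately have "schwartz (poly_gauss q (\<lambda>_. a * b * c))"
    by (intro schwartz_poly_gauss[of q _ m]) auto
  moreover have "poly_gauss q (\<lambda>_. a * b * c) = gauss_box a b c"
  proof
    fix p :: "real \<times> real \<times> real"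
    obtain x y z where p: "p = (x, y, z)" by (cases p)
    have "exp (- q p) = exp (- (a * x)\<^sup>2 / 2) * (exp (- (b * y)\<^sup>2 / 2) * exp (- (c * z)\<^sup>2 / 2))"
      unfolding mult_exp_exp by (simp add: q_def p add_divide_distrib)
    then show "poly_gauss q (\<lambda>_. a * b * c) p = gauss_box a b c p"
      by (simp add: poly_gauss_def gauss_box_def p mult_ac)
  qed
  ultimately show ?thesis by simp
qed

lemma integral_lborel_mult:
  fixes f :: "'a::euclidean_space \<Rightarrow> 'c::{real_normed_field, banach, second_countable_topology}"
    and g :: "'b::euclidean_space \<Rightarrow> 'c"
  assumes f: "integrable lborel f" and g: "integrable lborel g"
  shows "integrable lborel (\<lambda>(x, y). f x * g y)"
    and "(LINT p|lborel. (case p of (x, y) \<Rightarrow> f x * g y)) = (LINT x|lborel. f x) * (LINT y|lborel. g y)"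
proof -
  have [measurable]: "f \<in> borel_measurable borel" "g \<in> borel_measurable borel"
    using borel_measurable_integrable[OF f] borel_measurable_integrable[OF g] by auto
  have int: "integrable (lborel \<Otimes>\<^sub>M lborel) (\<lambda>(x, y). f x * g y)"
  proof (rule lborel_pair.Fubini_integrable)
    show "(\<lambda>(x, y). f x * g y) \<in> borel_measurable (lborel \<Otimes>\<^sub>M lborel)" by measurable
    have "integrable lborel (\<lambda>x. norm (f x) * (LINT y|lborel. norm (g y)))"
      using f by (intro integrable_mult_left integrable_norm)
    then show "integrable lborel (\<lambda>x. LINT y|lborel. norm (case (x, y) of (x, y) \<Rightarrow> f x * g y))"
      by (simp add: norm_mult)
    show "AE x in lborel. integrable lborel (\<lambda>y. case (x, y) of (x, y) \<Rightarrow> f x * g y)"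
      using g by simp
  qed
  then show "integrable lborel (\<lambda>(x, y). f x * g y)" by (simp add: lborel_prod)
  have "(LINT p|lborel. (case p of (x, y) \<Rightarrow> f x * g y)) = (LINT x|lborel. LINT y|lborel. f x * g y)"
    using lborel_pair.integral_fst'[OF int] by (simp add: lborel_prod)
  then show "(LINT p|lborel. (case p of (x, y) \<Rightarrow> f x * g y)) = (LINT x|lborel. f x) * (LINT y|lborel. g y)"
    by simp
qed

lemma integral_lborel_mult3:
  fixes f g h :: "real \<Rightarrow> 'c::{real_normed_field, banach, second_countable_topology}"
  assumes "integrable lborel f" "integrable lborel g" "integrable lborel h"
  shows "(LINT p|lborel. (case p of (x, yz) \<Rightarrow> f x * (case yz of (y, z) \<Rightarrow> g y * h z)))
    = (LINT x|lborel. f x) * ((LINT y|lborel. g y) * (LINT z|lborel. h z))"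
  using integral_lborel_mult(2)[OF assms(1) integral_lborel_mult(1)[OF assms(2,3)]]
    integral_lborel_mult(2)[OF assms(2,3)] by simp

text \<open>The substitution of \<open>r * x\<close> for \<open>x\<close> leaves
  \<open>sqrt (2 * pi)\<close> times the characteristic function of the standard normal distribution
  at \<open>- \<xi> / r\<close>.\<close>

lemma gauss_fourier_1d:
  fixes r \<xi> :: real
  assumes r: "r > 0"
  defines "f \<equiv> \<lambda>x. cis (- (x * \<xi>)) * complex_of_real (r * exp (- (r * x)\<^sup>2 / 2))"
  shows "integrable lborel f"
    and "(LINT x|lborel. f x) = complex_of_real (sqrt (2 * pi) * exp (- (\<xi> / r)\<^sup>2 / 2))"
proof -
  define g where "g = (\<lambda>x. complex_of_real (std_normal_density x) * cis (- (\<xi> / r) * x))"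
  have g_int: "integrable lborel g"
  proof (rule Bochner_Integration.integrable_bound[of _ std_normal_density])
    show "g \<in> borel_measurable lborel" unfolding g_def cis_conv_exp by measurable
  qed (auto simp: g_def norm_mult)
  have "char std_normal_distribution (- \<xi> / r) = (LINT x|lborel. g x)"
    unfolding char_def g_def by (subst integral_density) (auto simp: cis_conv_exp scaleR_conv_of_real mult_ac)
  then have g_val: "(LINT x|lborel. g x) = complex_of_real (exp (- (\<xi> / r)\<^sup>2 / 2))"
    by (simp add: char_std_normal_distribution)
  have fg: "f x = complex_of_real (sqrt (2 * pi) * r) * g (0 + r * x)" for x
    using r by (simp add: f_def g_def std_normal_density_def real_sqrt_mult mult_ac)
  have "integrable lborel (\<lambda>x. g (0 + r * x))" using lborel_integrable_real_affine[OF g_int, of r 0] r by simp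
  then show "integrable lborel f" unfolding fg by (intro integrable_mult_right) simp
  have "(LINT x|lborel. g x) = r *\<^sub>R (LINT x|lborel. g (0 + r * x))"
    using lborel_integral_real_affine[of r g 0] r by simp
  then show "(LINT x|lborel. f x) = complex_of_real (sqrt (2 * pi) * exp (- (\<xi> / r)\<^sup>2 / 2))"
    unfolding fg by (simp add: g_val[symmetric] scaleR_conv_of_real mult_ac)
       (use g_val in \<open>simp add: scaleR_conv_of_real mult_ac\<close>)
qed

lemma fourier_gauss_box:
  assumes "a > 0" "b > 0" "c > 0"
  shows "fourier (gauss_box a b c) (u, v, w) = complex_of_real
    (sqrt (2 * pi) ^ 3 * exp (- ((u / a)\<^sup>2 + (v / b)\<^sup>2 + (w / c)\<^sup>2) / 2))"
proof -
  define F where "F = (\<lambda>r \<xi> x. cis (- (x * \<xi>)) * complex_of_real (r * exp (- (r * x)\<^sup>2 / 2)))"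
  have F_int: "integrable lborel (F r \<xi>)" if "r > 0" for r \<xi>
    unfolding F_def by (rule gauss_fourier_1d(1)[OF that])
  have F_val: "(LINT x|lborel. F r \<xi> x) = complex_of_real (sqrt (2 * pi) * exp (- (\<xi> / r)\<^sup>2 / 2))"
    if "r > 0" for r \<xi>
    unfolding F_def by (rule gauss_fourier_1d(2)[OF that])
  have cis: "cis (- ((x, y, z) \<bullet> (u, v, w))) = cis (- (x * u)) * (cis (- (y * v)) * cis (- (z * w)))" for x y z
    by (simp add: cis_mult algebra_simps)
  have "fourier (gauss_box a b c) (u, v, w)
    = (LINT p|lborel. (case p of (x, yz) \<Rightarrow> F a u x * (case yz of (y, z) \<Rightarrow> F b v y * F c w z)))"
    unfolding fourier_def
  proof (intro Bochner_Integration.integral_cong refl)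
    fix p :: "real \<times> real \<times> real"
    obtain x y z where p: "p = (x, y, z)" by (cases p)
    show "cis (- (p \<bullet> (u, v, w))) * gauss_box a b c p
      = (case p of (x, yz) \<Rightarrow> F a u x * (case yz of (y, z) \<Rightarrow> F b v y * F c w z))"
      unfolding p cis by (simp add: gauss_box_def F_def mult_ac)
  qed
  also have "\<dots> = (LINT x|lborel. F a u x) * ((LINT x|lborel. F b v x) * (LINT x|lborel. F c w x))"
    by (intro integral_lborel_mult3 F_int assms)
  also have "\<dots> = complex_of_real ((sqrt (2 * pi) * sqrt (2 * pi) * sqrt (2 * pi)) *
     (exp (- (u / a)\<^sup>2 / 2) * (exp (- (v / b)\<^sup>2 / 2) * exp (- (w / c)\<^sup>2 / 2))))"
    by (simp only: F_val[OF assms(1)] F_val[OF assms(2)] F_val[OF assms(3)] of_real_mult mult_ac)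
  also have "exp (- (u / a)\<^sup>2 / 2) * (exp (- (v / b)\<^sup>2 / 2) * exp (- (w / c)\<^sup>2 / 2))
    = exp (- ((u / a)\<^sup>2 + (v / b)\<^sup>2 + (w / c)\<^sup>2) / 2)"
    unfolding mult_exp_exp by (simp add: add_divide_distrib)
  also have "sqrt (2 * pi) * sqrt (2 * pi) * sqrt (2 * pi) = sqrt (2 * pi) ^ 3"
    by (simp only: power3_eq_cube)
  finally show ?thesis .
qed

text \<open>Scaling: in each variable the integral of the \<open>p\<close>-th power is proportional
  to \<open>r powr (p - 1)\<close>, and the \<open>p\<close>-th root gives the exponent
  \<open>1 - 1 / p\<close>. What matters is that \<open>K\<close> is the same for all boxes.\<close>

lemma Lp_norm_gauss_box:
  assumes p: "p > 1"
  shows "\<exists>K\<ge>0. \<forall>a>0. \<forall>b>0. \<forall>c>0. Lp_norm p (gauss_box a b c) = K * (a * b * c) powr (1 - 1 / p)"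
proof -
  define h where "h = (\<lambda>x::real. exp (- (p * x\<^sup>2) / 2))"
  have h_int: "integrable lborel h"
  proof -
    have "h = (\<lambda>x. sqrt (2 * pi) * std_normal_density (0 + sqrt p * x))"
      using p by (simp add: h_def std_normal_density_def real_sqrt_mult power_mult_distrib fun_eq_iff)
    moreover have "integrable lborel (\<lambda>x. std_normal_density (0 + sqrt p * x))"
      using p by (intro lborel_integrable_real_affine) auto
    ultimately show ?thesis by simp
  qed
  define I where "I = (LINT x|lborel. h x)"
  have I: "I \<ge> 0" unfolding I_def by (intro integral_nonneg_AE) (auto simp: h_def)
  define H where "H = (\<lambda>r x. (r * exp (- (r * x)\<^sup>2 / 2)) powr p)"
  have H: "integrable lborel (H r)" "(LINT x|lborel. H r x) = r powr (p - 1) * I" if r: "r > 0" for r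
  proof -
    have Hh: "H r x = r powr p * h (0 + r * x)" for x
      using r by (simp add: H_def h_def powr_mult exp_powr_real mult_ac)
    have "integrable lborel (\<lambda>x. h (0 + r * x))" using lborel_integrable_real_affine[OF h_int, of r 0] r by simp
    then show "integrable lborel (H r)" unfolding Hh[abs_def] by (intro integrable_mult_right) simp
    have "I = r * (LINT x|lborel. h (0 + r * x))"
      using lborel_integral_real_affine[of r h 0] r by (simp add: I_def)
    moreover have "r powr p = r powr (p - 1) * r" using r by (simp add: powr_diff)
    ultimately show "(LINT x|lborel. H r x) = r powr (p - 1) * I" unfolding Hh by simp
  qed
  have "Lp_norm p (gauss_box a b c) = (I ^ 3) powr (1 / p) * (a * b * c) powr (1 - 1 / p)"
    if abc: "a > 0" "b > 0" "c > 0" for a b c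
  proof -
    have "(LINT x|lborel. norm (gauss_box a b c x) powr p)
      = (LINT q|lborel. (case q of (x, yz) \<Rightarrow> H a x * (case yz of (y, z) \<Rightarrow> H b y * H c z)))"
      using abc
      by (intro Bochner_Integration.integral_cong refl)
         (auto simp: gauss_box_def H_def powr_mult norm_mult abs_mult)
    also have "\<dots> = (LINT x|lborel. H a x) * ((LINT x|lborel. H b x) * (LINT x|lborel. H c x))"
      by (intro integral_lborel_mult3 H abc)
    also have "\<dots> = I ^ 3 * (a * b * c) powr (p - 1)"
      using H abc by (simp add: powr_mult power3_eq_cube mult_ac)
    finally have "Lp_norm p (gauss_box a b c) = (I ^ 3 * (a * b * c) powr (p - 1)) powr (1 / p)"
      by (simp add: Lp_norm_def)
    also have "\<dots> = (I ^ 3) powr (1 / p) * (a * b * c) powr ((p - 1) * (1 / p))"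
      using I by (simp add: powr_mult powr_powr)
    also have "(p - 1) * (1 / p) = 1 - 1 / p" using p by (simp add: field_simps)
    finally show ?thesis .
  qed
  then show ?thesis by (intro exI[of _ "(I ^ 3) powr (1 / p)"]) simp
qed

section \<open>Knapp boxes\<close>

text \<open>In the chart the integrand gains the area factor \<open>J\<close>, which is at least 1,
  so restricting the nonnegative integrand to \<open>D\<close> gives the bound.\<close>

lemma surface_integral_ge:
  assumes \<Omega>: "open \<Omega>" and \<phi>: "smooth_on \<Omega> \<phi>"
    and \<rho>: "smooth_compactly_supported_on_graph \<Omega> \<phi> \<rho>" "\<And>x. x \<in> \<Omega> \<Longrightarrow> 0 \<le> \<rho> (graph_map \<phi> x)"
    and G: "continuous_on UNIV G" "\<And>\<xi>. 0 \<le> G \<xi>"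
    and D: "D \<in> sets borel" "D \<subseteq> \<Omega>" "emeasure lborel D < \<infinity>" "\<And>x. x \<in> D \<Longrightarrow> c \<le> G (graph_map \<phi> x) * \<rho> (graph_map \<phi> x)"
  shows "c * measure lborel D \<le> (LINT \<xi>|surface_measure \<Omega> \<phi>. G \<xi> * \<rho> \<xi>)"
proof -
  define J where "J = (\<lambda>x. sqrt (1 + (dirderiv (1, 0) \<phi> x)\<^sup>2 + (dirderiv (0, 1) \<phi> x)\<^sup>2))"
  define u where "u = (\<lambda>x. \<rho> (graph_map \<phi> x))"
  define h where "h = (\<lambda>x. G (graph_map \<phi> x) * u x)"
  let ?S = "graph_map \<phi> ` \<Omega>" and ?M = "restrict_space lborel \<Omega>"
  have c\<phi>: "continuous_on \<Omega> \<phi>" using smooth_on_continuous[OF \<phi>] .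
  have cgraph: "continuous_on \<Omega> (graph_map \<phi>)"
    unfolding graph_map_def by (intro continuous_intros c\<phi>)
  have cu: "continuous_on \<Omega> u"
    using \<rho>(1) smooth_on_continuous by (auto simp: smooth_compactly_supported_on_graph_def u_def o_def)
  have cJ: "continuous_on \<Omega> J"
    unfolding J_def by (intro continuous_intros smooth_on_continuous smooth_on_dirderiv \<phi>)
  have ch: "continuous_on \<Omega> h"
    unfolding h_def by (intro continuous_intros cu continuous_on_compose2[OF G(1) cgraph]) auto
  obtain K where K: "compact K" "K \<subseteq> \<Omega>" "\<And>x. x \<in> \<Omega> - K \<Longrightarrow> u x = 0"
    using \<rho>(1) by (auto simp: smooth_compactly_supported_on_graph_def u_def)
  have J1: "J x \<ge> 1" for x by (simp add: J_def)
  have h0: "h x \<ge> 0" if "x \<in> \<Omega>" for x using that \<rho>(2) G(2) by (simp add: h_def u_def)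
  have sets_M: "sets ?M = sets (restrict_space borel \<Omega>)" by (intro sets_restrict_space_cong) simp
  have meas: "f \<in> borel_measurable ?M" if "continuous_on \<Omega> f" for f :: "real \<times> real \<Rightarrow> 'b::topological_space"
    using borel_measurable_continuous_on_restrict[OF that] measurable_cong_sets[OF sets_M refl] by blast
  have graph_meas: "graph_map \<phi> \<in> measurable ?M (restrict_space borel ?S)"
    by (intro measurable_restrict_space2 meas cgraph) (auto simp: space_restrict_space)
  \<comment> \<open>Regularity of \<open>\<rho>\<close> is known only through the chart; on the
    graph the chart point is recovered from the first two coordinates, which yields
    measurability.\<close>
  have "continuous_on ?S (\<lambda>\<xi>. G \<xi> * u (fst \<xi>, fst (snd \<xi>)))"
    by (intro continuous_intros continuous_on_subset[OF G(1)] continuous_on_compose2[OF cu])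
       (auto simp: graph_map_def)
  then have "(\<lambda>\<xi>. G \<xi> * u (fst \<xi>, fst (snd \<xi>))) \<in> borel_measurable (restrict_space borel ?S)"
    by (rule borel_measurable_continuous_on_restrict)
  moreover have "G \<xi> * u (fst \<xi>, fst (snd \<xi>)) = G \<xi> * \<rho> \<xi>" if "\<xi> \<in> space (restrict_space borel ?S)" for \<xi>
    using that by (auto simp: space_restrict_space u_def graph_map_def)
  ultimately have F_meas: "(\<lambda>\<xi>. G \<xi> * \<rho> \<xi>) \<in> borel_measurable (restrict_space borel ?S)"
    using measurable_cong[of "restrict_space borel ?S"] by (metis (no_types, lifting))
  have sd: "surface_measure \<Omega> \<phi> = distr (density ?M (\<lambda>x. ennreal (J x))) (restrict_space borel ?S) (graph_map \<phi>)"
    by (simp add: surface_measure_def J_def)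
  have "(LINT \<xi>|surface_measure \<Omega> \<phi>. G \<xi> * \<rho> \<xi>) = (LINT x|density ?M (\<lambda>x. ennreal (J x)). h x)"
    unfolding sd h_def u_def
    by (rule integral_distr) (use graph_meas F_meas in \<open>simp_all add: measurable_density_eq1\<close>)
  also have "\<dots> = (LINT x|?M. J x *\<^sub>R h x)"
    by (rule integral_density) (use J1 in \<open>auto intro!: meas ch cJ AE_I2 intro: order_trans[OF zero_le_one]\<close>)
  also have "\<dots> = (LINT x|lborel. indicator \<Omega> x *\<^sub>R (J x *\<^sub>R h x))"
    by (rule integral_restrict_space) (use \<Omega> in auto)
  finally have eq: "(LINT \<xi>|surface_measure \<Omega> \<phi>. G \<xi> * \<rho> \<xi>) = (LINT x|lborel. indicator \<Omega> x *\<^sub>R (J x *\<^sub>R h x))" .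
  \<comment> \<open>A non-integrable function would have integral 0 by convention and the lower
    bound could fail; the compact support of \<open>\<rho>\<close> in the chart excludes
    this.\<close>
  have "integrable lborel (\<lambda>x. indicator K x *\<^sub>R (J x *\<^sub>R h x))"
    using K(2) by (intro borel_integrable_compact K(1) continuous_intros continuous_on_subset[OF cJ] continuous_on_subset[OF ch])
  moreover have "indicator K x *\<^sub>R (J x *\<^sub>R h x) = indicator \<Omega> x *\<^sub>R (J x *\<^sub>R h x)" for x
    using K(2) K(3)[of x] by (auto simp: indicator_def h_def)
  ultimately have int: "integrable lborel (\<lambda>x. indicator \<Omega> x *\<^sub>R (J x *\<^sub>R h x))" by (simp only:)
  have "c * measure lborel D = (LINT x|lborel. c * indicator D x)" by simp
  also have "\<dots> \<le> (LINT x|lborel. indicator \<Omega> x *\<^sub>R (J x *\<^sub>R h x))"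
  proof (rule integral_mono)
    show "integrable lborel (\<lambda>x. c * indicator D x)" using D by simp
    fix x :: "real \<times> real"
    show "c * indicator D x \<le> indicator \<Omega> x *\<^sub>R (J x *\<^sub>R h x)"
    proof (cases "x \<in> D")
      case True
      then have x: "x \<in> \<Omega>" using D by blast
      have "c \<le> h x" using D(4)[OF True] by (simp add: h_def u_def)
      also have "\<dots> \<le> J x * h x" using J1[of x] h0[OF x] mult_right_mono[of 1 "J x" "h x"] by simp
      finally show ?thesis using True x by simp
    next
      case False
      have "J x * h x \<ge> 0" if "x \<in> \<Omega>" using J1[of x] h0[OF that] by simp
      then show ?thesis using False by (auto simp: indicator_def)
    qed
  qed (rule int)
  finally show ?thesis using eq by simp
qed

text \<open>The set is open, and by Fubini it has the area of a rectangle: each vertical slice is an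
  interval of length \<open>2 * b\<close>, centred at \<open>\<psi>\<close>.\<close>

lemma sheared_box:
  fixes \<psi> :: "real \<Rightarrow> real"
  assumes \<psi>: "continuous_on {-a<..<a} \<psi>" and ab: "a > 0" "b > 0"
  defines "D \<equiv> {x :: real \<times> real. \<bar>fst x\<bar> < a \<and> \<bar>snd x - \<psi> (fst x)\<bar> < b}"
  shows "D \<in> sets borel" "emeasure lborel D = ennreal (4 * (a * b))"
proof -
  let ?A = "{x :: real \<times> real. \<bar>fst x\<bar> < a}"
  have oA: "open ?A" by (intro open_Collect_less continuous_intros)
  have "continuous_on ?A (\<lambda>x. \<bar>snd x - \<psi> (fst x)\<bar>)"
    by (intro continuous_intros continuous_on_compose2[OF \<psi>]) auto
  then have "open ((\<lambda>x. \<bar>snd x - \<psi> (fst x)\<bar>) -` {..<b} \<inter> ?A)"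
    by (rule continuous_on_open_vimage[OF oA, THEN iffD1, rule_format]) simp
  moreover have "D = (\<lambda>x. \<bar>snd x - \<psi> (fst x)\<bar>) -` {..<b} \<inter> ?A" by (auto simp: D_def)
  ultimately show D: "D \<in> sets borel" by simp
  have "emeasure lborel D = emeasure (lborel \<Otimes>\<^sub>M lborel) D" by (simp add: lborel_prod)
  also have "\<dots> = (\<integral>\<^sup>+x. emeasure lborel (Pair x -` D) \<partial>lborel)"
    using D by (intro lborel.emeasure_pair_measure_alt) (simp only: lborel_prod sets_lborel)
  also have "\<dots> = (\<integral>\<^sup>+x. ennreal (2 * b) * indicator {-a<..<a} x \<partial>lborel)"
  proof (intro nn_integral_cong)
    fix x
    have "Pair x -` D = (if \<bar>x\<bar> < a then {\<psi> x - b<..<\<psi> x + b} else {})" by (auto simp: D_def)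
    then show "emeasure lborel (Pair x -` D) = ennreal (2 * b) * indicator {-a<..<a} x"
      using ab by (auto simp: indicator_def)
  qed
  also have "\<dots> = ennreal (2 * b) * ennreal (2 * a)"
    using ab by (simp add: nn_integral_cmult_indicator)
  also have "\<dots> = ennreal (4 * (a * b))" using ab by (simp add: ennreal_mult[symmetric] mult_ac)
  finally show "emeasure lborel D = ennreal (4 * (a * b))" .
qed

lemma powr_exponent_le:
  assumes A: "A > 0" and ev: "eventually (\<lambda>e. A * e powr \<alpha> \<le> B * e powr s) (at_right (0::real))"
  shows "s \<le> \<alpha>"
proof (rule ccontr)
  assume "\<not> s \<le> \<alpha>"
  have "((\<lambda>e. B * e powr (s - \<alpha>)) \<longlongrightarrow> B * 0) (at_right 0)"
    using \<open>\<not> s \<le> \<alpha>\<close> eventually_at_right_less[of "0::real"]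
    by (intro tendsto_mult tendsto_const tendsto_zero_powrI[where b = "s - \<alpha>"] tendsto_ident_at)
       (auto elim: eventually_mono)
  moreover have "eventually (\<lambda>e. A \<le> B * e powr (s - \<alpha>)) (at_right 0)"
    using ev eventually_at_right_less[of "0::real"]
  proof eventually_elim
    case (elim e)
    then have "A * e powr \<alpha> \<le> (B * e powr (s - \<alpha>)) * e powr \<alpha>" by (simp add: powr_diff)
    then show ?case using elim by simp
  qed
  ultimately have "A \<le> B * 0" by (rule tendsto_lowerbound) simp
  then show False using A by simp
qed

text \<open>Stated for a general \<open>\<mu>\<close> because it is applied both to the root jet and
  to the zero function, for which every power bound holds. The left exponent is that of the volume
  of the box, from the norm of the test function; the right one is half that of the area of the
  piece, from the square root of the surface integral.\<close>

lemma knapp_bound: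
  fixes \<phi> :: "real \<times> real \<Rightarrow> real" and \<psi> :: "real \<Rightarrow> real"
  assumes sm: "smooth_near_0 (shear \<psi> \<phi>)" and \<kappa>: "\<kappa>1 > 0" "\<kappa>2 > 0"
    and supp: "\<And>j k. (j, k) \<in> taylor_support (shear \<psi> \<phi>) \<Longrightarrow> 1 \<le> \<kappa>1 * real j + \<kappa>2 * real k"
    and \<psi>: "smooth_near_0 \<psi>" "\<exists>C\<ge>0. \<exists>r>0. \<forall>s. \<bar>s\<bar> \<le> r \<longrightarrow> \<bar>\<psi> s\<bar> \<le> C * \<bar>s\<bar> powr \<mu>"
    and \<mu>: "\<mu> > 0" "\<mu> * \<kappa>1 \<le> \<kappa>2"
    and \<Omega>: "open \<Omega>" "0 \<in> \<Omega>" and \<phi>: "smooth_on \<Omega> \<phi>" "\<phi> 0 = 0"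
    and \<rho>: "smooth_compactly_supported_on_graph \<Omega> \<phi> \<rho>" "\<forall>x\<in>graph_map \<phi> ` \<Omega>. 0 \<le> \<rho> x" "\<rho> 0 \<noteq> 0"
    and rest: "restriction_estimate (surface_measure \<Omega> \<phi>) \<rho> p" and p: "p > 1"
  shows "(1 + (1 + \<mu>) * \<kappa>1) * (1 - 1 / p) \<le> (\<kappa>1 + \<kappa>2) / 2"
proof -
  obtain C1 e1 where C1: "C1 \<ge> 0" "e1 > 0" "\<And>e x y. 0 < e \<Longrightarrow> e < e1 \<Longrightarrow> \<bar>x\<bar> \<le> e powr \<kappa>1 \<Longrightarrow>
      \<bar>y\<bar> \<le> e powr \<kappa>2 \<Longrightarrow> \<bar>shear \<psi> \<phi> (x, y)\<bar> \<le> C1 * e"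
    using anisotropic_box_bound[OF sm \<kappa> supp] by blast
  obtain C2 r2 where C2: "C2 \<ge> 0" "r2 > 0" "\<And>s. \<bar>s\<bar> \<le> r2 \<Longrightarrow> \<bar>\<psi> s\<bar> \<le> C2 * \<bar>s\<bar> powr \<mu>"
    using \<psi>(2) by blast
  obtain V where V: "open V" "0 \<in> V" "smooth_on V \<psi>" using \<psi>(1) by (auto simp: smooth_near_0_def)
  obtain r3 where r3: "r3 > 0" "ball 0 r3 \<subseteq> V" using V openE by blast
  define u where "u = (\<lambda>x. \<rho> (graph_map \<phi> x))"
  have g0: "graph_map \<phi> 0 = 0" using \<phi>(2) by (simp add: graph_map_def zero_prod_def)
  have u0: "u 0 > 0" using \<rho>(2,3) \<Omega>(2) g0 by (force simp: u_def)
  have "continuous_on \<Omega> u"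
    using \<rho>(1) smooth_on_continuous by (auto simp: smooth_compactly_supported_on_graph_def u_def o_def)
  then have "(u \<longlongrightarrow> u 0) (nhds 0)"
    using \<Omega> by (simp add: continuous_on_eq_continuous_at isCont_def tendsto_at_iff_tendsto_nhds)
  then have "eventually (\<lambda>x. u x > u 0 / 2) (nhds 0)" by (rule order_tendstoD(1)) (use u0 in simp)
  then have "eventually (\<lambda>x. x \<in> \<Omega> \<and> u x > u 0 / 2) (nhds 0)"
    using eventually_nhds_in_open[OF \<Omega>] by eventually_elim auto
  then obtain r4 where r4: "r4 > 0" "\<And>x. dist x 0 < r4 \<Longrightarrow> x \<in> \<Omega> \<and> u x > u 0 / 2"
    unfolding eventually_nhds_metric by blast
  obtain K where K: "K \<ge> 0" "\<And>a b c. a > 0 \<Longrightarrow> b > 0 \<Longrightarrow> c > 0 \<Longrightarrow>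
      Lp_norm p (gauss_box a b c) = K * (a * b * c) powr (1 - 1 / p)"
    using Lp_norm_gauss_box[OF p] by blast
  obtain C where C: "\<And>f. schwartz f \<Longrightarrow>
      sqrt (LINT \<xi>|surface_measure \<Omega> \<phi>. (norm (fourier f \<xi>))\<^sup>2 * \<rho> \<xi>) \<le> C * Lp_norm p f"
    using rest by (auto simp: restriction_estimate_def)
  \<comment> \<open>A lower bound for the Fourier transform on the piece: after division by the
    sides of the box the coordinates there are at most 1, \<open>1 + C2\<close> and
    \<open>C1\<close> in modulus.\<close>
  define c0 where "c0 = sqrt (2 * pi) ^ 3 * exp (- (1 + (1 + C2)\<^sup>2 + C1\<^sup>2) / 2)"
  have c0: "c0 > 0" by (simp add: c0_def)
  \<comment> \<open>The factor 4 comes from the area \<open>(2 * a) * (2 * e powr \<kappa>2)\<close>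
    of the piece, and \<open>u 0 / 2\<close> bounds the density \<open>\<rho>\<close> from below on
    it.\<close>
  define A where "A = sqrt (c0\<^sup>2 * (u 0 / 2) * 4)"
  have A: "A > 0" using c0 u0 by (simp add: A_def)
  define s where "s = (1 + (1 + \<mu>) * \<kappa>1) * (1 - 1 / p)"
  have lim: "((\<lambda>e. e powr t) \<longlongrightarrow> 0) (at_right (0::real))" if "t > 0" for t
    using that eventually_at_right_less[of "0::real"]
    by (intro tendsto_zero_powrI[where b = t] tendsto_ident_at tendsto_const) (auto elim: eventually_mono)
  \<comment> \<open>This sum bounds the distance from the origin of the points of the piece, which
    must stay below \<open>r4\<close>.\<close>
  have lim2: "((\<lambda>e. e powr \<kappa>1 + (1 + C2) * e powr (\<mu> * \<kappa>1)) \<longlongrightarrow> 0) (at_right 0)"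
    using tendsto_add[OF lim[OF \<kappa>(1)] tendsto_mult[OF tendsto_const[of "1 + C2"] lim[of "\<mu> * \<kappa>1"]]] \<mu> \<kappa> by simp
  have "eventually (\<lambda>e. A * e powr ((\<kappa>1 + \<kappa>2) / 2) \<le> (\<bar>C\<bar> * K) * e powr s) (at_right 0)"
    using eventually_at_right_less[of "0::real"]
      order_tendstoD(2)[OF tendsto_ident_at[of "0::real" "{0<..}"] C1(2)]
      order_tendstoD(2)[OF tendsto_ident_at[of "0::real" "{0<..}"] zero_less_one]
      order_tendstoD(2)[OF lim[OF \<kappa>(1)] C2(2)] order_tendstoD(2)[OF lim[OF \<kappa>(1)] r3(1)]
      order_tendstoD(2)[OF lim2 r4(1)]
  proof eventually_elim
    case (elim e)
    define a b where "a = e powr \<kappa>1" and "b = e powr (\<mu> * \<kappa>1)"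
    have pos: "e > 0" "a > 0" "b > 0" using elim by (auto simp: a_def b_def)
    define D where "D = {x :: real \<times> real. \<bar>fst x\<bar> < a \<and> \<bar>snd x - \<psi> (fst x)\<bar> < e powr \<kappa>2}"
    have "continuous_on {-a<..<a} \<psi>"
      using elim r3(2) by (intro continuous_on_subset[OF smooth_on_continuous[OF V(3)]]) (auto simp: a_def subset_iff)
    note box = sheared_box[OF this pos(2), of "e powr \<kappa>2", folded D_def]
    have bound2: "\<bar>snd x\<bar> \<le> (1 + C2) * b" if x: "x \<in> D" for x
    proof -
      have "\<bar>\<psi> (fst x)\<bar> \<le> C2 * \<bar>fst x\<bar> powr \<mu>" using x elim by (intro C2(3)) (auto simp: D_def a_def)
      also have "\<dots> \<le> C2 * a powr \<mu>"
        using x \<mu> C2(1) by (intro mult_left_mono powr_mono2) (auto simp: D_def)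
      also have "a powr \<mu> = b" by (simp add: a_def b_def powr_powr mult.commute)
      finally have 1: "\<bar>\<psi> (fst x)\<bar> \<le> C2 * b" .
      \<comment> \<open>Here \<open>\<mu> * \<kappa>1 \<le> \<kappa>2\<close> and
        \<open>e < 1\<close> enter: the thickness around the curve is at most the height swept by
        it.\<close>
      have "e powr \<kappa>2 \<le> b" unfolding b_def using elim \<mu> by (intro powr_mono') auto
      then have "\<bar>snd x - \<psi> (fst x)\<bar> \<le> b" using x by (auto simp: D_def)
      then have "\<bar>snd x\<bar> \<le> b + C2 * b" using 1 by linarith
      then show ?thesis by (simp add: distrib_right)
    qed
    have bound3: "\<bar>\<phi> x\<bar> \<le> C1 * e" if x: "x \<in> D" for x
    proof -
      have "\<bar>shear \<psi> \<phi> (fst x, snd x - \<psi> (fst x))\<bar> \<le> C1 * e"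
        using x elim by (intro C1(3)) (auto simp: D_def a_def)
      then show ?thesis by (simp add: shear_def)
    qed
    have near: "x \<in> \<Omega> \<and> u x > u 0 / 2" if x: "x \<in> D" for x
    proof (rule r4(2))
      have "dist x 0 \<le> \<bar>fst x\<bar> + \<bar>snd x\<bar>"
        by (cases x) (simp add: norm_Pair sqrt_sum_squares_le_sum_abs)
      also have "\<dots> \<le> a + (1 + C2) * b" using x bound2[OF x] by (auto simp: D_def)
      also have "\<dots> < r4" using elim by (simp add: a_def b_def)
      finally show "dist x 0 < r4" .
    qed
    define G where "G = (\<lambda>\<xi>. (norm (fourier (gauss_box (e powr \<kappa>1) b e) \<xi>))\<^sup>2)"
    have G_eq: "G \<xi> = (sqrt (2 * pi) ^ 3 *
      exp (- ((fst \<xi> / a)\<^sup>2 + (fst (snd \<xi>) / b)\<^sup>2 + (snd (snd \<xi>) / e)\<^sup>2) / 2))\<^sup>2" for \<xi>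
      using pos fourier_gauss_box[of a b e "fst \<xi>" "fst (snd \<xi>)" "snd (snd \<xi>)"]
      by (simp add: G_def a_def[symmetric] norm_mult norm_power)
    have lower: "c0\<^sup>2 * (u 0 / 2) \<le> G (graph_map \<phi> x) * \<rho> (graph_map \<phi> x)" if x: "x \<in> D" for x
    proof -
      have "\<bar>fst x / a\<bar> \<le> 1" using x pos by (auto simp: D_def abs_divide)
      then have t1: "(fst x / a)\<^sup>2 \<le> 1" using abs_square_le_1[of "fst x / a"] by simp
      have "\<bar>snd x / b\<bar> \<le> 1 + C2" using bound2[OF x] pos by (simp add: abs_divide field_simps)
      then have t2: "(snd x / b)\<^sup>2 \<le> (1 + C2)\<^sup>2" using power2_le_iff_abs_le[of "1 + C2" "snd x / b"] C2(1) by simp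
      have "\<bar>\<phi> x / e\<bar> \<le> C1" using bound3[OF x] pos by (simp add: abs_divide field_simps)
      then have t3: "(\<phi> x / e)\<^sup>2 \<le> C1\<^sup>2" using power2_le_iff_abs_le[of C1 "\<phi> x / e"] C1(1) by simp
      have "c0\<^sup>2 \<le> G (graph_map \<phi> x)"
        unfolding G_eq c0_def graph_map_def
        using t1 t2 t3 by (intro power_mono mult_left_mono) auto
      then show ?thesis using near[OF x] u0 by (intro mult_mono) (auto simp: u_def G_def)
    qed
    have "c0\<^sup>2 * (u 0 / 2) * measure lborel D \<le> (LINT \<xi>|surface_measure \<Omega> \<phi>. G \<xi> * \<rho> \<xi>)"
    proof (rule surface_integral_ge[OF \<Omega>(1) \<phi>(1) \<rho>(1)])
      show "continuous_on UNIV G" unfolding G_eq[abs_def] using pos by (intro continuous_intros) auto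
    qed (use \<rho>(2) box near lower pos in \<open>auto simp: G_def\<close>)
    moreover have "measure lborel D = 4 * (e powr (\<kappa>1 + \<kappa>2))"
      using box(2) pos by (simp add: measure_def a_def powr_add)
    ultimately have "A\<^sup>2 * e powr (\<kappa>1 + \<kappa>2) \<le> (LINT \<xi>|surface_measure \<Omega> \<phi>. G \<xi> * \<rho> \<xi>)"
      using u0 by (simp add: A_def mult_ac)
    then have "sqrt (A\<^sup>2 * e powr (\<kappa>1 + \<kappa>2)) \<le> sqrt (LINT \<xi>|surface_measure \<Omega> \<phi>. G \<xi> * \<rho> \<xi>)" by simp
    also have "\<dots> \<le> C * Lp_norm p (gauss_box a b e)"
      unfolding G_def a_def[symmetric] using pos by (intro C schwartz_gauss_box)
    also have "\<dots> = C * (K * (a * b * e) powr (1 - 1 / p))" using K(2) pos by simp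
    \<comment> \<open>The constant of the estimate carries no sign in
      \<open>restriction_estimate\<close>.\<close>
    also have "\<dots> \<le> \<bar>C\<bar> * (K * (a * b * e) powr (1 - 1 / p))" using K(1) by (intro mult_right_mono) auto
    also have "(a * b * e) powr (1 - 1 / p) = e powr s"
    proof -
      have "a * b * e = e powr (1 + (1 + \<mu>) * \<kappa>1)"
        using pos by (simp add: a_def b_def powr_add[symmetric] powr_mult_base[symmetric] algebra_simps)
      then show ?thesis by (simp add: s_def powr_powr)
    qed
    finally have "sqrt (A\<^sup>2 * e powr (\<kappa>1 + \<kappa>2)) \<le> \<bar>C\<bar> * K * e powr s" by simp
    moreover have "sqrt (e powr (\<kappa>1 + \<kappa>2)) = e powr ((\<kappa>1 + \<kappa>2) / 2)"
      by (simp add: powr_half_sqrt[symmetric] powr_powr)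
    ultimately show ?case using A by (simp add: real_sqrt_mult)
  qed
  then show ?thesis unfolding s_def[symmetric] by (rule powr_exponent_le[OF A])
qed

section \<open>The necessary condition\<close>

text \<open>If the sheared function were flat, it would be \<open>O(norm z ^ n)\<close> for every
  \<open>n\<close>. Undoing the shear enlarges distances from the origin at most by a constant
  factor, so \<open>\<phi>\<close> would decay equally fast, contradicting
  \<open>taylor_support_empty\<close>.\<close>

lemma shear_finite_type:
  assumes "smooth_near_0 \<phi>" "finite_type \<phi>" "smooth_near_0 (shear \<psi> \<phi>)"
    and \<psi>: "C \<ge> 0" "r > 0" "\<And>s. \<bar>s\<bar> \<le> r \<Longrightarrow> \<bar>\<psi> s\<bar> \<le> C * \<bar>s\<bar>"
  shows "taylor_support (shear \<psi> \<phi>) \<noteq> {}"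
proof
  assume flat: "taylor_support (shear \<psi> \<phi>) = {}"
  have "taylor_support \<phi> = {}"
  proof (rule taylor_support_empty[OF assms(1)])
    fix n
    have "taylor_poly (shear \<psi> \<phi>) n x y = 0" for x y
      using flat by (auto simp: taylor_poly_def taylor_support_def intro!: sum.neutral)
    then obtain r' C' where C': "r' > 0" "C' \<ge> 0" "\<And>x y. \<bar>x\<bar> \<le> r' \<Longrightarrow> \<bar>y\<bar> \<le> r' \<Longrightarrow>
      \<bar>shear \<psi> \<phi> (x, y)\<bar> \<le> C' * (\<bar>x\<bar> ^ n + \<bar>y\<bar> ^ n)"
      using taylor_expansion[OF assms(3), of n] by auto
    have factor: "c * (t + w * t) = (c * (1 + w)) * t" for c t w :: real by (simp add: algebra_simps)
    define e where "e = min r (r' / (1 + C))"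
    have e: "e > 0" using C' \<psi> by (simp add: e_def)
    have "\<bar>\<phi> z\<bar> \<le> (C' * (1 + (1 + C) ^ n)) * norm z ^ n" if z: "dist z 0 < e" for z
    proof -
      obtain x y where xy: "z = (x, y)" by (cases z)
      have x: "\<bar>x\<bar> \<le> norm z" and y: "\<bar>y\<bar> \<le> norm z"
        using norm_fst_le[of x y] norm_snd_le[of y x] xy by auto
      have "\<bar>\<psi> x\<bar> \<le> C * \<bar>x\<bar>" using x z by (intro \<psi>) (auto simp: e_def)
      also have "\<dots> \<le> C * norm z" using x \<psi>(1) by (intro mult_left_mono)
      finally have y': "\<bar>y - \<psi> x\<bar> \<le> (1 + C) * norm z" using y by (simp add: distrib_right)
      have "(1 + C) * norm z \<le> r'" using z \<psi>(1) by (simp add: e_def pos_less_divide_eq mult.commute)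
      moreover have "norm z \<le> (1 + C) * norm z" using \<psi>(1) by (simp add: distrib_right)
      ultimately have "\<bar>shear \<psi> \<phi> (x, y - \<psi> x)\<bar> \<le> C' * (\<bar>x\<bar> ^ n + \<bar>y - \<psi> x\<bar> ^ n)"
        using x y' by (intro C') auto
      also have "\<dots> \<le> C' * (norm z ^ n + ((1 + C) * norm z) ^ n)"
        using x y' C'(2) by (intro mult_left_mono add_mono power_mono) auto
      also have "\<dots> = (C' * (1 + (1 + C) ^ n)) * norm z ^ n"
        unfolding power_mult_distrib using factor[of C' "norm z ^ n" "(1 + C) ^ n"] .
      finally show ?thesis by (simp add: xy shear_def)
    qed
    then show "\<exists>C. eventually (\<lambda>z. \<bar>\<phi> z\<bar> \<le> C * norm z ^ n) (nhds 0)"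
      using e unfolding eventually_nhds_metric by blast
  qed
  then show False using assms(2) by (simp add: finite_type_def)
qed

lemma restriction_height_cases:
  assumes "taylor_support (shear \<psi> \<phi>) \<noteq> {}"
  obtains "restriction_height \<phi> \<psi> = newton_distance \<phi>"
  | "restriction_height \<phi> \<psi> = snd (last_vertex (newton_hull (taylor_support (shear \<psi> \<phi>)))) - 1"
  | \<gamma> where "\<gamma> \<in> compact_edges (newton_hull (taylor_support (shear \<psi> \<phi>)))"
      "snd (edge_weight \<gamma>) / fst (edge_weight \<gamma>) > principal_exponent \<phi>"
      "restriction_height \<phi> \<psi> = edge_height (principal_exponent \<phi>) (edge_weight \<gamma>)"
proof -
  let ?N = "newton_hull (taylor_support (shear \<psi> \<phi>))"
  let ?H = "{newton_distance \<phi>, snd (last_vertex ?N) - 1} \<union>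
        {edge_height (principal_exponent \<phi>) (edge_weight \<gamma>) | \<gamma>.
           \<gamma> \<in> compact_edges ?N \<and> snd (edge_weight \<gamma>) / fst (edge_weight \<gamma>) > principal_exponent \<phi>}"
  have "finite ?H"
    using finite_compact_edges[of "taylor_support (shear \<psi> \<phi>)"] by auto
  then have "Max ?H \<in> ?H" by (rule Max_in) simp
  moreover have "restriction_height \<phi> \<psi> = Max ?H"
    by (simp add: restriction_height_def newton_polyhedron_eq Let_def)
  ultimately have "restriction_height \<phi> \<psi> \<in> ?H" by simp
  then show ?thesis using that by blast
qed

text \<open>The weight of the horizontal edge is not positive, so the edge is tilted slightly about
  \<open>(A, B)\<close>: the line of weight \<open>(t, (1 - t * A) / B)\<close> passes through this
  vertex and, for small \<open>t\<close>, stays below the support. The bound follows as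
  \<open>t\<close> tends to 0.\<close>

lemma last_vertex_bound:
  fixes q m :: real
  assumes S: "\<And>j k. (j, k) \<in> S \<Longrightarrow> B < k \<or> k = B \<and> A \<le> j"
    and knapp: "\<And>\<kappa>1 \<kappa>2. 0 < \<kappa>1 \<Longrightarrow> 0 < \<kappa>2 \<Longrightarrow> m * \<kappa>1 \<le> \<kappa>2 \<Longrightarrow>
      (\<And>j k. (j, k) \<in> S \<Longrightarrow> 1 \<le> \<kappa>1 * real j + \<kappa>2 * real k) \<Longrightarrow>
      2 * (1 + (1 + m) * \<kappa>1) \<le> q * (\<kappa>1 + \<kappa>2)"
    and q: "0 \<le> q"
  shows "2 * real B \<le> q"
proof (cases "B = 0")
  case False
  let ?k2 = "\<lambda>t. (1 - t * real A) / real B"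
  have B: "real B > 0" using False by simp
  \<comment> \<open>\<open>t * A < 1 / (B + 1)\<close> is what places all points in the rows from
    \<open>B + 1\<close> upwards on the correct side of the tilted line, whatever their first
    coordinate. The limit \<open>l2\<close> ensures \<open>m * t \<le> ?k2 t\<close>.\<close>
  then have pB: "0 < 1 / (real B + 1)" by simp
  have l1: "((\<lambda>t. t * real A) \<longlongrightarrow> 0) (at_right 0)" by (auto intro!: tendsto_eq_intros)
  have l2: "((\<lambda>t. m * t * real B + t * real A) \<longlongrightarrow> 0) (at_right 0)" by (auto intro!: tendsto_eq_intros)
  have "eventually (\<lambda>t. 2 * (1 + (1 + m) * t) \<le> q * (t + ?k2 t)) (at_right 0)"
    using eventually_at_right_less[of "0::real"]
      order_tendstoD(2)[OF l1 pB] order_tendstoD(2)[OF l2 zero_less_one]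
  proof eventually_elim
    case (elim t)
    have tA: "t * real A < 1 / (real B + 1)" using elim B by simp
    have "1 / (real B + 1) < 1" using B by simp
    then have pos: "1 - t * real A > 0" using tA by linarith
    show ?case
    proof (rule knapp)
      show "t > 0" "?k2 t > 0" using elim pos B by auto
      show "m * t \<le> ?k2 t" using elim B by (simp add: pos_le_divide_eq)
      fix j k assume jk: "(j, k) \<in> S"
      show "1 \<le> t * real j + ?k2 t * real k"
      proof (cases "k = B")
        case True
        then have "t * real A \<le> t * real j" using S[OF jk] elim by simp
        then show ?thesis using True B by simp
      next
        case False
        then have "real B + 1 \<le> real k" using S[OF jk] by auto
        then have "?k2 t * (real B + 1) \<le> ?k2 t * real k" using pos B by (intro mult_left_mono) auto
        moreover have "1 \<le> ?k2 t * (real B + 1)"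
        proof -
          have "t * real A * (real B + 1) \<le> 1" using tA B by (simp add: field_simps)
          then have "real B \<le> (1 - t * real A) * (real B + 1)" by (simp add: algebra_simps)
          then show ?thesis using B by (simp add: field_simps)
        qed
        moreover have "t * real j \<ge> 0" using elim by simp
        ultimately show ?thesis by linarith
      qed
    qed
  qed
  moreover have "((\<lambda>t. 2 * (1 + (1 + m) * t)) \<longlongrightarrow> 2) (at_right 0)" by (auto intro!: tendsto_eq_intros)
  moreover have "((\<lambda>t. q * (t + ?k2 t)) \<longlongrightarrow> q * (1 / real B)) (at_right 0)"
    using B by (auto intro!: tendsto_eq_intros)
  ultimately have "2 \<le> q * (1 / real B)"
    by (intro tendsto_le[OF trivial_limit_at_right_real])
  then show ?thesis using B by (simp add: field_simps)
qed (use q in simp)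

theorem theorem1p8:
  fixes \<phi> :: "real \<times> real \<Rightarrow> real" and \<psi> :: "real \<Rightarrow> real"
  assumes "smooth_near_0 \<phi>" and "finite_type \<phi>"
    and "\<phi> 0 = 0" and "GDERIV \<phi> 0 :> 0"
    and "linearly_adapted \<phi>" and "\<not> adapted \<phi>"
    and "0 < fst (principal_weight \<phi>)"
    and "fst (principal_weight \<phi>) \<le> snd (principal_weight \<phi>)"
    and "principal_root_jet \<phi> \<psi>"
  shows "\<exists>\<delta>>0. \<forall>\<Omega>. open \<Omega> \<and> 0 \<in> \<Omega> \<and> \<Omega> \<subseteq> ball 0 \<delta> \<longrightarrow>
    (\<forall>(p::real) (p'::ereal) (\<rho> :: real \<times> real \<times> real \<Rightarrow> real).
       1 \<le> p \<and> 1 \<le> p' \<and> 1 / ereal p + 1 / p' = 1 \<and>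
       smooth_compactly_supported_on_graph \<Omega> \<phi> \<rho> \<and> (\<forall>x\<in>graph_map \<phi> ` \<Omega>. 0 \<le> \<rho> x) \<and>
       restriction_estimate (surface_measure \<Omega> \<phi>) \<rho> p \<and> \<rho> 0 \<noteq> 0
       \<longrightarrow> ereal (2 * restriction_height \<phi> \<psi> + 2) \<le> p')"
proof -
  define k1 k2 where "k1 = fst (principal_weight \<phi>)" and "k2 = snd (principal_weight \<phi>)"
  have k: "k1 > 0" "k2 > 0" "k1 \<le> k2" using assms(7,8) by (auto simp: k1_def k2_def)
  define S where "S = taylor_support (shear \<psi> \<phi>)"
  obtain U where U: "open U" "0 \<in> U" "smooth_on U \<phi>" using assms(1) by (auto simp: smooth_near_0_def)
  then obtain \<delta> where \<delta>: "\<delta> > 0" "ball 0 \<delta> \<subseteq> U" using openE by blast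
  have ne: "taylor_support \<phi> \<noteq> {}" using assms(2) by (simp add: finite_type_def)
  have 0: "(0, 0) \<notin> taylor_support \<phi>" using assms(3) by (simp add: taylor_support_def taylor_coeff_def)
  obtain b m0 C r where root: "varchenko_root \<phi> b m0" and \<psi>: "smooth_near_0 \<psi>"
    and Cr: "C \<ge> 0" "r > 0" "\<And>s. \<bar>s\<bar> \<le> r \<Longrightarrow> \<bar>\<psi> s\<bar> \<le> C * \<bar>s\<bar> ^ m0"
    using principal_root_jet_order[OF assms(9,6)] by blast
  define m where "m = principal_exponent \<phi>"
  note pw = varchenko_root_exponent[OF ne 0 root, folded k1_def k2_def, OF k(1,2)]
  have m: "m = real m0" "m = k2 / k1"
    using pw(1) by (auto simp: m_def principal_exponent_def k1_def k2_def)
  have m1: "m \<ge> 1" using k by (simp add: m(2))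
  then have m0: "m0 \<ge> 1" using m(1) by simp
  have powr_bd: "\<bar>\<psi> s\<bar> \<le> C * \<bar>s\<bar> powr m" if "\<bar>s\<bar> \<le> r" for s
  proof (cases "s = 0")
    case False
    then show ?thesis using Cr(3)[OF that] by (simp add: m(1) powr_realpow)
  qed (use Cr(3)[OF that] m0 in \<open>simp add: power_0_left\<close>)
  \<comment> \<open>The linear bound yields \<open>\<psi> 0 = 0\<close>, so the shear fixes the
    origin, and controls the shear in \<open>shear_finite_type\<close>.\<close>
  have lin_bd: "\<bar>\<psi> s\<bar> \<le> C * \<bar>s\<bar>" if "\<bar>s\<bar> \<le> min 1 r" for s
  proof -
    have "\<bar>s\<bar> ^ m0 \<le> \<bar>s\<bar> ^ 1" using that m0 by (intro power_decreasing) auto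
    then have "C * \<bar>s\<bar> ^ m0 \<le> C * \<bar>s\<bar>" using Cr(1) by (intro mult_left_mono) auto
    then show ?thesis using Cr(3)[of s] that by simp
  qed
  have "\<psi> 0 = 0" using lin_bd[of 0] Cr(2) by simp
  then have sm: "smooth_near_0 (shear \<psi> \<phi>)" by (intro smooth_near_0_shear assms(1) \<psi>)
  have S: "S \<noteq> {}"
    unfolding S_def by (rule shear_finite_type[where r = "min 1 r", OF assms(1,2) sm Cr(1) _ lin_bd]) (use Cr(2) in simp_all)
  have "ereal (2 * restriction_height \<phi> \<psi> + 2) \<le> p'"
    if \<Omega>: "open \<Omega>" "0 \<in> \<Omega>" "\<Omega> \<subseteq> ball 0 \<delta>" and p: "1 \<le> p" "1 \<le> p'" "1 / ereal p + 1 / p' = 1"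
      and \<rho>: "smooth_compactly_supported_on_graph \<Omega> \<phi> \<rho>" "\<forall>x\<in>graph_map \<phi> ` \<Omega>. 0 \<le> \<rho> x" "\<rho> 0 \<noteq> 0"
      and rest: "restriction_estimate (surface_measure \<Omega> \<phi>) \<rho> p"
    for \<Omega> p p' \<rho>
  proof (cases p')
    case (real q)
    have q: "q \<ge> 1" using p(2) real by simp
    have pq: "1 / p + 1 / q = 1" using p q real by (simp add: one_ereal_def)
    then have q': "1 - 1 / p = 1 / q" by simp
    have "1 / q > 0" using q by simp
    then have "1 / p < 1" using pq by linarith
    then have p1: "p > 1" using p(1) by (simp add: field_simps)
    have sm\<Omega>: "smooth_on \<Omega> \<phi>" using smooth_on_subset[OF U(3)] \<Omega>(3) \<delta>(2) by blast
    have knapp: "2 * (1 + (1 + \<mu>) * \<kappa>1) \<le> q * (\<kappa>1 + \<kappa>2)"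
      if \<eta>: "smooth_near_0 \<eta>" "smooth_near_0 (shear \<eta> \<phi>)"
        "\<exists>C\<ge>0. \<exists>r>0. \<forall>s. \<bar>s\<bar> \<le> r \<longrightarrow> \<bar>\<eta> s\<bar> \<le> C * \<bar>s\<bar> powr \<mu>"
      and \<kappa>: "\<kappa>1 > 0" "\<kappa>2 > 0" "0 < \<mu>" "\<mu> * \<kappa>1 \<le> \<kappa>2"
      and supp: "\<And>j k. (j, k) \<in> taylor_support (shear \<eta> \<phi>) \<Longrightarrow> 1 \<le> \<kappa>1 * real j + \<kappa>2 * real k"
      for \<eta> \<mu> \<kappa>1 \<kappa>2
    proof -
      have "(1 + (1 + \<mu>) * \<kappa>1) * (1 / q) \<le> (\<kappa>1 + \<kappa>2) / 2"
        unfolding q'[symmetric]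
        by (rule knapp_bound[OF \<eta>(2) \<kappa>(1,2) supp \<eta>(1,3) \<kappa>(3,4) \<Omega>(1,2) sm\<Omega> assms(3) \<rho> rest p1])
      then show ?thesis using q by (simp add: field_simps)
    qed
    have knapp\<psi>: "2 * (1 + (1 + m) * \<kappa>1) \<le> q * (\<kappa>1 + \<kappa>2)"
      if "0 < \<kappa>1" "0 < \<kappa>2" "m * \<kappa>1 \<le> \<kappa>2" "\<And>j k. (j, k) \<in> S \<Longrightarrow> 1 \<le> \<kappa>1 * real j + \<kappa>2 * real k"
      for \<kappa>1 \<kappa>2
      by (rule knapp[OF \<psi> sm _ that(1,2) _ that(3) that(4)[unfolded S_def]])
         (use Cr powr_bd m1 in auto)
    have "2 * restriction_height \<phi> \<psi> + 2 \<le> q"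
      using S unfolding S_def
    proof (cases rule: restriction_height_cases)
      case 1
      define d where "d = newton_distance \<phi>"
      have d: "(k1 + k2) * d = 1" using pw(2) by (simp add: d_def)
      then have d0: "d > 0" using k by (metis add_pos_pos zero_less_mult_pos zero_less_one)
      \<comment> \<open>In the original coordinates the piece is a rectangle; taking
        \<open>\<mu> = k2 / k1\<close> gives the box the same height \<open>e powr k2\<close> up to
        a constant. Multiplication by \<open>d = 1 / (k1 + k2)\<close> then produces
        \<open>2 * d + 2\<close>.\<close>
      have "2 * (1 + (1 + k2 / k1) * k1) \<le> q * (k1 + k2)"
      proof (rule knapp[of "\<lambda>_. 0"])
        show "smooth_near_0 (\<lambda>_::real. 0::real)"
          unfolding smooth_near_0_def using smooth_on_const open_UNIV by blast
        show "\<exists>C\<ge>0. \<exists>r>0. \<forall>s. \<bar>s\<bar> \<le> r \<longrightarrow> \<bar>0::real\<bar> \<le> C * \<bar>s\<bar> powr (k2 / k1)"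
          by (intro exI[of _ 0] conjI exI[of _ 1]) auto
      qed (use assms(1) k pw(3) in auto)
      moreover have "(1 + k2 / k1) * k1 = k1 + k2" using k by (simp add: distrib_right)
      ultimately have "2 * (1 + (k1 + k2)) \<le> q * (k1 + k2)" by simp
      then have "2 * (1 + (k1 + k2)) * d \<le> q * (k1 + k2) * d"
        using d0 by (intro mult_right_mono) auto
      moreover have "2 * (1 + (k1 + k2)) * d = 2 * d + 2 * ((k1 + k2) * d)" by (simp add: algebra_simps)
      moreover have "q * (k1 + k2) * d = q" using d by (simp only: mult.assoc mult_1_right)
      ultimately have "2 * d + 2 \<le> q" using d by linarith
      then show ?thesis using 1 by (simp add: d_def)
    next
      case 2
      obtain A B where AB: "last_vertex (newton_hull S) = (real A, real B)"
        "\<And>j k. (j, k) \<in> S \<Longrightarrow> B < k \<or> k = B \<and> A \<le> j"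
        using last_vertex_newton_hull[OF S] by blast
      \<comment> \<open>This is the required bound, because
        \<open>2 * (B - 1) + 2 = 2 * B\<close>.\<close>
      have "2 * real B \<le> q"
        using q by (intro last_vertex_bound[OF AB(2) knapp\<psi>]) auto
      then show ?thesis using 2 AB(1) by (simp add: S_def)
    next
      case (3 \<gamma>)
      obtain \<kappa>1 \<kappa>2 where \<kappa>: "\<kappa>1 > 0" "\<kappa>2 > 0" "edge_weight \<gamma> = (\<kappa>1, \<kappa>2)"
        "\<And>j k. (j, k) \<in> S \<Longrightarrow> 1 \<le> \<kappa>1 * real j + \<kappa>2 * real k"
        using compact_edge_weight[OF 3(1)[folded S_def] S] by blast
      have "m * \<kappa>1 \<le> \<kappa>2" using 3(2) \<kappa> by (simp add: m_def field_simps)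
      then have "2 * (1 + (1 + m) * \<kappa>1) \<le> q * (\<kappa>1 + \<kappa>2)" using \<kappa> by (intro knapp\<psi>)
      moreover have "restriction_height \<phi> \<psi> * (\<kappa>1 + \<kappa>2) = 1 + m * \<kappa>1 - \<kappa>2"
        using 3(3) \<kappa> by (simp add: edge_height_def m_def)
      ultimately have "(2 * restriction_height \<phi> \<psi> + 2) * (\<kappa>1 + \<kappa>2) \<le> q * (\<kappa>1 + \<kappa>2)"
        by (simp add: algebra_simps)
      then show ?thesis using \<kappa> by simp
    qed
    then show ?thesis using real by simp
  \<comment> \<open>For \<open>p' = \<infinity>\<close>, the dual of \<open>p = 1\<close>, the
    conclusion is immediate; the value minus infinity contradicts \<open>1 \<le> p'\<close>.\<close>
  qed (use p in auto)
  then show ?thesis using \<delta>(1) by blast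
qed

end
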